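(* Let $\Bbbk$ be an algebraically closed field with $\mathrm{char}\,\Bbbk\neq2$, let $V=\Bbbk^{M+1}$ and let $X\subsetneq\mathbb{P}^M=\mathbb{P}(V)$ be a reduced and irreducible subvariety. Denote by $\mathcal{S}=\mathbb{P}(\mathrm{Sym}^2V^\vee)$ the space of symmetric bilinear forms on $V$ up to scaling and, for $q\in\mathcal{S}$ nondegenerate, by $$\Delta_q=\overline{\left\{([x],[qx])\ \vert\ x\in V\setminus\{0\}\right\}}\subseteq\mathbb{P}^M\times\mathbb{P}(V^\vee)$$ the diagonal induced by $q$. Then there exists a nonempty Zariski open subset $U\subseteq\mathcal{S}$, consisting of nondegenerate forms, such that $$\mathcal{N}_X\cap\Delta_q=\emptyset\qquad\text{for every } q\in U.$$
   Context: $\mathbb{P}(E)$ is the space of lines in $E$. For a symmetric bilinear form $q$ and $x\in V$, $qx\in V^\vee$ denotes the functional $q(x,\cdot)$. The conormal variety of $X$ is the closure $\mathcal{N}_X=\overline{\{(x,H): x\in X_{\mathrm{reg}},\ T_xX\subseteq H\}}\subseteq\mathbb{P}^M\times\mathbb{P}(V^\vee)$, where $T_xX$ is the embedded projective tangent space and hyperplanes $H$ of $\mathbb{P}^M$ are identified with points of $\mathbb{P}(V^\vee)$. *)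

theory Defs
  imports
    "HOL-Analysis.Analysis"
    "HOL-Library.Poly_Mapping"
    "HOL-Computational_Algebra.Computational_Algebra"
begin

section \<open>Polynomials in finitely many variables\<close>

text \<open>A monomial is its exponent vector; a polynomial is a finitely supported
  family of coefficients indexed by monomials.\<close>

type_synonym ('i, 'k) mpoly = "('i \<Rightarrow>\<^sub>0 nat) \<Rightarrow>\<^sub>0 'k"

definition meval :: "('i::finite, 'k::comm_ring_1) mpoly \<Rightarrow> ('i \<Rightarrow> 'k) \<Rightarrow> 'k" where
  "meval p a = (\<Sum>m\<in>Poly_Mapping.keys p.
      Poly_Mapping.lookup p m * (\<Prod>i\<in>UNIV. a i ^ Poly_Mapping.lookup m i))"

text \<open>Below, the truncated subtraction of exponents is harmless: if \<open>i\<close> does not occur in \<open>m\<close>,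
  the coefficient is multiplied by \<open>0\<close>.\<close>

definition mpderiv :: "'i \<Rightarrow> ('i::finite, 'k::comm_ring_1) mpoly \<Rightarrow> ('i, 'k) mpoly" where
  "mpderiv i p = (\<Sum>m\<in>Poly_Mapping.keys p.
      Poly_Mapping.single (m - Poly_Mapping.single i 1)
        (of_nat (Poly_Mapping.lookup m i) * Poly_Mapping.lookup p m))"

definition homogeneous :: "nat \<Rightarrow> ('i::finite, 'k::comm_ring_1) mpoly \<Rightarrow> bool" where
  "homogeneous d p \<longleftrightarrow>
     (\<forall>m\<in>Poly_Mapping.keys p. (\<Sum>i\<in>UNIV. Poly_Mapping.lookup m i) = d)"

definition bihomogeneous ::
    "nat \<Rightarrow> nat \<Rightarrow> ('i::finite + 'j::finite, 'k::comm_ring_1) mpoly \<Rightarrow> bool" where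
  "bihomogeneous d e p \<longleftrightarrow> (\<forall>m\<in>Poly_Mapping.keys p.
     (\<Sum>i\<in>UNIV. Poly_Mapping.lookup m (Inl i)) = d \<and>
     (\<Sum>j\<in>UNIV. Poly_Mapping.lookup m (Inr j)) = e)"

section \<open>Projective spaces and their Zariski topologies\<close>

abbreviation line :: "'k::field ^ 'n \<Rightarrow> ('k ^ 'n) set" where
  "line x \<equiv> vec.span {x}"

definition proj_space :: "('k::field ^ 'n) set \<Rightarrow> ('k ^ 'n) set set" where
  "proj_space E = {line x | x. x \<in> E \<and> x \<noteq> 0}"

text \<open>The sets of points at which a (bi)homogeneous polynomial does not vanish are closed under
  finite intersections, so they form a base of the (usual) Zariski topology: the closed sets are
  the common zero sets of families of (bi)homogeneous polynomials. Whether a (bi)homogeneous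
  polynomial vanishes does not depend on the choice of nonzero representatives.\<close>

definition zariski :: "('k::field ^ 'n) set topology" where
  "zariski = topology_generated_by
     {{P \<in> proj_space UNIV. \<exists>x\<in>P. meval p (($) x) \<noteq> 0} | p d. homogeneous d p}"

definition bizariski :: "(('k::field ^ 'n) set \<times> ('k ^ 'm) set) topology" where
  "bizariski = topology_generated_by
     {{(P, H). P \<in> proj_space UNIV \<and> H \<in> proj_space UNIV \<and>
         (\<exists>x\<in>P. \<exists>y\<in>H. meval p (case_sum (($) x) (($) y)) \<noteq> 0)} | p d e. bihomogeneous d e p}"

definition irreducible_in :: "'a topology \<Rightarrow> 'a set \<Rightarrow> bool" where
  "irreducible_in T A \<longleftrightarrow> A \<noteq> {} \<and> A \<subseteq> topspace T \<and>
     (\<forall>C D. closedin T C \<and> closedin T D \<and> A \<subseteq> C \<union> D \<longrightarrow> A \<subseteq> C \<or> A \<subseteq> D)"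

text \<open>Over an algebraically closed field, reduced and irreducible closed subschemes of projective
  space are given by their sets of closed points.\<close>

definition projective_variety :: "('k::field ^ 'n) set set \<Rightarrow> bool" where
  "projective_variety X \<longleftrightarrow> closedin zariski X \<and> irreducible_in zariski X"

text \<open>Krull dimension.\<close>

definition variety_dim :: "('k::field ^ 'n) set set \<Rightarrow> enat" where
  "variety_dim X = Sup {enat r | r. \<exists>Z.
     (\<forall>i\<le>r. closedin zariski (Z i) \<and> irreducible_in zariski (Z i) \<and> Z i \<subseteq> X) \<and>
     (\<forall>i<r. Z i \<subset> Z (Suc i))}"

section \<open>Tangent spaces and regular points\<close>

definition vanishing_forms :: "('k::field ^ 'n) set set \<Rightarrow> ('n, 'k) mpoly set" where
  "vanishing_forms X =
     {p. (\<exists>d. homogeneous d p) \<and> (\<forall>P\<in>X. \<forall>x\<in>P. meval p (($) x) = 0)}"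

text \<open>The linear subspace whose projectivization is the embedded tangent space of \<open>X\<close> at \<open>P\<close>.
  The conditions for different \<open>x \<noteq> 0\<close> in the line \<open>P\<close> are equivalent.\<close>

definition tangent_cone :: "('k::field ^ 'n) set set \<Rightarrow> ('k ^ 'n) set \<Rightarrow> ('k ^ 'n) set" where
  "tangent_cone X P = {v. \<forall>p\<in>vanishing_forms X. \<forall>x\<in>P - {0}.
     (\<Sum>i\<in>UNIV. meval (mpderiv i p) (($) x) * v $ i) = 0}"

definition embedded_tangent_space ::
    "('k::field ^ 'n) set set \<Rightarrow> ('k ^ 'n) set \<Rightarrow> ('k ^ 'n) set set" where
  "embedded_tangent_space X P = proj_space (tangent_cone X P)"

text \<open>Jacobian criterion: the projective space \<open>embedded_tangent_space X P\<close>, of dimension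
  \<open>vec.dim (tangent_cone X P) - 1\<close>, has the same dimension as \<open>X\<close>.\<close>

definition regular_points :: "('k::field ^ 'n) set set \<Rightarrow> ('k ^ 'n) set set" where
  "regular_points X = {P \<in> X. enat (vec.dim (tangent_cone X P)) = variety_dim X + 1}"

section \<open>The dual space and conormal varieties\<close>

text \<open>\<open>y\<close> is the coordinate vector, with respect to the dual basis, of the functional
  \<open>functional y\<close>. In this way the dual of \<open>'k ^ 'n\<close> is identified with \<open>'k ^ 'n\<close>.\<close>

definition functional :: "'k::field ^ 'n \<Rightarrow> 'k ^ 'n \<Rightarrow> 'k" where
  "functional y v = (\<Sum>i\<in>UNIV. y $ i * v $ i)"

lemma functional_axis: "functional y (axis i 1) = y $ i"
  by (simp add: functional_def axis_def if_distrib cong: if_cong)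

lemma ex1_functional:
  fixes f :: "'k::field ^ 'n \<Rightarrow> 'k"
  assumes "\<And>v w. f (v + w) = f v + f w" and "\<And>c v. f (c *s v) = c * f v"
  shows "\<exists>!y. f = functional y"
proof -
  have f0: "f 0 = 0"
    using assms(2)[of 0 0] by simp
  have f_sum: "f (sum g A) = (\<Sum>i\<in>A. f (g i))" if "finite A" for g :: "'n \<Rightarrow> _" and A
    using that by (induction A rule: finite_induct) (simp_all add: f0 assms(1))
  have "f v = functional (\<chi> i. f (axis i 1)) v" for v
  proof -
    have "f v = f (\<Sum>i\<in>UNIV. v $ i *s axis i 1)"
      by (simp add: basis_expansion)
    also have "\<dots> = functional (\<chi> i. f (axis i 1)) v"
      by (simp add: f_sum assms(2) functional_def mult.commute)
    finally show ?thesis .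
  qed
  moreover have "y = z" if "functional y = functional z" for y z :: "'k ^ 'n"
    using that by (metis functional_axis vec_eq_iff)
  ultimately show ?thesis
    by (metis ext)
qed

definition hyperplane :: "'k::field ^ 'n \<Rightarrow> ('k ^ 'n) set set" where
  "hyperplane y = proj_space {v. functional y v = 0}"

definition conormal_variety ::
    "('k::field ^ 'n) set set \<Rightarrow> (('k ^ 'n) set \<times> ('k ^ 'n) set) set" where
  "conormal_variety X = bizariski closure_of
     {(P, line y) | P y. P \<in> regular_points X \<and> y \<noteq> 0 \<and>
        embedded_tangent_space X P \<subseteq> hyperplane y}"

section \<open>Bilinear forms\<close>

text \<open>A bilinear form is given by its Gram matrix, indexed by pairs so that the space of all
  bilinear forms is again a coordinate space.\<close>

definition bilin :: "'k::field ^ ('n::finite \<times> 'n) \<Rightarrow> 'k ^ 'n \<Rightarrow> 'k ^ 'n \<Rightarrow> 'k" where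
  "bilin q x y = (\<Sum>i\<in>UNIV. \<Sum>j\<in>UNIV. q $ (i, j) * x $ i * y $ j)"

definition sym_forms :: "('k::field ^ ('n::finite \<times> 'n)) set" where
  "sym_forms = {q. \<forall>x y. bilin q x y = bilin q y x}"

definition nondegenerate :: "'k::field ^ ('n::finite \<times> 'n) \<Rightarrow> bool" where
  "nondegenerate q \<longleftrightarrow> (\<forall>x. (\<forall>y. bilin q x y = 0) \<longrightarrow> x = 0)"

definition sym_zariski :: "('k::field ^ ('n::finite \<times> 'n)) set topology" where
  "sym_zariski = subtopology zariski (proj_space sym_forms)"

definition flat :: "'k::field ^ ('n::finite \<times> 'n) \<Rightarrow> 'k ^ 'n \<Rightarrow> 'k ^ 'n" where
  "flat q x = (\<chi> j. \<Sum>i\<in>UNIV. q $ (i, j) * x $ i)"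

lemma functional_flat: "functional (flat q x) = bilin q x"
proof
  fix y
  have "functional (flat q x) y = (\<Sum>j\<in>UNIV. \<Sum>i\<in>UNIV. q $ (i, j) * x $ i * y $ j)"
    by (simp add: functional_def flat_def sum_distrib_right)
  also have "\<dots> = bilin q x y"
    unfolding bilin_def by (rule sum.swap)
  finally show "functional (flat q x) y = bilin q x y" .
qed

definition form_diagonal ::
    "'k::field ^ ('n::finite \<times> 'n) \<Rightarrow> (('k ^ 'n) set \<times> ('k ^ 'n) set) set" where
  "form_diagonal q = bizariski closure_of {(line x, line (flat q x)) | x. x \<noteq> 0}"

end

theory Submission
  imports Defs "HOL-Library.Function_Algebras"
begin

text \<open>
  The theorem is a dimension count. Write \<open>n = M + 1\<close> and let \<open>r\<close> be the dimension of \<open>X\<close>. The conormal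
  variety has dimension \<open>M - 1\<close>, because over a regular point the hyperplanes containing the tangent
  space form a projective space of dimension \<open>M - 1 - r\<close>. For a given point \<open>([x], [y])\<close>, the condition
  \<open>[qx] = [y]\<close> imposes \<open>M\<close> conditions on \<open>q\<close>. So the bad forms \<open>q\<close>, those with \<open>([x], [qx])\<close> in the
  conormal variety for some \<open>x\<close>, have dimension at most \<open>dim S - 1\<close>, where \<open>S\<close> is the space of symmetric
  forms, and a general \<open>q\<close> is not bad. For nondegenerate \<open>q\<close>, the points \<open>([x], [qx])\<close> are all the points of
  the diagonal of \<open>q\<close> (\<open>form_diagonal_points\<close>).

  The count is carried out with Hilbert functions instead of dimensions. Two things are gained: no theory
  of dimensions of fibres is needed, and the open set comes directly as the nonvanishing set of
  a form, without elimination theory. The bad forms are parametrized, in a chart \<open>x $ i0 = 1\<close>, by \<open>x\<close> on the cone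
  over \<open>X\<close>, by the coefficients of \<open>y\<close> with respect to gradients of \<open>n - 1 - r\<close> equations of \<open>X\<close>, and by a minor
  of \<open>q\<close> (\<open>completion\<close>). Monomials in the entries of \<open>q\<close>, pulled back to these parameters, lie in a space
  whose dimension grows more slowly with the degree than the number of monomials. Hence there is a
  linear relation, that is, a nonzero form vanishing at all bad \<open>q\<close> (\<open>relation_among_completions\<close>,
  \<open>bad_forms_in_hypersurface\<close>). Passing from regular points to the closure costs nothing, since
  polynomial identities extend to closures (\<open>polynomial_vanishes_on_closure\<close>).

  This needs a bound on the growth of the homogeneous coordinate ring of \<open>X\<close> in terms of the combinatorial
  dimension \<open>variety_dim\<close> (\<open>hilbert_growth_variety_dim\<close>). It rests on two facts. If chains of
  irreducible closed subsets of \<open>X\<close> have length at most \<open>r\<close>, then \<open>X\<close> has \<open>r + 1\<close> linear forms without common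
  zero (\<open>linear_forms_without_common_zero\<close>), by the finiteness of irreducible components, which comes
  from Hilbert's basis theorem (\<open>noetherian_adjoin\<close>). By the projective Nullstellensatz
  (\<open>projective_nullstellensatz\<close>), the coordinate ring is then finite over the polynomials in these forms.
  The basis theorem is used a second time to see that finitely many equations yield all the conormal
  spaces (\<open>finite_gradient_generators\<close>), so that finitely many choices of \<open>n - 1 - r\<close> equations suffice
  (\<open>conormal_pieces\<close>).
\<close>

section \<open>Spaces of polynomial functions\<close>

lemma infinite_UNIV_alg_closed: "infinite (UNIV :: 'k::alg_closed_field set)"
proof
  assume fin: "finite (UNIV :: 'k set)"
  let ?p = "(\<Prod>a\<in>(UNIV::'k set). [:-a, 1:]) + 1"
  have "degree (\<Prod>a\<in>(UNIV::'k set). [:-a, 1:]) = card (UNIV::'k set)"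
    by (subst degree_prod_eq_sum_degree) auto
  also have "\<dots> > 0" using fin by (simp add: card_gt_0_iff)
  finally have "degree ?p > 0"
    by (subst degree_add_eq_left) auto
  then obtain x where "poly ?p x = 0" using alg_closed_imp_poly_has_root by blast
  moreover have "poly (\<Prod>a\<in>(UNIV::'k set). [:-a, 1:]) x = 0"
    using fin by (auto simp: poly_prod prod_zero_iff intro!: bexI[of _ x])
  ultimately show False by simp
qed

lemma poly_fun_zero_imp_zero:
  fixes P :: "'k::alg_closed_field poly"
  assumes "\<And>c. c \<noteq> 0 \<Longrightarrow> poly P c = 0"
  shows "P = 0"
proof (rule ccontr)
  assume "P \<noteq> 0"
  then have "finite {c. poly P c = 0}" by (rule poly_roots_finite)
  moreover have "UNIV \<subseteq> insert 0 {c. poly P c = 0}" using assms by auto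
  ultimately show False
    using infinite_UNIV_alg_closed[where 'k='k] by (meson finite.insertI finite_subset)
qed

lemma poly_fun_eq_imp_eq:
  fixes P :: "'k::alg_closed_field poly"
  assumes "\<And>c. poly P c = poly Q c"
  shows "P = Q"
  using poly_fun_zero_imp_zero[of "P - Q"] assms by simp

definition fscale :: "'k::field \<Rightarrow> ('p \<Rightarrow> 'k) \<Rightarrow> 'p \<Rightarrow> 'k" where
  "fscale c f = (\<lambda>p. c * f p)"

lemma fscale_apply: "fscale c f p = c * f p"
  by (simp add: fscale_def)

interpretation fs: vector_space "fscale :: 'k::field \<Rightarrow> ('p \<Rightarrow> 'k) \<Rightarrow> 'p \<Rightarrow> 'k"
  by unfold_locales (auto simp: fun_eq_iff fscale_apply algebra_simps)

lemma span_mult: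
  assumes "\<And>a b. a \<in> A \<Longrightarrow> b \<in> B \<Longrightarrow> a * b \<in> fs.span C"
    and "f \<in> fs.span A" and "g \<in> fs.span B"
  shows "f * g \<in> fs.span C"
proof -
  have 1: "a * g \<in> fs.span C" if "a \<in> A" for a
    using assms(3)
  proof (induction rule: fs.span_induct_alt)
    case base
    have "a * 0 = 0" by (simp add: fun_eq_iff fscale_apply)
    then show ?case by (metis fs.span_zero)
  next
    case (step c x y)
    have "a * (fscale c x + y) = fscale c (a * x) + a * y"
      by (simp add: fun_eq_iff fscale_apply algebra_simps)
    then show ?case using step assms(1)[OF that] by (metis fs.span_add fs.span_scale)
  qed
  show ?thesis using assms(2)
  proof (induction rule: fs.span_induct_alt)
    case base
    have "0 * g = 0" by (simp add: fun_eq_iff fscale_apply)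
    then show ?case by (metis fs.span_zero)
  next
    case (step c x y)
    have "(fscale c x + y) * g = fscale c (x * g) + y * g"
      by (simp add: fun_eq_iff fscale_apply algebra_simps)
    then show ?case using step 1 by (metis fs.span_add fs.span_scale)
  qed
qed

lemma sum_fun_apply: "(\<Sum>a\<in>A. f a) p = (\<Sum>a\<in>A. f a p)"
  by (induction A rule: infinite_finite_induct) simp_all

lemma span_sum_scale:
  "finite A \<Longrightarrow> (\<And>a. a \<in> A \<Longrightarrow> f a \<in> fs.span B) \<Longrightarrow> (\<lambda>p. \<Sum>a\<in>A. u a * f a p) \<in> fs.span B"
proof (induction A rule: finite_induct)
  case empty
  have eq: "(\<lambda>p. \<Sum>a\<in>{}. u a * f a p) = 0" by (simp add: fun_eq_iff fscale_apply)
  show ?case unfolding eq by (rule fs.span_zero)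
next
  case (insert a A)
  have "(\<lambda>p. \<Sum>x\<in>insert a A. u x * f x p) = fscale (u a) (f a) + (\<lambda>p. \<Sum>a\<in>A. u a * f a p)"
    using insert by (simp add: fun_eq_iff fscale_apply)
  moreover have "f a \<in> fs.span B" "(\<lambda>p. \<Sum>a\<in>A. u a * f a p) \<in> fs.span B"
    using insert by auto
  ultimately show ?case by (simp only: fs.span_add fs.span_scale)
qed

text \<open>The family may repeat a vector; then the difference of two equal members is already a relation.\<close>

lemma linear_relation_if_card_less:
  assumes "finite E" "finite B" "card B < card E" "\<And>e. e \<in> E \<Longrightarrow> H e \<in> fs.span B"
  shows "\<exists>u. (\<exists>e\<in>E. u e \<noteq> 0) \<and> (\<forall>p. (\<Sum>e\<in>E. u e * H e p) = 0)"
proof (cases "inj_on H E")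
  case True
  have "fs.dependent (H ` E)"
  proof (rule ccontr)
    assume "\<not> fs.dependent (H ` E)"
    then have "card (H ` E) \<le> card B"
      using fs.independent_span_bound[OF assms(2)] assms(4) by blast
    then show False using assms(3) True by (simp add: card_image)
  qed
  then obtain w where w: "\<exists>v\<in>H ` E. w v \<noteq> 0" "(\<Sum>v\<in>H ` E. fscale (w v) v) = 0"
    using fs.dependent_finite[of "H ` E"] assms(1) by auto
  have "(\<Sum>e\<in>E. w (H e) * H e p) = (\<Sum>v\<in>H ` E. fscale (w v) v) p" for p
    using True by (simp add: sum.reindex sum_fun_apply fscale_apply)
  then show ?thesis using w by (intro exI[of _ "\<lambda>e. w (H e)"]) auto
next
  case False
  then obtain a b where ab: "a \<in> E" "b \<in> E" "a \<noteq> b" "H a = H b" by (auto simp: inj_on_def)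
  let ?u = "\<lambda>e. if e = a then 1 else if e = b then - 1 else 0"
  have "(\<Sum>e\<in>E. ?u e * H e p) = (\<Sum>e\<in>{a, b}. ?u e * H e p)" for p
    by (rule sum.mono_neutral_right) (use ab assms(1) in auto)
  then show ?thesis using ab by (intro exI[of _ ?u]) auto
qed

text \<open>Everything below is phrased with polynomial functions instead of formal polynomials: the
  argument only compares dimensions of spaces of functions on sets of points. The coordinates
  \<open>z\<close> live on an arbitrary type of points, so that the same notions serve vectors, pairs of
  vectors, lists of linear forms and parameter spaces.\<close>

definition mono_fn :: "'v set \<Rightarrow> ('v \<Rightarrow> 'p \<Rightarrow> 'k::field) \<Rightarrow> ('v \<Rightarrow> nat) \<Rightarrow> 'p \<Rightarrow> 'k" where
  "mono_fn V z m = (\<lambda>p. \<Prod>v\<in>V. z v p ^ m v)"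

definition mono_span ::
    "'v set \<Rightarrow> ('v \<Rightarrow> 'p \<Rightarrow> 'k::field) \<Rightarrow> ('v \<Rightarrow> nat) set \<Rightarrow> ('p \<Rightarrow> 'k) set" where
  "mono_span V z M = fs.span (mono_fn V z ` M)"

definition deg_exps :: "'v set \<Rightarrow> nat \<Rightarrow> ('v \<Rightarrow> nat) set" where
  "deg_exps V d = {m. sum m V = d}"

definition bideg_exps :: "'v set \<Rightarrow> 'w set \<Rightarrow> nat \<Rightarrow> nat \<Rightarrow> ('v + 'w \<Rightarrow> nat) set" where
  "bideg_exps V W d e = {m. (\<Sum>v\<in>V. m (Inl v)) = d \<and> (\<Sum>w\<in>W. m (Inr w)) = e}"

lemma mono_fn_mult: "mono_fn V z m * mono_fn V z m' = mono_fn V z (\<lambda>v. m v + m' v)"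
  by (simp add: mono_fn_def fun_eq_iff fscale_apply power_add prod.distrib)

lemma mono_span_mult:
  assumes "\<And>m m'. m \<in> M \<Longrightarrow> m' \<in> M' \<Longrightarrow> (\<lambda>v. m v + m' v) \<in> M''"
    and "f \<in> mono_span V z M" "g \<in> mono_span V z M'"
  shows "f * g \<in> mono_span V z M''"
  using assms(2,3) unfolding mono_span_def
  by (rule span_mult[rotated 1])
    (use assms(1) in \<open>auto simp: mono_fn_mult intro!: fs.span_base\<close>)

lemma deg_span_mult:
  assumes "f \<in> mono_span V z (deg_exps V d)" "g \<in> mono_span V z (deg_exps V e)"
  shows "f * g \<in> mono_span V z (deg_exps V (d + e))"
  by (rule mono_span_mult[OF _ assms]) (auto simp: deg_exps_def sum.distrib)

lemma bideg_span_mult: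
  assumes "f \<in> mono_span V z (bideg_exps A B d e)" "g \<in> mono_span V z (bideg_exps A B d' e')"
  shows "f * g \<in> mono_span V z (bideg_exps A B (d + d') (e + e'))"
  by (rule mono_span_mult[OF _ assms]) (auto simp: bideg_exps_def sum.distrib)

lemma mono_span_add: "f \<in> mono_span V z M \<Longrightarrow> g \<in> mono_span V z M \<Longrightarrow> f + g \<in> mono_span V z M"
  and mono_span_scale: "f \<in> mono_span V z M \<Longrightarrow> fscale c f \<in> mono_span V z M"
  and mono_span_zero: "0 \<in> mono_span V z M"
  and mono_span_base: "m \<in> M \<Longrightarrow> mono_fn V z m \<in> mono_span V z M"
  unfolding mono_span_def
  by (auto intro: fs.span_add fs.span_scale fs.span_zero fs.span_base)

lemma mono_fn_const: "mono_fn V z (\<lambda>_. 0) = 1"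
  by (simp add: mono_fn_def fun_eq_iff fscale_apply)

lemma mono_fn_var: "finite V \<Longrightarrow> v \<in> V \<Longrightarrow> mono_fn V z (\<lambda>w. if w = v then 1 else 0) = z v"
  by (simp add: mono_fn_def fun_eq_iff fscale_apply if_distrib cong: if_cong)

lemma deg_span_one: "1 \<in> mono_span V z (deg_exps V 0)"
  by (metis (mono_tags, lifting) deg_exps_def mem_Collect_eq mono_fn_const mono_span_base sum.neutral_const)

lemma deg_span_var: "finite V \<Longrightarrow> v \<in> V \<Longrightarrow> z v \<in> mono_span V z (deg_exps V 1)"
  using mono_span_base[of "\<lambda>w. if w = v then 1 else 0" "deg_exps V 1" V z]
  by (simp add: mono_fn_var deg_exps_def)

lemma bideg_span_Inl:
  "finite V \<Longrightarrow> finite W \<Longrightarrow> v \<in> V \<Longrightarrow> z (Inl v) \<in> mono_span (V <+> W) z (bideg_exps V W 1 0)"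
  using mono_span_base[of "\<lambda>w. if w = Inl v then 1 else 0" "bideg_exps V W 1 0" "V <+> W" z]
  by (simp add: mono_fn_var bideg_exps_def InlI)

lemma bideg_span_Inr:
  "finite V \<Longrightarrow> finite W \<Longrightarrow> w \<in> W \<Longrightarrow> z (Inr w) \<in> mono_span (V <+> W) z (bideg_exps V W 0 1)"
  using mono_span_base[of "\<lambda>v. if v = Inr w then 1 else 0" "bideg_exps V W 0 1" "V <+> W" z]
  by (simp add: mono_fn_var bideg_exps_def InrI)

lemma deg_span_prod:
  assumes "finite A" "\<And>a. a \<in> A \<Longrightarrow> f a \<in> mono_span V z (deg_exps V (d a))"
  shows "(\<lambda>p. \<Prod>a\<in>A. f a p) \<in> mono_span V z (deg_exps V (sum d A))"
  using assms
proof (induction A rule: finite_induct)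
  case empty
  then show ?case using deg_span_one by (simp add: one_fun_def)
next
  case (insert a A)
  have "(\<lambda>p. \<Prod>a\<in>insert a A. f a p) = f a * (\<lambda>p. \<Prod>a\<in>A. f a p)"
    using insert by (simp add: fun_eq_iff fscale_apply)
  then show ?case using insert deg_span_mult[of "f a" V z "d a"] by simp
qed

lemma bideg_span_one: "1 \<in> mono_span V z (bideg_exps A B 0 0)"
proof -
  have "(\<lambda>_. 0) \<in> bideg_exps A B 0 0" by (simp add: bideg_exps_def)
  then show ?thesis by (metis mono_fn_const mono_span_base)
qed

lemma bideg_span_power:
  assumes "f \<in> mono_span V z (bideg_exps A B d e)"
  shows "(\<lambda>p. f p ^ k) \<in> mono_span V z (bideg_exps A B (k * d) (k * e))"
proof (induction k)
  case 0
  then show ?case using bideg_span_one by (simp add: one_fun_def)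
next
  case (Suc k)
  have "(\<lambda>p. f p ^ Suc k) = f * (\<lambda>p. f p ^ k)" by (simp add: fun_eq_iff fscale_apply)
  then show ?case using bideg_span_mult[OF assms Suc] by simp
qed

lemma bideg_span_prod:
  assumes "finite I" "\<And>i. i \<in> I \<Longrightarrow> f i \<in> mono_span V z (bideg_exps A B (d i) (e i))"
  shows "(\<lambda>p. \<Prod>i\<in>I. f i p) \<in> mono_span V z (bideg_exps A B (sum d I) (sum e I))"
  using assms
proof (induction I rule: finite_induct)
  case empty
  then show ?case using bideg_span_one by (simp add: one_fun_def)
next
  case (insert a I)
  have "(\<lambda>p. \<Prod>a\<in>insert a I. f a p) = f a * (\<lambda>p. \<Prod>a\<in>I. f a p)"
    using insert by (simp add: fun_eq_iff fscale_apply)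
  then show ?case using insert bideg_span_mult[of "f a" V z A B "d a" "e a"] by simp
qed

lemma mono_span_along_curve:
  assumes "f \<in> mono_span V z M" "\<And>v. v \<in> V \<Longrightarrow> \<exists>P. \<forall>c. z v (\<gamma> c) = poly P c"
  shows "\<exists>P. \<forall>c. f (\<gamma> c) = poly P c"
  using assms(1) unfolding mono_span_def
proof (induction rule: fs.span_induct_alt)
  case base
  then show ?case by (intro exI[of _ 0]) simp
next
  case (step c x y)
  obtain P where P: "\<And>v c. v \<in> V \<Longrightarrow> z v (\<gamma> c) = poly (P v) c" using assms(2) by metis
  obtain m where m: "x = mono_fn V z m" using step(1) by blast
  obtain Q where Q: "\<And>c. y (\<gamma> c) = poly Q c" using step(2) by blast
  show ?case
    by (rule exI[of _ "smult c (\<Prod>v\<in>V. P v ^ m v) + Q"])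
      (simp add: fscale_apply m Q mono_fn_def poly_prod P cong: prod.cong)
qed

lemma mono_span_explicit:
  assumes "f \<in> mono_span V z M"
  obtains S c where "finite S" "S \<subseteq> M" "\<And>p. f p = (\<Sum>m\<in>S. c m * mono_fn V z m p)"
proof -
  have "\<exists>S c. finite S \<and> S \<subseteq> M \<and> (\<forall>p. f p = (\<Sum>m\<in>S. c m * mono_fn V z m p))"
    using assms unfolding mono_span_def
  proof (induction rule: fs.span_induct_alt)
    case base
    then show ?case by (intro exI[of _ "{}"]) simp
  next
    case (step a x y)
    then obtain m S c where *: "m \<in> M" "x = mono_fn V z m" "finite S" "S \<subseteq> M"
      "\<And>p. y p = (\<Sum>m\<in>S. c m * mono_fn V z m p)" by blast
    let ?c = "\<lambda>m'. (if m' \<in> S then c m' else 0) + (if m' = m then a else 0)"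
    have "(fscale a x + y) p = (\<Sum>m'\<in>insert m S. ?c m' * mono_fn V z m' p)" for p
    proof -
      have "(\<Sum>m'\<in>insert m S. ?c m' * mono_fn V z m' p)
        = (\<Sum>m'\<in>insert m S. (if m' \<in> S then c m' * mono_fn V z m' p else 0))
          + (\<Sum>m'\<in>insert m S. (if m' = m then a * mono_fn V z m' p else 0))"
        by (subst sum.distrib[symmetric], rule sum.cong) (auto simp: algebra_simps)
      also have "(\<Sum>m'\<in>insert m S. (if m' \<in> S then c m' * mono_fn V z m' p else 0)) = y p"
        unfolding *(5) by (rule sum.mono_neutral_cong_right) (use *(3) in auto)
      finally show ?thesis using *(2,3) by (simp add: fscale_apply)
    qed
    then show ?case using * by (intro exI[of _ "insert m S"] exI[of _ ?c]) auto
  qed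
  then show thesis using that by blast
qed

text \<open>In a fixed degree one exponent is determined by the others. The resulting exponent
  \<open>card V - 1\<close> (and not \<open>card V\<close>) matters: the final dimension count is won by one.\<close>

lemma deg_mono_fns_bound:
  assumes "finite V" "V \<noteq> {}"
  shows "finite (mono_fn V z ` deg_exps V d)
    \<and> card (mono_fn V z ` deg_exps V d) \<le> (d + 1) ^ (card V - 1)"
proof -
  obtain v0 where v0: "v0 \<in> V" using assms by blast
  let ?W = "V - {v0}"
  let ?G = "\<lambda>g. mono_fn V z (g(v0 := d - sum g ?W))"
  have sub: "mono_fn V z ` deg_exps V d \<subseteq> ?G ` (PiE ?W (\<lambda>_. {..d}))"
  proof
    fix f assume "f \<in> mono_fn V z ` deg_exps V d"
    then obtain m where m: "f = mono_fn V z m" "sum m V = d" by (auto simp: deg_exps_def)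
    have le: "m v \<le> d" if "v \<in> V" for v using m(2) member_le_sum[of v V m] that assms by auto
    have sw: "sum (restrict m ?W) ?W = sum m ?W" by (rule sum.cong) auto
    have eq: "m v0 + sum m ?W = d" using m(2) sum.remove[of V v0 m] assms v0 by simp
    have "f = ?G (restrict m ?W)"
      unfolding m(1) mono_fn_def sw using eq by (intro ext prod.cong) auto
    moreover have "restrict m ?W \<in> PiE ?W (\<lambda>_. {..d})" using le by auto
    ultimately show "f \<in> ?G ` (PiE ?W (\<lambda>_. {..d}))" by blast
  qed
  have fin: "finite (PiE ?W (\<lambda>_. {..d}))" using assms by (intro finite_PiE) auto
  have "card (mono_fn V z ` deg_exps V d) \<le> card (PiE ?W (\<lambda>_. {..d}))"
    using sub fin by (meson card_image_le card_mono finite_imageI le_trans)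
  also have "\<dots> = (d + 1) ^ (card V - 1)" using assms v0 by (simp add: card_PiE)
  finally show ?thesis using sub fin finite_subset by blast
qed

text \<open>A relation between monomials is a polynomial in any one of the variables whose coefficients
  are again such relations in fewer variables, and over an infinite field a polynomial function
  determines its coefficients.\<close>

lemma mono_fns_independent:
  fixes u :: "('v \<Rightarrow> nat) \<Rightarrow> 'k::alg_closed_field"
  assumes "finite V" "finite E" "\<And>e v. e \<in> E \<Longrightarrow> v \<notin> V \<Longrightarrow> e v = 0"
    and "\<And>z :: 'v \<Rightarrow> 'k. (\<Sum>e\<in>E. u e * (\<Prod>v\<in>V. z v ^ e v)) = 0"
    and "e \<in> E"
  shows "u e = 0"
  using assms
proof (induction V arbitrary: E u e rule: finite_induct)
  case empty
  then have "e' = (\<lambda>_. 0)" if "e' \<in> E" for e' using that by blast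
  then have E: "E = {e}" using empty(4) by blast
  show ?case using empty(3) by (simp add: E)
next
  case (insert w V)
  let ?k = "e w"
  let ?E = "{e' \<in> E. e' w = ?k}"
  have eq0: "(\<Sum>e'\<in>?E. u e' * (\<Prod>v\<in>V. z v ^ e' v)) = 0" for z :: "'v \<Rightarrow> 'k"
  proof -
    define P where "P = (\<Sum>e'\<in>E. monom (u e' * (\<Prod>v\<in>V. z v ^ e' v)) (e' w))"
    have "poly P c = 0" for c
    proof -
      have "poly P c = (\<Sum>e'\<in>E. u e' * (\<Prod>v\<in>insert w V. (z(w := c)) v ^ e' v))"
        unfolding P_def poly_sum poly_monom
      proof (rule sum.cong[OF refl])
        fix e'
        have "(\<Prod>v\<in>V. (z(w := c)) v ^ e' v) = (\<Prod>v\<in>V. z v ^ e' v)"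
          by (rule prod.cong) (use insert in auto)
        then show "u e' * (\<Prod>v\<in>V. z v ^ e' v) * c ^ e' w
            = u e' * (\<Prod>v\<in>insert w V. (z(w := c)) v ^ e' v)"
          using insert(1,2) by simp
      qed
      then show ?thesis using insert(6) by simp
    qed
    then have "P = 0" by (intro poly_fun_zero_imp_zero)
    then have "coeff P ?k = 0" by simp
    then show ?thesis
      unfolding P_def coeff_sum coeff_monom
      by (simp add: sum.inter_filter[OF insert(4)])
  qed
  let ?r = "\<lambda>e'. e'(w := 0::nat)"
  have inj: "inj_on ?r ?E"
  proof (rule inj_onI)
    fix x y assume "x \<in> ?E" "y \<in> ?E" and eq: "?r x = ?r y"
    then have "x w = y w" by simp
    then have "x v = y v" for v using fun_cong[OF eq, of v] by (cases "v = w") auto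
    then show "x = y" by blast
  qed
  have "(u \<circ> (\<lambda>e'. e'(w := ?k))) (?r e) = 0"
  proof (rule insert.IH[of "?r ` ?E"])
    show "finite (?r ` ?E)" using insert by simp
    show "e v = 0" if "e \<in> ?r ` ?E" "v \<notin> V" for e v
      using that insert(5) by auto
    show "?r e \<in> ?r ` ?E" using insert by blast
    fix z :: "'v \<Rightarrow> 'k"
    have "(\<Sum>e'\<in>?r ` ?E. (u \<circ> (\<lambda>e'. e'(w := ?k))) e' * (\<Prod>v\<in>V. z v ^ e' v))
      = (\<Sum>e'\<in>?E. u e' * (\<Prod>v\<in>V. z v ^ e' v))"
    proof (subst sum.reindex[OF inj], rule sum.cong[OF refl])
      fix x assume x: "x \<in> ?E"
      have "(\<Prod>v\<in>V. z v ^ (x(w := 0)) v) = (\<Prod>v\<in>V. z v ^ x v)"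
        by (rule prod.cong) (use insert in auto)
      moreover have "x(w := ?k) = x" using x by auto
      ultimately show "((\<lambda>e'. (u \<circ> (\<lambda>e'. e'(w := ?k))) e' * (\<Prod>v\<in>V. z v ^ e' v)) \<circ> ?r) x
          = u x * (\<Prod>v\<in>V. z v ^ x v)" by simp
    qed
    then show "(\<Sum>e'\<in>?r ` ?E. (u \<circ> (\<lambda>e'. e'(w := ?k))) e' * (\<Prod>v\<in>V. z v ^ e' v)) = 0"
      using eq0 by simp
  qed
  then show ?case by simp
qed

section \<open>Polynomials and polynomial functions\<close>

lemma meval_superset:
  assumes "finite K" "Poly_Mapping.keys p \<subseteq> K"
  shows "meval p a = (\<Sum>m\<in>K. Poly_Mapping.lookup p m * (\<Prod>i\<in>UNIV. a i ^ Poly_Mapping.lookup m i))"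
  unfolding meval_def
  by (rule sum.mono_neutral_left) (use assms in \<open>auto simp: in_keys_iff\<close>)

lemma meval_add: "meval (p + q) a = meval p a + meval q a"
proof -
  let ?K = "Poly_Mapping.keys p \<union> Poly_Mapping.keys q"
  have f: "finite ?K" by simp
  have "Poly_Mapping.keys (p + q) \<subseteq> ?K" by (rule Poly_Mapping.keys_add)
  then show ?thesis
    using meval_superset[OF f, of "p + q" a] meval_superset[OF f, of p a] meval_superset[OF f, of q a]
    by (simp add: lookup_add algebra_simps sum.distrib)
qed

lemma meval_zero [simp]: "meval 0 a = 0"
  by (simp add: meval_def)

lemma meval_sum: "meval (sum f A) a = (\<Sum>x\<in>A. meval (f x) a)"
  by (induction A rule: infinite_finite_induct) (simp_all add: meval_add)

lemma meval_single: "meval (Poly_Mapping.single m c) a = c * (\<Prod>i\<in>UNIV. a i ^ Poly_Mapping.lookup m i)"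
  by (simp add: meval_superset[of "{m}"])

lemma mono_span_iff_meval:
  fixes z :: "'i::finite \<Rightarrow> 'p \<Rightarrow> 'k::field"
  shows "f \<in> mono_span UNIV z M \<longleftrightarrow>
    (\<exists>p. (\<forall>m\<in>Poly_Mapping.keys p. Poly_Mapping.lookup m \<in> M) \<and> f = (\<lambda>q. meval p (\<lambda>i. z i q)))"
proof
  assume "f \<in> mono_span UNIV z M"
  then show "\<exists>p. (\<forall>m\<in>Poly_Mapping.keys p. Poly_Mapping.lookup m \<in> M) \<and> f = (\<lambda>q. meval p (\<lambda>i. z i q))"
    unfolding mono_span_def
  proof (induction rule: fs.span_induct_alt)
    case base
    then show ?case by (intro exI[of _ 0]) (simp add: fun_eq_iff fscale_apply)
  next
    case (step c x y)
    then obtain m p where *: "m \<in> M" "x = mono_fn UNIV z m"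
      "\<forall>m\<in>Poly_Mapping.keys p. Poly_Mapping.lookup m \<in> M" "y = (\<lambda>q. meval p (\<lambda>i. z i q))" by blast
    define m' where "m' = Abs_poly_mapping m"
    have m': "Poly_Mapping.lookup m' = m" unfolding m'_def by (rule lookup_Abs_poly_mapping) simp
    have "Poly_Mapping.keys (Poly_Mapping.single m' c + p) \<subseteq> insert m' (Poly_Mapping.keys p)"
      using Poly_Mapping.keys_add[of "Poly_Mapping.single m' c" p] by (auto split: if_splits)
    then have "\<forall>k\<in>Poly_Mapping.keys (Poly_Mapping.single m' c + p). Poly_Mapping.lookup k \<in> M"
      using *(1,3) m' by auto
    moreover have "fscale c x + y = (\<lambda>q. meval (Poly_Mapping.single m' c + p) (\<lambda>i. z i q))"
      using * m' by (simp add: fun_eq_iff fscale_apply meval_add meval_single mono_fn_def)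
    ultimately show ?case by blast
  qed
next
  assume "\<exists>p. (\<forall>m\<in>Poly_Mapping.keys p. Poly_Mapping.lookup m \<in> M) \<and> f = (\<lambda>q. meval p (\<lambda>i. z i q))"
  then obtain p where p: "\<forall>m\<in>Poly_Mapping.keys p. Poly_Mapping.lookup m \<in> M" "f = (\<lambda>q. meval p (\<lambda>i. z i q))"
    by blast
  have "f = (\<lambda>q. \<Sum>m\<in>Poly_Mapping.keys p. Poly_Mapping.lookup p m * mono_fn UNIV z (Poly_Mapping.lookup m) q)"
    by (simp add: p(2) meval_def mono_fn_def)
  also have "\<dots> \<in> mono_span UNIV z M"
    unfolding mono_span_def by (rule span_sum_scale) (use p(1) in \<open>auto intro!: fs.span_base\<close>)
  finally show "f \<in> mono_span UNIV z M" .
qed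

section \<open>Noetherian rings of functions\<close>

definition subring_set :: "'a::comm_ring_1 set \<Rightarrow> bool" where
  "subring_set A \<longleftrightarrow> 1 \<in> A \<and> (\<forall>x\<in>A. \<forall>y\<in>A. x - y \<in> A \<and> x * y \<in> A)"

definition ideal_in :: "'a::comm_ring_1 set \<Rightarrow> 'a set \<Rightarrow> bool" where
  "ideal_in A I \<longleftrightarrow> I \<subseteq> A \<and> 0 \<in> I \<and> (\<forall>x\<in>I. \<forall>y\<in>I. x + y \<in> I) \<and> (\<forall>a\<in>A. \<forall>x\<in>I. a * x \<in> I)"

definition noetherian_set :: "'a::comm_ring_1 set \<Rightarrow> bool" where
  "noetherian_set A \<longleftrightarrow> (\<forall>I. (\<forall>j. ideal_in A (I j)) \<and> (\<forall>j. I j \<subseteq> I (Suc j)) \<longrightarrow>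
     (\<exists>N. \<forall>j\<ge>N. I j = I N))"

text \<open>The element \<open>x\<close> may satisfy algebraic relations over \<open>A\<close>, so a polynomial ring in finitely many
  variables is obtained by adjoining the coordinate functions one after the other.\<close>

definition adjoin :: "'a::comm_ring_1 set \<Rightarrow> 'a \<Rightarrow> 'a set" where
  "adjoin A x = {poly p x | p. \<forall>i. coeff p i \<in> A}"

lemma subring_set_closed:
  assumes "subring_set A"
  shows "0 \<in> A" "1 \<in> A" "x \<in> A \<Longrightarrow> y \<in> A \<Longrightarrow> x - y \<in> A" "x \<in> A \<Longrightarrow> y \<in> A \<Longrightarrow> x * y \<in> A"
    "x \<in> A \<Longrightarrow> - x \<in> A" "x \<in> A \<Longrightarrow> y \<in> A \<Longrightarrow> x + y \<in> A"
proof -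
  show 0: "0 \<in> A" using assms by (metis diff_self subring_set_def)
  show m: "- x \<in> A" if "x \<in> A" for x using assms 0 that by (metis diff_0 subring_set_def)
  show "x \<in> A \<Longrightarrow> y \<in> A \<Longrightarrow> x + y \<in> A"
    using assms m[of y] by (metis diff_minus_eq_add subring_set_def)
qed (use assms in \<open>auto simp: subring_set_def\<close>)

lemma subring_set_sum:
  "subring_set A \<Longrightarrow> (\<And>i. i \<in> S \<Longrightarrow> f i \<in> A) \<Longrightarrow> sum f S \<in> A"
  by (induction S rule: infinite_finite_induct) (auto simp: subring_set_closed)

lemma ideal_in_uminus:
  assumes "subring_set A" "ideal_in A I" "x \<in> I"
  shows "- x \<in> I"
proof -
  have "- 1 \<in> A" using assms(1) by (simp add: subring_set_closed)
  then show ?thesis using assms by (metis ideal_in_def mult_minus1)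
qed

lemma subring_adjoin:
  assumes A: "subring_set A"
  shows "subring_set (adjoin A x)" "A \<subseteq> adjoin A x" "x \<in> adjoin A x"
proof -
  have "1 = poly [:1:] x" "\<forall>i. coeff [:1:] i \<in> A"
    using A by (auto simp: coeff_pCons subring_set_closed split: nat.split)
  then have one: "1 \<in> adjoin A x" unfolding adjoin_def by blast
  show "A \<subseteq> adjoin A x"
  proof
    fix a assume "a \<in> A"
    then have "a = poly [:a:] x" "\<forall>i. coeff [:a:] i \<in> A"
      using A by (auto simp: coeff_pCons subring_set_closed split: nat.split)
    then show "a \<in> adjoin A x" unfolding adjoin_def by blast
  qed
  have "x = poly [:0, 1:] x" "\<forall>i. coeff [:0, 1:] i \<in> A"
    using A by (auto simp: coeff_pCons subring_set_closed split: nat.split)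
  then show "x \<in> adjoin A x" unfolding adjoin_def by blast
  have "a - b \<in> adjoin A x \<and> a * b \<in> adjoin A x" if ab: "a \<in> adjoin A x" "b \<in> adjoin A x" for a b
  proof -
    obtain p q where p: "a = poly p x" "\<And>i. coeff p i \<in> A" and q: "b = poly q x" "\<And>i. coeff q i \<in> A"
      using ab unfolding adjoin_def by blast
    have "a - b = poly (p - q) x" "\<forall>i. coeff (p - q) i \<in> A"
      using p q A by (auto simp: subring_set_closed)
    moreover have "a * b = poly (p * q) x" "\<forall>i. coeff (p * q) i \<in> A"
      using p q A by (auto simp: coeff_mult subring_set_closed intro!: subring_set_sum)
    ultimately show ?thesis unfolding adjoin_def by blast
  qed
  with one show "subring_set (adjoin A x)" unfolding subring_set_def by blast
qed

text \<open>An element of \<open>I\<close> may have several polynomials over \<open>A\<close> representing it; the coefficients in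
  degree \<open>k\<close> of all those of degree at most \<open>k\<close> are collected.\<close>

definition leading_coeffs :: "'a::comm_ring_1 set \<Rightarrow> 'a \<Rightarrow> 'a set \<Rightarrow> nat \<Rightarrow> 'a set" where
  "leading_coeffs A x I k =
     {coeff p k | p. (\<forall>i. coeff p i \<in> A) \<and> (\<forall>i>k. coeff p i = 0) \<and> poly p x \<in> I}"

lemma leading_coeffs_ideal:
  assumes A: "subring_set A" and I: "ideal_in (adjoin A x) I"
  shows "ideal_in A (leading_coeffs A x I k)"
  unfolding ideal_in_def
proof (intro conjI ballI)
  show "leading_coeffs A x I k \<subseteq> A" unfolding leading_coeffs_def by blast
  have "0 = coeff 0 k \<and> (\<forall>i. coeff 0 i \<in> A) \<and> (\<forall>i>k. coeff 0 i = (0::'a)) \<and> poly 0 x \<in> I"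
    using A I by (auto simp: subring_set_closed ideal_in_def)
  then show "0 \<in> leading_coeffs A x I k" unfolding leading_coeffs_def by blast
next
  fix a b assume "a \<in> leading_coeffs A x I k" "b \<in> leading_coeffs A x I k"
  then obtain p q where p: "a = coeff p k" "\<forall>i. coeff p i \<in> A" "\<forall>i>k. coeff p i = 0" "poly p x \<in> I"
    and q: "b = coeff q k" "\<forall>i. coeff q i \<in> A" "\<forall>i>k. coeff q i = 0" "poly q x \<in> I"
    unfolding leading_coeffs_def by blast
  have "a + b = coeff (p + q) k \<and> (\<forall>i. coeff (p + q) i \<in> A) \<and> (\<forall>i>k. coeff (p + q) i = 0)
      \<and> poly (p + q) x \<in> I"
    using p q A I by (auto simp: subring_set_closed ideal_in_def)
  then show "a + b \<in> leading_coeffs A x I k" unfolding leading_coeffs_def by blast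
next
  fix c a assume c: "c \<in> A" and "a \<in> leading_coeffs A x I k"
  then obtain p where p: "a = coeff p k" "\<forall>i. coeff p i \<in> A" "\<forall>i>k. coeff p i = 0" "poly p x \<in> I"
    unfolding leading_coeffs_def by blast
  have "c \<in> adjoin A x" using c subring_adjoin(2)[OF A] by blast
  then have "c * a = coeff (smult c p) k \<and> (\<forall>i. coeff (smult c p) i \<in> A)
      \<and> (\<forall>i>k. coeff (smult c p) i = 0) \<and> poly (smult c p) x \<in> I"
    using p c A I by (auto simp: subring_set_closed ideal_in_def)
  then show "c * a \<in> leading_coeffs A x I k" unfolding leading_coeffs_def by blast
qed

lemma leading_coeffs_mono:
  assumes A: "subring_set A" and J: "ideal_in (adjoin A x) J" and "I \<subseteq> J" "k \<le> l"
  shows "leading_coeffs A x I k \<subseteq> leading_coeffs A x J l"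
proof
  fix a assume "a \<in> leading_coeffs A x I k"
  then obtain p where p: "a = coeff p k" "\<forall>i. coeff p i \<in> A" "\<forall>i>k. coeff p i = 0" "poly p x \<in> J"
    unfolding leading_coeffs_def using assms(3) by blast
  define q where "q = monom 1 (l - k) * p"
  have q: "coeff q i = (if l - k \<le> i then coeff p (i - (l - k)) else 0)" for i
    unfolding q_def by (simp add: coeff_monom_mult)
  have "x ^ m \<in> adjoin A x" for m
    by (induction m) (use subring_adjoin[OF A, of x] in \<open>auto simp: subring_set_closed\<close>)
  then have "poly q x \<in> J"
    using p(4) J by (simp add: q_def poly_monom ideal_in_def)
  moreover have "a = coeff q l" "\<forall>i. coeff q i \<in> A" "\<forall>i>l. coeff q i = 0"
    using p assms(4) A by (auto simp: q subring_set_closed)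
  ultimately show "a \<in> leading_coeffs A x J l" unfolding leading_coeffs_def by blast
qed

text \<open>Subtracting an element of \<open>I\<close> with the same leading coefficient lowers the degree of an element
  of \<open>J\<close>, so that the elements of \<open>J\<close> are reduced to \<open>0\<close> modulo \<open>I\<close>.\<close>

lemma ideal_eq_if_leading_coeffs_eq:
  assumes A: "subring_set A" and I: "ideal_in (adjoin A x) I" and J: "ideal_in (adjoin A x) J"
    and "I \<subseteq> J" and eq: "\<And>k. leading_coeffs A x I k = leading_coeffs A x J k"
  shows "I = J"
proof
  have *: "(\<forall>i. coeff p i \<in> A) \<Longrightarrow> (\<forall>i\<ge>k. coeff p i = 0) \<Longrightarrow> poly p x \<in> J \<Longrightarrow> poly p x \<in> I" for k p
  proof (induction k arbitrary: p)
    case 0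
    then have "p = 0" by (intro poly_eqI) auto
    then show ?case using I by (simp add: ideal_in_def)
  next
    case (Suc k)
    have "\<forall>i>k. coeff p i = 0" using Suc(3) by simp
    then have "coeff p k \<in> leading_coeffs A x J k"
      unfolding leading_coeffs_def using Suc(2,4) by blast
    then have "coeff p k \<in> leading_coeffs A x I k" by (simp add: eq)
    then obtain q where q: "coeff p k = coeff q k" "\<forall>i. coeff q i \<in> A" "\<forall>i>k. coeff q i = 0" "poly q x \<in> I"
      unfolding leading_coeffs_def by auto
    have "poly (p - q) x \<in> J"
      using Suc(4) q(4) assms(4) J ideal_in_uminus[OF subring_adjoin(1)[OF A] J, of "poly q x"]
      by (auto simp: ideal_in_def diff_conv_add_uminus simp del: add_uminus_conv_diff)
    moreover have "coeff (p - q) i = 0" if "i \<ge> k" for i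
      using that Suc(3) q(1,3) by (cases "i = k") auto
    ultimately have "poly (p - q) x \<in> I"
      using Suc(1)[of "p - q"] Suc(2) q(2) A by (auto simp: subring_set_closed)
    then have "poly (p - q) x + poly q x \<in> I" using I q(4) unfolding ideal_in_def by blast
    then show ?case by simp
  qed
  show "J \<subseteq> I"
  proof
    fix y assume y: "y \<in> J"
    then obtain p where "y = poly p x" "\<forall>i. coeff p i \<in> A"
      using J unfolding ideal_in_def adjoin_def by blast
    then show "y \<in> I" using *[of p "Suc (degree p)"] y by (simp add: coeff_eq_0)
  qed
qed (use assms in auto)

text \<open>Hilbert's basis theorem, for ascending chains. The ideals of leading coefficients ascend in two
  directions, along the chain and with the degree. The diagonal becomes stationary at some \<open>N0\<close>,
  which settles all degrees above \<open>N0\<close>, and each of the finitely many smaller degrees becomes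
  stationary on its own.\<close>

theorem noetherian_adjoin:
  assumes A: "subring_set A" and N: "noetherian_set A"
  shows "noetherian_set (adjoin A x)"
  unfolding noetherian_set_def
proof (intro allI impI, elim conjE)
  fix I :: "nat \<Rightarrow> 'a set"
  assume I: "\<forall>j. ideal_in (adjoin A x) (I j)" and ch: "\<forall>j. I j \<subseteq> I (Suc j)"
  let ?L = "\<lambda>j k. leading_coeffs A x (I j) k"
  have mono: "I i \<subseteq> I j" if "i \<le> j" for i j using lift_Suc_mono_le[of I] ch that by blast
  have Lmono: "?L i k \<subseteq> ?L j l" if "i \<le> j" "k \<le> l" for i j k l
    by (rule leading_coeffs_mono[OF A]) (use I mono that in auto)
  have stab: "\<exists>N. \<forall>j\<ge>N. C j = C N" if "\<And>j. ideal_in A (C j)" "\<And>j. C j \<subseteq> C (Suc j)" for C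
    using N that unfolding noetherian_set_def by blast
  obtain N0 where N0: "\<And>j. j \<ge> N0 \<Longrightarrow> ?L j j = ?L N0 N0"
    using stab[of "\<lambda>j. ?L j j"] leading_coeffs_ideal[OF A] I Lmono by (metis le_SucI order_refl)
  have "\<exists>M. \<forall>j\<ge>M. ?L j k = ?L M k" for k
    using stab[of "\<lambda>j. ?L j k"] leading_coeffs_ideal[OF A] I Lmono by (metis le_SucI order_refl)
  then obtain M where M: "\<And>j k. j \<ge> M k \<Longrightarrow> ?L j k = ?L (M k) k" by metis
  define K where "K = Max (insert N0 (M ` {..N0}))"
  have KN: "N0 \<le> K" and KM: "\<And>k. k \<le> N0 \<Longrightarrow> M k \<le> K"
    unfolding K_def by (auto simp del: Max_insert intro!: Max_ge)
  have "I j = I K" if j: "j \<ge> K" for j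
  proof (rule sym, rule ideal_eq_if_leading_coeffs_eq[OF A])
    show "I K \<subseteq> I j" using mono j by blast
    fix k show "?L K k = ?L j k"
    proof (cases "k \<le> N0")
      case True
      then show ?thesis using M[of k j] M[of k K] KM[OF True] j by simp
    next
      case False
      have "?L j k \<subseteq> ?L (max j k) (max j k)" by (rule Lmono) auto
      also have "\<dots> = ?L N0 N0" using N0[of "max j k"] False by simp
      also have "\<dots> \<subseteq> ?L K k" by (rule Lmono) (use False KN in auto)
      finally show ?thesis using Lmono[OF j, of k k] by blast
    qed
  qed (use I in auto)
  then show "\<exists>N. \<forall>j\<ge>N. I j = I N" by blast
qed

lemma noetherian_finite_generation:
  assumes A: "subring_set A" and N: "noetherian_set A" and F: "F \<subseteq> A"
  shows "\<exists>G\<subseteq>F. finite G \<and> (\<forall>f\<in>F. \<exists>g. (\<forall>h\<in>G. g h \<in> A) \<and> f = (\<Sum>h\<in>G. g h * h))"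
proof (rule ccontr)
  define gen where "gen = (\<lambda>G. {(\<Sum>h\<in>G. g h * h) | g. \<forall>h\<in>G. g h \<in> A})"
  assume "\<not> ?thesis"
  then have "\<forall>G. finite G \<and> G \<subseteq> F \<longrightarrow> (\<exists>f. f \<in> F \<and> f \<notin> gen G)"
    unfolding gen_def by blast
  then obtain nf where nf: "\<And>G. finite G \<Longrightarrow> G \<subseteq> F \<Longrightarrow> nf G \<in> F \<and> nf G \<notin> gen G" by metis
  define G where "G = rec_nat {} (\<lambda>_ G. insert (nf G) G)"
  have G_Suc: "G (Suc j) = insert (nf (G j)) (G j)" for j by (simp add: G_def)
  have G: "finite (G j) \<and> G j \<subseteq> F" for j
  proof (induction j)
    case 0
    then show ?case by (simp add: G_def)
  next
    case (Suc j)
    then show ?case using nf[of "G j"] by (simp add: G_Suc)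
  qed
  have id: "ideal_in A (gen H)" if "finite H" "H \<subseteq> A" for H
    unfolding ideal_in_def
  proof (intro conjI ballI)
    show "gen H \<subseteq> A"
      unfolding gen_def using A that by (auto intro!: subring_set_sum simp: subring_set_closed subsetD)
    have "0 = (\<Sum>h\<in>H. 0 * h) \<and> (\<forall>h\<in>H. 0 \<in> A)" using A by (simp add: subring_set_closed)
    then show "0 \<in> gen H" unfolding gen_def by (intro CollectI exI[of _ "\<lambda>_. 0"])
  next
    fix x y assume "x \<in> gen H" "y \<in> gen H"
    then obtain g g' where *: "x = (\<Sum>h\<in>H. g h * h)" "\<forall>h\<in>H. g h \<in> A" "y = (\<Sum>h\<in>H. g' h * h)" "\<forall>h\<in>H. g' h \<in> A"
      unfolding gen_def by blast
    have "x + y = (\<Sum>h\<in>H. (g h + g' h) * h) \<and> (\<forall>h\<in>H. g h + g' h \<in> A)"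
      using * A by (simp add: subring_set_closed sum.distrib algebra_simps)
    then show "x + y \<in> gen H" unfolding gen_def by (intro CollectI exI[of _ "\<lambda>h. g h + g' h"])
  next
    fix a x assume "a \<in> A" "x \<in> gen H"
    then obtain g where *: "a \<in> A" "x = (\<Sum>h\<in>H. g h * h)" "\<forall>h\<in>H. g h \<in> A"
      unfolding gen_def by blast
    have "a * x = (\<Sum>h\<in>H. (a * g h) * h) \<and> (\<forall>h\<in>H. a * g h \<in> A)"
      using * A by (simp add: subring_set_closed sum_distrib_left mult.assoc)
    then show "a * x \<in> gen H" unfolding gen_def by (intro CollectI exI[of _ "\<lambda>h. a * g h"])
  qed
  have gen_mono: "gen (G j) \<subseteq> gen (G (Suc j))" for j
  proof
    fix y assume "y \<in> gen (G j)"
    then obtain g where g: "y = (\<Sum>h\<in>G j. g h * h)" "\<forall>h\<in>G j. g h \<in> A" unfolding gen_def by blast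
    let ?g = "\<lambda>h. if h \<in> G j then g h else 0"
    have "y = (\<Sum>h\<in>G (Suc j). ?g h * h)"
      unfolding g(1) by (rule sum.mono_neutral_cong_left) (use G in \<open>auto simp: G_Suc\<close>)
    moreover have "\<forall>h\<in>G (Suc j). ?g h \<in> A" using g(2) A by (simp add: subring_set_closed)
    ultimately show "y \<in> gen (G (Suc j))" unfolding gen_def by (intro CollectI exI[of _ ?g] conjI)
  qed
  have "\<forall>j. ideal_in A (gen (G j))" using id G F by blast
  then obtain M where "\<forall>j\<ge>M. gen (G j) = gen (G M)"
    using N gen_mono unfolding noetherian_set_def by (elim allE[of _ "\<lambda>j. gen (G j)"]) blast
  then have "gen (G (Suc M)) = gen (G M)" by (metis le_SucI order_refl)
  moreover have "nf (G M) \<in> gen (G (Suc M))"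
  proof -
    let ?g = "\<lambda>h. if h = nf (G M) then 1 else 0"
    have "nf (G M) = (\<Sum>h\<in>G (Suc M). ?g h * h)"
      using G[of "Suc M"] by (simp add: if_distrib[of "\<lambda>a. a * _"] G_Suc cong: if_cong)
    moreover have "\<forall>h\<in>G (Suc M). ?g h \<in> A" using A by (simp add: subring_set_closed)
    ultimately show ?thesis unfolding gen_def by (intro CollectI exI[of _ ?g] conjI)
  qed
  ultimately show False using nf[of "G M"] G by blast
qed

lemma noetherian_constants: "noetherian_set (range (\<lambda>c::'k::field. (\<lambda>_::'p. c)))"
  unfolding noetherian_set_def
proof (intro allI impI, elim conjE)
  let ?A = "range (\<lambda>c::'k. (\<lambda>_::'p. c))"
  fix I :: "nat \<Rightarrow> ('p \<Rightarrow> 'k) set"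
  assume I: "\<forall>j. ideal_in ?A (I j)" and ch: "\<forall>j. I j \<subseteq> I (Suc j)"
  have mono: "I i \<subseteq> I j" if "i \<le> j" for i j using lift_Suc_mono_le[of I] ch that by blast
  have full: "I j = ?A" if f: "f \<in> I j" "f \<noteq> 0" for j f
  proof
    show "I j \<subseteq> ?A" using I by (auto simp: ideal_in_def)
    obtain c where c: "f = (\<lambda>_. c)" using f I unfolding ideal_in_def by blast
    then have c0: "c \<noteq> 0" using f by auto
    show "?A \<subseteq> I j"
    proof
      fix g assume "g \<in> ?A"
      then obtain d where d: "g = (\<lambda>_. d)" by blast
      have "(\<lambda>_. d / c) * f \<in> I j" using I f unfolding ideal_in_def by blast
      then show "g \<in> I j" using c c0 d by (simp add: times_fun_def)
    qed
  qed
  show "\<exists>N. \<forall>j\<ge>N. I j = I N"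
  proof (cases "\<exists>N f. f \<in> I N \<and> f \<noteq> 0")
    case True
    then obtain N f where f: "f \<in> I N" "f \<noteq> 0" by blast
    have "I j = I N" if "j \<ge> N" for j using full[of f j] full[OF f] mono[OF that] f by blast
    then show ?thesis by blast
  next
    case False
    then have "I j = {0}" for j using I unfolding ideal_in_def by blast
    then show ?thesis by blast
  qed
qed

lemma power_fun_apply: "(f ^ n) p = f p ^ n"
  by (induction n) simp_all

lemma poly_fun_apply:
  fixes f :: "'p \<Rightarrow> 'a::comm_ring_1"
  shows "poly P f p = (\<Sum>i\<le>degree P. coeff P i p * f p ^ i)"
  by (simp add: poly_altdef sum_fun_apply power_fun_apply)

text \<open>The last clause, that the elements restrict to polynomials on lines, gives access to their
  derivatives.\<close>

lemma noetherian_polynomial_ring: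
  "\<exists>A :: ('k::field ^ 'n \<Rightarrow> 'k) set. subring_set A \<and> noetherian_set A \<and> (\<forall>c. (\<lambda>_. c) \<in> A) \<and>
     (\<forall>i. (\<lambda>x. x $ i) \<in> A) \<and> (\<forall>f\<in>A. \<forall>a v. \<exists>P. \<forall>c. f (a + c *s v) = poly P c)"
proof -
  have "\<exists>A :: ('k ^ 'n \<Rightarrow> 'k) set. subring_set A \<and> noetherian_set A \<and> (\<forall>c. (\<lambda>_. c) \<in> A) \<and>
     (\<forall>i\<in>S. (\<lambda>x. x $ i) \<in> A) \<and> (\<forall>f\<in>A. \<forall>a v. \<exists>P. \<forall>c. f (a + c *s v) = poly P c)"
    if "finite S" for S
    using that
  proof (induction S rule: finite_induct)
    case empty
    let ?A = "range (\<lambda>c::'k. (\<lambda>_::'k ^ 'n. c))"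
    have "subring_set ?A"
      unfolding subring_set_def by (auto simp: one_fun_def fun_diff_def times_fun_def)
    moreover have "\<exists>P. \<forall>c. f (a + c *s v) = poly P c" if f: "f \<in> ?A" for f a v
    proof -
      obtain d where "f = (\<lambda>_. d)" using f by (rule rangeE)
      then show ?thesis by (intro exI[of _ "[:d:]"]) simp
    qed
    ultimately show ?case using noetherian_constants by (intro exI[of _ ?A]) blast
  next
    case (insert i S)
    then obtain A :: "('k ^ 'n \<Rightarrow> 'k) set" where A: "subring_set A" "noetherian_set A" "\<forall>c. (\<lambda>_. c) \<in> A"
      "\<forall>i\<in>S. (\<lambda>x. x $ i) \<in> A" "\<forall>f\<in>A. \<forall>a v. \<exists>P. \<forall>c. f (a + c *s v) = poly P c" by blast
    let ?A = "adjoin A (\<lambda>x. x $ i)"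
    have "\<exists>P. \<forall>c. f (a + c *s v) = poly P c" if f: "f \<in> ?A" for f a v
    proof -
      obtain p where p: "f = poly p (\<lambda>x. x $ i)" "\<forall>j. coeff p j \<in> A" using f unfolding adjoin_def by blast
      then have "\<forall>j. \<exists>P. \<forall>c. coeff p j (a + c *s v) = poly P c" using A(5) by blast
      then obtain P where P: "\<And>j c. coeff p j (a + c *s v) = poly (P j) c" by metis
      show ?thesis
        by (rule exI[of _ "\<Sum>j\<le>degree p. P j * [:a $ i, v $ i:] ^ j"])
          (simp add: p(1) poly_fun_apply P poly_sum poly_power)
    qed
    moreover have "noetherian_set ?A" using noetherian_adjoin A by blast
    ultimately show ?case
      using subring_adjoin[OF A(1), of "\<lambda>x. x $ i"] A(3,4) by (intro exI[of _ ?A]) blast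
  qed
  from this[of UNIV] show ?thesis by simp
qed

section \<open>Forms and the Zariski topology\<close>

definition forms :: "nat \<Rightarrow> ('k::field ^ 'n \<Rightarrow> 'k) set" where
  "forms d = mono_span UNIV (\<lambda>i x. x $ i) (deg_exps UNIV d)"

definition affine_cone :: "('k::field ^ 'n) set set \<Rightarrow> ('k ^ 'n) set" where
  "affine_cone X = {x. x \<noteq> 0 \<and> line x \<in> X}"

lemma forms_iff_meval:
  "f \<in> forms d \<longleftrightarrow> (\<exists>p. homogeneous d p \<and> f = (\<lambda>x. meval p (($) x)))"
  unfolding forms_def mono_span_iff_meval homogeneous_def deg_exps_def by simp

lemma forms_mult: "f \<in> forms d \<Longrightarrow> g \<in> forms e \<Longrightarrow> f * g \<in> forms (d + e)"
  unfolding forms_def by (rule deg_span_mult)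

lemma form_homogeneous:
  assumes "f \<in> forms d"
  shows "f (c *s x) = c ^ d * f x"
  using assms unfolding forms_def mono_span_def
proof (induction rule: fs.span_induct_alt)
  case (step b g h)
  then obtain m where m: "g = mono_fn UNIV (\<lambda>i x. x $ i) m" "sum m UNIV = d"
    by (auto simp: deg_exps_def)
  have "g (c *s x) = c ^ d * g x"
    by (simp add: m(1) mono_fn_def power_mult_distrib prod.distrib m(2)[symmetric] power_sum)
  then show ?case using step by (simp add: fscale_apply algebra_simps)
qed simp

lemma line_eq: "line x = range (\<lambda>c. c *s x)"
  by (rule vec.span_singleton)

lemma line_scale: "c \<noteq> 0 \<Longrightarrow> line (c *s x) = line (x :: 'k::field ^ 'n)"
proof -
  assume c: "c \<noteq> 0"
  have "a *s x \<in> range (\<lambda>b. b *s (c *s x))" for a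
    by (rule range_eqI[of _ _ "a / c"]) (use c in \<open>simp add: vector_smult_assoc\<close>)
  moreover have "a *s (c *s x) \<in> range (\<lambda>b. b *s x)" for a
    by (rule range_eqI[of _ _ "a * c"]) (simp add: vector_smult_assoc)
  ultimately show ?thesis unfolding line_eq by blast
qed

lemma line_self: "x \<in> line x"
  by (simp add: vec.span_base)

lemma line_eq_imp_scale: "line x = line y \<Longrightarrow> y \<noteq> 0 \<Longrightarrow> \<exists>c. c \<noteq> 0 \<and> y = c *s (x :: 'k::field ^ 'n)"
proof -
  assume *: "line x = line y" "y \<noteq> 0"
  then have "y \<in> range (\<lambda>c. c *s x)" using line_self[of y] line_eq[of x] by simp
  then show ?thesis using * by (metis rangeE vector_smult_lzero)
qed

lemma in_line_nonzero: "y \<in> line x \<Longrightarrow> y \<noteq> 0 \<Longrightarrow> \<exists>c. c \<noteq> 0 \<and> y = c *s (x :: 'k::field ^ 'n)"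
  unfolding line_eq by (metis rangeE vector_smult_lzero)

lemma in_proj_space_UNIV: "P \<in> proj_space UNIV \<longleftrightarrow> (\<exists>x. x \<noteq> 0 \<and> P = line x)"
  by (auto simp: proj_space_def)

lemma line_nonvanishing_iff:
  assumes "f \<in> forms d"
  shows "(\<exists>y\<in>line x. f y \<noteq> 0) \<longleftrightarrow> f x \<noteq> 0"
  using assms line_self[of x] by (auto simp: line_eq form_homogeneous)

lemma zariski_basis:
  "zariski = topology_generated_by {{P \<in> proj_space UNIV. \<exists>x\<in>P. f x \<noteq> 0} | f d. f \<in> forms d}"
proof -
  have "{{P \<in> proj_space UNIV. \<exists>x\<in>P. meval p (($) x) \<noteq> 0} | p d. homogeneous d p}
    = {{P \<in> proj_space UNIV. \<exists>x\<in>P. (f :: 'a ^ 'b \<Rightarrow> 'a) x \<noteq> 0} | f d. f \<in> forms d}"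
  proof (intro set_eqI iffI)
    fix U :: "('a ^ 'b) set set"
    assume "U \<in> {{P \<in> proj_space UNIV. \<exists>x\<in>P. meval p (($) x) \<noteq> 0} | p d. homogeneous d p}"
    then obtain p d where "homogeneous d p" "U = {P \<in> proj_space UNIV. \<exists>x\<in>P. meval p (($) x) \<noteq> 0}"
      by blast
    then show "U \<in> {{P \<in> proj_space UNIV. \<exists>x\<in>P. f x \<noteq> 0} | f d. f \<in> forms d}"
      using forms_iff_meval[of "\<lambda>x. meval p (($) x)" d]
      by (intro CollectI exI[of _ "\<lambda>x. meval p (($) x)"] exI[of _ d]) auto
  next
    fix U :: "('a ^ 'b) set set"
    assume "U \<in> {{P \<in> proj_space UNIV. \<exists>x\<in>P. f x \<noteq> 0} | f d. f \<in> forms d}"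
    then obtain f d where f: "f \<in> forms d" "U = {P \<in> proj_space UNIV. \<exists>x\<in>P. f x \<noteq> 0}" by blast
    then obtain p where "homogeneous d p" "f = (\<lambda>x. meval p (($) x))"
      unfolding forms_iff_meval by auto
    with f(2) show "U \<in> {{P \<in> proj_space UNIV. \<exists>x\<in>P. meval p (($) x) \<noteq> 0} | p d. homogeneous d p}"
      by (intro CollectI exI[of _ p] exI[of _ d]) auto
  qed
  then show ?thesis unfolding zariski_def by simp
qed

lemma openin_zariski_form: "f \<in> forms d \<Longrightarrow> openin zariski {P \<in> proj_space UNIV. \<exists>x\<in>P. f x \<noteq> 0}"
  unfolding zariski_basis openin_topology_generated_by_iff
  by (rule generate_topology_on.Basis) blast

lemma topspace_zariski: "topspace zariski = proj_space UNIV"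
proof
  show "topspace zariski \<subseteq> proj_space UNIV"
    unfolding zariski_def topology_generated_by_topspace by blast
  have one: "(1 :: 'a ^ 'b \<Rightarrow> 'a) \<in> forms 0" unfolding forms_def by (rule deg_span_one)
  have "{P \<in> proj_space UNIV. \<exists>x\<in>P. (1 :: 'a ^ 'b \<Rightarrow> 'a) x \<noteq> 0} = proj_space UNIV"
  proof (intro set_eqI iffI)
    fix P :: "('a ^ 'b) set"
    assume P: "P \<in> proj_space UNIV"
    then obtain x where "P = line x" unfolding in_proj_space_UNIV by blast
    then have "x \<in> P" by (simp add: line_self)
    then show "P \<in> {P \<in> proj_space UNIV. \<exists>x\<in>P. (1 :: 'a ^ 'b \<Rightarrow> 'a) x \<noteq> 0}"
      using P by auto
  qed simp
  then show "proj_space UNIV \<subseteq> topspace (zariski :: ('a ^ 'b) set topology)"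
    using openin_zariski_form[OF one] by (metis openin_subset)
qed

text \<open>The nonvanishing sets of forms are closed under intersections, because a product of forms is a
  form; hence they are a base and not only a subbase.\<close>

lemma openin_zariski_nbhd:
  fixes x :: "'k::field ^ 'n"
  assumes "openin zariski U" "line x \<in> U"
  shows "\<exists>d. \<exists>f\<in>forms d. f x \<noteq> 0 \<and> (\<forall>y. y \<noteq> 0 \<and> f y \<noteq> 0 \<longrightarrow> line y \<in> U)"
  using assms unfolding zariski_basis openin_topology_generated_by_iff
proof (induction arbitrary: rule: generate_topology_on.induct)
  case Empty
  then show ?case by simp
next
  case (Int a b)
  have "line x \<in> a" "line x \<in> b" using Int.prems by simp_all
  from Int.IH(1)[OF this(1)] Int.IH(2)[OF this(2)] obtain d f e g
    where f: "f \<in> forms d" "f x \<noteq> 0 \<and> (\<forall>y. y \<noteq> 0 \<and> f y \<noteq> 0 \<longrightarrow> line y \<in> a)"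
    and g: "g \<in> forms e" "g x \<noteq> 0 \<and> (\<forall>y. y \<noteq> 0 \<and> g y \<noteq> 0 \<longrightarrow> line y \<in> b)"
    by (elim exE bexE) (rule that)
  have "(f * g) x \<noteq> 0" using f g by simp
  moreover have "line y \<in> a \<inter> b" if "y \<noteq> 0" "(f * g) y \<noteq> 0" for y
  proof -
    have "f y \<noteq> 0" "g y \<noteq> 0" using that(2) unfolding times_fun_apply by fastforce+
    then show ?thesis using f(2) g(2) that(1) by simp
  qed
  ultimately have "(f * g) x \<noteq> 0 \<and> (\<forall>y. y \<noteq> 0 \<and> (f * g) y \<noteq> 0 \<longrightarrow> line y \<in> a \<inter> b)"
    by blast
  then show ?case by (intro exI[of _ "d + e"] bexI[OF _ forms_mult[OF f(1) g(1)]])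
next
  case (UN K)
  then obtain U where U: "U \<in> K" "line x \<in> U" by auto
  from UN.IH[OF this] obtain d f
    where f: "f \<in> forms d" "f x \<noteq> 0 \<and> (\<forall>y. y \<noteq> 0 \<and> f y \<noteq> 0 \<longrightarrow> line y \<in> U)"
    by (elim exE bexE) (rule that)
  then have "f x \<noteq> 0 \<and> (\<forall>y. y \<noteq> 0 \<and> f y \<noteq> 0 \<longrightarrow> line y \<in> \<Union>K)" using U(1) by blast
  then show ?case by (intro exI[of _ d] bexI[OF _ f(1)])
next
  case (Basis s)
  then obtain f d where f: "f \<in> forms d" "s = {P \<in> proj_space UNIV. \<exists>x\<in>P. f x \<noteq> 0}" by blast
  then have "f x \<noteq> 0" using Basis line_nonvanishing_iff[OF f(1), of x] by blast
  moreover have "line y \<in> s" if "y \<noteq> 0" "f y \<noteq> 0" for y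
    using that line_self[of y] unfolding f(2) in_proj_space_UNIV by blast
  ultimately have "f x \<noteq> 0 \<and> (\<forall>y. y \<noteq> 0 \<and> f y \<noteq> 0 \<longrightarrow> line y \<in> s)" by blast
  then show ?case by (intro exI[of _ d] bexI[OF _ f(1)])
qed

lemma closedin_zariski_separate:
  fixes x :: "'k::field ^ 'n"
  assumes "closedin zariski Y" "x \<noteq> 0" "line x \<notin> Y"
  shows "\<exists>d. \<exists>f\<in>forms d. f x \<noteq> 0 \<and> (\<forall>y\<in>affine_cone Y. f y = 0)"
proof -
  have 1: "openin zariski (topspace zariski - Y)" using assms(1) by blast
  have 2: "line x \<in> topspace zariski - Y"
    using assms by (auto simp: topspace_zariski in_proj_space_UNIV)
  from openin_zariski_nbhd[OF 1 2] obtain d f where f: "f \<in> forms d"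
    "f x \<noteq> 0 \<and> (\<forall>y. y \<noteq> 0 \<and> f y \<noteq> 0 \<longrightarrow> line y \<in> topspace zariski - Y)"
    by (elim exE bexE) (rule that)
  have "f y = 0" if "y \<in> affine_cone Y" for y
    using f(2) that unfolding affine_cone_def by blast
  then have "f x \<noteq> 0 \<and> (\<forall>y\<in>affine_cone Y. f y = 0)" using f(2) by blast
  then show ?thesis by (intro exI[of _ d] bexI[OF _ f(1)])
qed

lemma closedin_zariski_zeros:
  fixes f :: "'k::field ^ 'n \<Rightarrow> 'k"
  assumes "f \<in> forms d"
  shows "closedin zariski {P \<in> proj_space UNIV. \<forall>x\<in>P. f x = 0}"
proof -
  have "{P \<in> proj_space UNIV. \<forall>x\<in>P. f x = 0}
    = topspace zariski - {P \<in> proj_space UNIV. \<exists>x\<in>P. f x \<noteq> 0}"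
    by (auto simp: topspace_zariski)
  then show ?thesis using closedin_diff[OF closedin_topspace openin_zariski_form[OF assms]] by simp
qed

lemma mono_span_subset_ring:
  assumes A: "subring_set A" "\<forall>c. (\<lambda>_. c) \<in> A" and z: "\<And>v. v \<in> V \<Longrightarrow> z v \<in> A"
  shows "mono_span V z M \<subseteq> A"
proof
  have pw: "g ^ k \<in> A" if g: "g \<in> A" for g k
  proof (induction k)
    case 0
    show ?case using subring_set_closed(2)[OF A(1)] by (simp only: power_0)
  next
    case (Suc k)
    show ?case using subring_set_closed(4)[OF A(1) g Suc] by (simp only: power_Suc)
  qed
  have mono: "mono_fn V z m \<in> A" for m
  proof -
    have "(\<lambda>p. \<Prod>v\<in>W. z v p ^ m v) \<in> A" if "W \<subseteq> V" for W
      using that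
    proof (induction W rule: infinite_finite_induct)
      case (infinite W)
      then show ?case using A(2) by simp
    next
      case (insert w W)
      have "(\<lambda>p. \<Prod>v\<in>insert w W. z v p ^ m v) = z w ^ m w * (\<lambda>p. \<Prod>v\<in>W. z v p ^ m v)"
        using insert by (simp add: fun_eq_iff power_fun_apply)
      then show ?case using insert pw[OF z] A by (simp add: subring_set_closed)
    qed (use A in simp)
    then show ?thesis by (simp add: mono_fn_def)
  qed
  fix f assume "f \<in> mono_span V z M"
  then show "f \<in> A" unfolding mono_span_def
  proof (induction rule: fs.span_induct_alt)
    case base
    then show ?case using A by (simp add: subring_set_closed)
  next
    case (step c x y)
    then have "(\<lambda>_. c) * x + y \<in> A" using mono A by (auto intro!: subring_set_closed)
    moreover have "fscale c x + y = (\<lambda>_. c) * x + y" by (simp add: fun_eq_iff fscale_apply)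
    ultimately show ?case by (simp only:)
  qed
qed

text \<open>Closed sets are determined by the polynomial functions vanishing on their cones, so a strictly
  descending chain of closed sets yields a strictly ascending chain of ideals.\<close>

lemma zariski_descending_chain:
  fixes Y :: "nat \<Rightarrow> ('k::field ^ 'n) set set"
  assumes "\<And>j. closedin zariski (Y j)" "\<And>j. Y (Suc j) \<subset> Y j"
  shows False
proof -
  obtain A :: "('k ^ 'n \<Rightarrow> 'k) set" where A: "subring_set A" "noetherian_set A" "\<forall>c. (\<lambda>_. c) \<in> A"
    "\<forall>i. (\<lambda>x. x $ i) \<in> A"
    using noetherian_polynomial_ring by metis
  have forms: "forms d \<subseteq> A" for d
    unfolding forms_def by (rule mono_span_subset_ring) (use A in auto)
  define I where "I = (\<lambda>j. {f \<in> A. \<forall>x\<in>affine_cone (Y j). f x = 0})"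
  have "ideal_in A (I j)" for j
    unfolding ideal_in_def I_def using A(1) by (auto simp: subring_set_closed)
  moreover have "I j \<subseteq> I (Suc j)" for j
    unfolding I_def using assms(2)[of j] by (auto simp: affine_cone_def)
  ultimately obtain N where "\<forall>j\<ge>N. I j = I N" using A(2) unfolding noetherian_set_def by blast
  then have eq: "I (Suc N) = I N" by (metis le_SucI order_refl)
  obtain P where P: "P \<in> Y N" "P \<notin> Y (Suc N)" using assms(2)[of N] by blast
  have "P \<in> topspace zariski" using P closedin_subset[OF assms(1)[of N]] by blast
  then obtain x where x: "x \<noteq> 0" "P = line x" by (auto simp: topspace_zariski in_proj_space_UNIV)
  obtain d f where f: "f \<in> forms d" "f x \<noteq> 0" "\<forall>y\<in>affine_cone (Y (Suc N)). f y = 0"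
    using closedin_zariski_separate[OF assms(1)[of "Suc N"] x(1)] P x by blast
  have "f \<in> I (Suc N)" unfolding I_def using f forms by blast
  then have "f \<in> I N" by (simp add: eq)
  then show False unfolding I_def using f(2) P x by (auto simp: affine_cone_def)
qed

lemma wf_zariski_closed:
  "wf {(Z, Y :: ('k::field ^ 'n) set set). closedin zariski Z \<and> closedin zariski Y \<and> Z \<subset> Y}"
  unfolding wf_iff_no_infinite_down_chain
proof
  assume "\<exists>Y. \<forall>i. (Y (Suc i), Y i) \<in> {(Z, Y :: ('k ^ 'n) set set). closedin zariski Z \<and> closedin zariski Y \<and> Z \<subset> Y}"
  then obtain Y :: "nat \<Rightarrow> ('k ^ 'n) set set"
    where "\<forall>i. (Y (Suc i), Y i) \<in> {(Z, Y). closedin zariski Z \<and> closedin zariski Y \<and> Z \<subset> Y}" ..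
  then have "closedin zariski (Y i)" "Y (Suc i) \<subset> Y i" for i by simp_all
  then show False by (rule zariski_descending_chain)
qed

text \<open>Noetherian induction: a closed set that is not irreducible splits into two strictly smaller ones.\<close>

lemma finite_irreducible_decomposition:
  fixes Y :: "('k::field ^ 'n) set set"
  assumes "closedin zariski Y"
  shows "\<exists>\<Z>. finite \<Z> \<and> Y = \<Union>\<Z> \<and> (\<forall>Z\<in>\<Z>. closedin zariski Z \<and> irreducible_in zariski Z)"
  using assms
proof (induction Y rule: wf_induct_rule[OF wf_zariski_closed])
  case (1 Y)
  show ?case
  proof (cases "Y = {} \<or> irreducible_in zariski Y")
    case True
    then show ?thesis
    proof
      assume "Y = {}"
      then show ?thesis by (intro exI[of _ "{}"]) simp
    next
      assume "irreducible_in zariski Y"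
      then show ?thesis using 1(2) by (intro exI[of _ "{Y}"]) simp
    qed
  next
    case False
    then obtain C D where CD: "closedin zariski C" "closedin zariski D" "Y \<subseteq> C \<union> D" "\<not> Y \<subseteq> C" "\<not> Y \<subseteq> D"
      unfolding irreducible_in_def using closedin_subset[OF 1(2)] by blast
    have "\<exists>\<Z>. finite \<Z> \<and> Y \<inter> E = \<Union>\<Z> \<and> (\<forall>Z\<in>\<Z>. closedin zariski Z \<and> irreducible_in zariski Z)"
      if "closedin zariski E" "\<not> Y \<subseteq> E" for E
      by (rule 1(1)) (use 1(2) that in \<open>auto intro: closedin_Int\<close>)
    then obtain Z1 Z2 where Z: "finite Z1" "Y \<inter> C = \<Union>Z1" "\<forall>Z\<in>Z1. closedin zariski Z \<and> irreducible_in zariski Z"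
      "finite Z2" "Y \<inter> D = \<Union>Z2" "\<forall>Z\<in>Z2. closedin zariski Z \<and> irreducible_in zariski Z"
      using CD by metis
    have "Y = (Y \<inter> C) \<union> (Y \<inter> D)" using CD(3) by blast
    then have "Y = \<Union>(Z1 \<union> Z2)" unfolding Z(2,5) by blast
    moreover have "finite (Z1 \<union> Z2)" using Z(1,4) by simp
    moreover have "\<forall>Z\<in>Z1 \<union> Z2. closedin zariski Z \<and> irreducible_in zariski Z"
      using Z(3,6) by (simp add: ball_Un)
    ultimately show ?thesis by (intro exI[of _ "Z1 \<union> Z2"] conjI)
  qed
qed

section \<open>The projective Nullstellensatz\<close>

lemma forms_add: "f \<in> forms d \<Longrightarrow> g \<in> forms d \<Longrightarrow> f + g \<in> forms d"
  and forms_scale: "f \<in> forms d \<Longrightarrow> fscale c f \<in> forms d"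
  and forms_zero: "0 \<in> forms d"
  unfolding forms_def by (rule mono_span_add mono_span_scale mono_span_zero; assumption)+

lemma forms_subspace: "fs.subspace (forms d)"
  unfolding forms_def mono_span_def by (rule fs.subspace_span)

lemma forms_one: "1 \<in> forms 0"
  unfolding forms_def by (rule deg_span_one)

lemma forms_const: "(\<lambda>_. c) \<in> forms 0"
proof -
  have "(\<lambda>_. c) = fscale c (1 :: 'a ^ 'b \<Rightarrow> 'a)" by (simp add: fun_eq_iff fscale_apply)
  then show ?thesis using forms_scale[OF forms_one, of c] by (simp only:)
qed

lemma forms_coord: "(\<lambda>x. x $ i) \<in> forms 1"
  unfolding forms_def by (rule deg_span_var) simp_all

lemma forms_power:
  assumes "f \<in> forms d"
  shows "f ^ k \<in> forms (k * d)"
proof (induction k)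
  case 0
  show ?case using forms_one by (simp only: power_0 mult_0)
next
  case (Suc k)
  show ?case using forms_mult[OF assms Suc] by (simp only: power_Suc mult_Suc)
qed

lemma forms_finite_dim: "\<exists>B. finite B \<and> forms d = fs.span B"
  using deg_mono_fns_bound[of "UNIV :: 'b set"] unfolding forms_def mono_span_def
  by (metis UNIV_not_empty finite)

lemma forms_Suc_span:
  "forms (Suc d) \<subseteq> fs.span {(\<lambda>x. x $ i) * g | i g. g \<in> forms d}"
proof -
  have "mono_fn UNIV (\<lambda>i x. x $ i) m \<in> {(\<lambda>x :: 'a ^ 'b. x $ i) * g | i g. g \<in> forms d}"
    if m: "sum m UNIV = Suc d" for m :: "'b \<Rightarrow> nat"
  proof -
    have "\<exists>i. m i \<noteq> 0" using m by (metis UNIV_I nat.distinct(1) sum.neutral)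
    then obtain i where i: "m i \<noteq> 0" by blast
    let ?m = "m(i := m i - 1)"
    have s: "sum m UNIV = m i + sum m (UNIV - {i})" "sum ?m UNIV = ?m i + sum ?m (UNIV - {i})"
      by (rule sum.remove; simp)+
    have "sum ?m (UNIV - {i}) = sum m (UNIV - {i})" by (rule sum.cong) auto
    then have "sum ?m UNIV = d" using s m i by simp
    then have "mono_fn UNIV (\<lambda>i x :: 'a ^ 'b. x $ i) ?m \<in> forms d"
      unfolding forms_def by (intro mono_span_base) (simp add: deg_exps_def)
    moreover have "mono_fn UNIV (\<lambda>i x. x $ i) m = (\<lambda>x. x $ i) * mono_fn UNIV (\<lambda>i x :: 'a ^ 'b. x $ i) ?m"
    proof
      fix x :: "'a ^ 'b"
      have "mono_fn UNIV (\<lambda>i x. x $ i) m x = x $ i ^ m i * (\<Prod>j\<in>UNIV - {i}. x $ j ^ m j)"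
        unfolding mono_fn_def by (rule prod.remove) auto
      also have "\<dots> = x $ i * (x $ i ^ ?m i * (\<Prod>j\<in>UNIV - {i}. x $ j ^ ?m j))"
        using i by (cases "m i") (auto intro!: prod.cong)
      also have "x $ i ^ ?m i * (\<Prod>j\<in>UNIV - {i}. x $ j ^ ?m j) = mono_fn UNIV (\<lambda>i x. x $ i) ?m x"
        unfolding mono_fn_def by (rule prod.remove[symmetric]) auto
      finally show "mono_fn UNIV (\<lambda>i x. x $ i) m x = ((\<lambda>x. x $ i) * mono_fn UNIV (\<lambda>i x. x $ i) ?m) x"
        by (simp only: times_fun_apply)
    qed
    ultimately show ?thesis by blast
  qed
  then have "mono_fn UNIV (\<lambda>i x. x $ i) ` deg_exps UNIV (Suc d)
      \<subseteq> {(\<lambda>x :: 'a ^ 'b. x $ i) * g | i g. g \<in> forms d}"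
    unfolding deg_exps_def by blast
  then show ?thesis
    unfolding forms_def[of "Suc d"] mono_span_def by (rule fs.span_mono)
qed

lemma forms_add_span: "forms (d + e) \<subseteq> fs.span {g * h | g h. g \<in> forms d \<and> h \<in> forms e}"
proof (induction d)
  case 0
  have "h \<in> {g * h | g h. g \<in> forms 0 \<and> h \<in> forms e}" if "h \<in> forms e" for h :: "'a ^ 'b \<Rightarrow> 'a"
    using that forms_one by (intro CollectI exI[of _ 1] exI[of _ h]) (simp only: mult_1 simp_thms)
  then show ?case by (simp only: add_0) (blast intro: fs.span_base)
next
  case (Suc d)
  let ?S = "{g * h | (g :: 'a ^ 'b \<Rightarrow> 'a) h. g \<in> forms (Suc d) \<and> h \<in> forms e}"
  have "(\<lambda>x. x $ i) * u \<in> fs.span ?S" if u: "u \<in> forms (d + e)" for i and u :: "'a ^ 'b \<Rightarrow> 'a"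
  proof (rule span_mult)
    show "u \<in> fs.span {g * h | g h. g \<in> forms d \<and> h \<in> forms e}" using Suc u by blast
    show "(\<lambda>x. x $ i) \<in> fs.span {\<lambda>x. x $ i}" by (rule fs.span_base) simp
    fix a b :: "'a ^ 'b \<Rightarrow> 'a"
    assume "a \<in> {\<lambda>x. x $ i}" "b \<in> {g * h | g h. g \<in> forms d \<and> h \<in> forms e}"
    then obtain g h where *: "a = (\<lambda>x. x $ i)" "b = g * h" "g \<in> forms d" "h \<in> forms e" by blast
    have "a * g \<in> forms (Suc d)" using forms_mult[OF forms_coord *(3)] *(1) by simp
    then have "(a * g) * h \<in> ?S" using *(4) by blast
    then show "a * b \<in> fs.span ?S" unfolding *(2) mult.assoc by (rule fs.span_base)
  qed
  then have "{(\<lambda>x :: 'a ^ 'b. x $ i) * g | i g. g \<in> forms (d + e)} \<subseteq> fs.span ?S" by blast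
  then have "fs.span {(\<lambda>x :: 'a ^ 'b. x $ i) * g | i g. g \<in> forms (d + e)} \<subseteq> fs.span ?S"
    by (rule fs.span_minimal) (rule fs.subspace_span)
  then show ?case using forms_Suc_span[of "d + e"] by (simp only: add_Suc) blast
qed

text \<open>A homogeneous ideal is given by the sequence of its graded pieces, which avoids decomposing
  functions into homogeneous components.\<close>

definition graded_ideal :: "(nat \<Rightarrow> ('k::field ^ 'n \<Rightarrow> 'k) set) \<Rightarrow> bool" where
  "graded_ideal I \<longleftrightarrow> (\<forall>d. I d \<subseteq> forms d \<and> 0 \<in> I d \<and> (\<forall>f\<in>I d. \<forall>g\<in>I d. f + g \<in> I d)) \<and>
     (\<forall>d e. \<forall>f\<in>forms e. \<forall>g\<in>I d. f * g \<in> I (e + d))"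

lemma graded_idealD:
  assumes "graded_ideal I"
  shows "f \<in> I d \<Longrightarrow> f \<in> forms d" "0 \<in> I d" "f \<in> I d \<Longrightarrow> g \<in> I d \<Longrightarrow> f + g \<in> I d"
    "h \<in> forms e \<Longrightarrow> f \<in> I d \<Longrightarrow> h * f \<in> I (e + d)"
  using assms unfolding graded_ideal_def by blast+

lemma graded_ideal_scale:
  assumes "graded_ideal I" "f \<in> I d"
  shows "fscale c f \<in> I d"
proof -
  have "fscale c f = (\<lambda>_. c) * f" by (simp add: fun_eq_iff fscale_apply)
  then show ?thesis using graded_idealD(4)[OF assms(1) forms_const assms(2)] by (simp only: add_0)
qed

lemma graded_ideal_subspace: "graded_ideal I \<Longrightarrow> fs.subspace (I d)"
  by (rule fs.subspaceI) (auto intro: graded_idealD graded_ideal_scale)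

lemma graded_ideal_full_mono:
  fixes I :: "nat \<Rightarrow> ('k::field ^ 'n \<Rightarrow> 'k) set"
  assumes "graded_ideal I" "forms D \<subseteq> I D" "D \<le> d"
  shows "forms d \<subseteq> I d"
  using assms(3)
proof (induction d rule: dec_induct)
  case (step d)
  have "(\<lambda>x. x $ i) * g \<in> I (Suc d)" if "g \<in> forms d" for i g
    using graded_idealD(4)[OF assms(1) forms_coord, of g d] that step by (metis plus_1_eq_Suc subsetD)
  then have "{(\<lambda>x :: 'k ^ 'n. x $ i) * g | i g. g \<in> forms d} \<subseteq> I (Suc d)" by blast
  then have "fs.span {(\<lambda>x :: 'k ^ 'n. x $ i) * g | i g. g \<in> forms d} \<subseteq> I (Suc d)"
    by (rule fs.span_minimal) (rule graded_ideal_subspace[OF assms(1)])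
  then show ?case using forms_Suc_span[of d] by blast
qed (use assms in simp)

text \<open>The ideal generated by \<open>P\<close> and the form \<open>f\<close> of degree \<open>a\<close>.\<close>

definition ideal_extend ::
    "(nat \<Rightarrow> ('k::field ^ 'n \<Rightarrow> 'k) set) \<Rightarrow> ('k ^ 'n \<Rightarrow> 'k) \<Rightarrow> nat \<Rightarrow> nat \<Rightarrow> ('k ^ 'n \<Rightarrow> 'k) set" where
  "ideal_extend P f a d = {p + f * h | p h. p \<in> P d \<and> h \<in> (if a \<le> d then forms (d - a) else {0})}"

lemma fun_mult_zero: "f * (0 :: 'p \<Rightarrow> 'k::field) = 0"
  by (rule mult_zero_right)

lemma graded_ideal_extend:
  fixes P :: "nat \<Rightarrow> ('k::field ^ 'n \<Rightarrow> 'k) set"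
  assumes P: "graded_ideal P" and f: "f \<in> forms a"
  shows "graded_ideal (ideal_extend P f a)"
proof -
  let ?H = "\<lambda>d. if a \<le> d then forms (d - a) else {0 :: 'k ^ 'n \<Rightarrow> 'k}"
  have H_add: "h + h' \<in> ?H d" if "h \<in> ?H d" "h' \<in> ?H d" for h h' d
    using that by (cases "a \<le> d") (simp_all only: if_True if_False singleton_iff add_0 forms_add)
  have H_zero: "0 \<in> ?H d" for d by (simp add: forms_zero)
  have fH: "f * h \<in> forms d" if "h \<in> ?H d" for h d
  proof (cases "a \<le> d")
    case True
    then have "f * h \<in> forms (a + (d - a))" using that by (intro forms_mult[OF f]) simp
    then show ?thesis using True by simp
  next
    case False
    then have "h = 0" using that by simp
    then show ?thesis by (simp only: fun_mult_zero forms_zero)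
  qed
  show ?thesis
    unfolding graded_ideal_def
  proof (intro conjI allI ballI)
    fix d
    show "ideal_extend P f a d \<subseteq> forms d"
    proof
      fix x assume "x \<in> ideal_extend P f a d"
      then obtain p h where "x = p + f * h" "p \<in> P d" "h \<in> ?H d" unfolding ideal_extend_def by blast
      then show "x \<in> forms d" using graded_idealD(1)[OF P, of p d] fH[of h d] forms_add by blast
    qed
    have "0 = 0 + f * 0" by (simp only: fun_mult_zero add_0)
    then show "0 \<in> ideal_extend P f a d" unfolding ideal_extend_def
      using graded_idealD(2)[OF P] H_zero by blast
  next
    fix d x y assume "x \<in> ideal_extend P f a d" "y \<in> ideal_extend P f a d"
    then obtain p h p' h' where *: "x = p + f * h" "p \<in> P d" "h \<in> ?H d" "y = p' + f * h'" "p' \<in> P d" "h' \<in> ?H d"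
      unfolding ideal_extend_def by blast
    have "x + y = (p + p') + f * (h + h')" by (simp add: *(1,4) fun_eq_iff algebra_simps)
    then show "x + y \<in> ideal_extend P f a d" unfolding ideal_extend_def
      using graded_idealD(3)[OF P *(2,5)] H_add[OF *(3,6)] by blast
  next
    fix d e and u x :: "'k ^ 'n \<Rightarrow> 'k" assume u: "u \<in> forms e" and "x \<in> ideal_extend P f a d"
    then obtain p h where *: "x = p + f * h" "p \<in> P d" "h \<in> ?H d" unfolding ideal_extend_def by blast
    have eq: "u * x = u * p + f * (u * h)" by (simp add: *(1) fun_eq_iff algebra_simps)
    have "u * h \<in> ?H (e + d)"
    proof (cases "a \<le> d")
      case True
      then have "u * h \<in> forms (e + (d - a))" using *(3) by (intro forms_mult[OF u]) simp
      then show ?thesis using True by simp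
    next
      case False
      then have "h = 0" using *(3) by simp
      then have "u * h = 0" by (simp only: fun_mult_zero)
      then show ?thesis using H_zero by (simp only:)
    qed
    then show "u * x \<in> ideal_extend P f a (e + d)" unfolding ideal_extend_def eq
      using graded_idealD(4)[OF P u *(2)] by blast
  qed
qed

text \<open>Zorn's lemma applies because the space of forms of a given degree has a finite basis: if it is
  contained in the union of a chain, it is contained in a member of the chain.\<close>

lemma maximal_graded_ideal:
  fixes I :: "nat \<Rightarrow> ('k::field ^ 'n \<Rightarrow> 'k) set"
  assumes "graded_ideal I" "\<And>D. \<not> forms D \<subseteq> I D"
  obtains P where "graded_ideal P" "\<And>d. I d \<subseteq> P d" "\<And>D. \<not> forms D \<subseteq> P D"
    "\<And>J. graded_ideal J \<Longrightarrow> (\<And>d. P d \<subseteq> J d) \<Longrightarrow> (\<And>D. \<not> forms D \<subseteq> J D) \<Longrightarrow> J = P"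
proof -
  let ?g = "\<lambda>(J :: (nat \<times> ('k ^ 'n \<Rightarrow> 'k)) set) d. {f. (d, f) \<in> J}"
  let ?p = "\<lambda>J :: nat \<Rightarrow> ('k ^ 'n \<Rightarrow> 'k) set. {(d, f). f \<in> J d}"
  have gp: "?g (?p J) = J" for J by (simp add: fun_eq_iff)
  define \<A> where "\<A> = {J. graded_ideal (?g J) \<and> ?p I \<subseteq> J \<and> (\<forall>D. \<not> forms D \<subseteq> ?g J D)}"
  have "?p I \<in> \<A>" unfolding \<A>_def using assms by simp
  then have "\<A> \<noteq> {}" by blast
  moreover have "\<Union>\<C> \<in> \<A>" if C: "\<C> \<noteq> {}" "subset.chain \<A> \<C>" for \<C>
  proof -
    have CA: "\<C> \<subseteq> \<A>" using C(2) by (simp add: subset_chain_def)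
    have gi: "graded_ideal (?g J)" if "J \<in> \<C>" for J using CA that unfolding \<A>_def by blast
    obtain J0 where J0: "J0 \<in> \<C>" using C(1) by blast
    have "graded_ideal (?g (\<Union>\<C>))"
      unfolding graded_ideal_def
    proof (intro conjI allI ballI)
      fix d
      show "?g (\<Union>\<C>) d \<subseteq> forms d" using graded_idealD(1)[OF gi] by blast
      show "0 \<in> ?g (\<Union>\<C>) d" using graded_idealD(2)[OF gi[OF J0]] J0 by blast
    next
      fix d f g assume "f \<in> ?g (\<Union>\<C>) d" "g \<in> ?g (\<Union>\<C>) d"
      then have "{(d, f), (d, g)} \<subseteq> \<Union>\<C>" by blast
      then obtain J where "J \<in> \<C>" "{(d, f), (d, g)} \<subseteq> J"
        using finite_subset_Union_chain[of "{(d, f), (d, g)}" \<C> \<A>] C by blast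
      then show "f + g \<in> ?g (\<Union>\<C>) d" using graded_idealD(3)[OF gi, of J f d g] by blast
    next
      fix d e and f g :: "'k ^ 'n \<Rightarrow> 'k" assume "f \<in> forms e" "g \<in> ?g (\<Union>\<C>) d"
      then obtain J where "J \<in> \<C>" "g \<in> ?g J d" "f \<in> forms e" by blast
      then show "f * g \<in> ?g (\<Union>\<C>) (e + d)" using graded_idealD(4)[OF gi, of J f e g d] by blast
    qed
    moreover have "?p I \<subseteq> \<Union>\<C>" using J0 CA unfolding \<A>_def by blast
    moreover have "\<not> forms D \<subseteq> ?g (\<Union>\<C>) D" for D
    proof
      assume full: "forms D \<subseteq> ?g (\<Union>\<C>) D"
      obtain B :: "('k ^ 'n \<Rightarrow> 'k) set" where B: "finite B" "forms D = fs.span B"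
        using forms_finite_dim by blast
      then have "Pair D ` B \<subseteq> \<Union>\<C>" using full fs.span_superset by blast
      then obtain J where J: "J \<in> \<C>" "Pair D ` B \<subseteq> J"
        using finite_subset_Union_chain[of "Pair D ` B" \<C> \<A>] C B(1) by blast
      then have "B \<subseteq> ?g J D" by blast
      then have "fs.span B \<subseteq> ?g J D"
        by (rule fs.span_minimal) (rule graded_ideal_subspace[OF gi[OF J(1)]])
      then show False using J(1) CA B(2) unfolding \<A>_def by blast
    qed
    ultimately show ?thesis unfolding \<A>_def by blast
  qed
  ultimately obtain M where M: "M \<in> \<A>" "\<And>X. X \<in> \<A> \<Longrightarrow> M \<subseteq> X \<Longrightarrow> X = M"
    using subset_Zorn_nonempty[of \<A>] by blast
  show thesis
  proof (rule that[of "?g M"])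
    show "graded_ideal (?g M)" "\<And>d. I d \<subseteq> ?g M d" "\<And>D. \<not> forms D \<subseteq> ?g M D"
      using M(1) unfolding \<A>_def by blast+
    fix J assume J: "graded_ideal J" "\<And>d. ?g M d \<subseteq> J d" "\<And>D. \<not> forms D \<subseteq> J D"
    have MJ: "M \<subseteq> ?p J" using J(2) by auto
    have "?p I \<subseteq> ?p J" using MJ M(1) unfolding \<A>_def by blast
    then have "?p J \<in> \<A>" unfolding \<A>_def using J by simp
    then have "?p J = M" using M(2) MJ by blast
    then show "J = ?g M" using gp[of J] by simp
  qed
qed

definition homogenize2 :: "('k::field) poly \<Rightarrow> nat \<Rightarrow> ('p \<Rightarrow> 'k) \<Rightarrow> ('p \<Rightarrow> 'k) \<Rightarrow> 'p \<Rightarrow> 'k" where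
  "homogenize2 Q K y l = (\<lambda>x. \<Sum>i\<le>K. coeff Q i * y x ^ i * l x ^ (K - i))"

text \<open>Over an algebraically closed field, this splits a binary form in \<open>y\<close> and \<open>l\<close> into linear factors.\<close>

lemma homogenize2_linear_factor:
  assumes "degree Q \<le> K"
  shows "homogenize2 ([:- a, 1:] * Q) (Suc K) y l = (y - fscale a l) * homogenize2 Q K y l"
proof
  fix x
  have 1: "(\<Sum>i\<le>Suc K. coeff (pCons 0 Q) i * y x ^ i * l x ^ (Suc K - i)) = y x * homogenize2 Q K y l x"
    by (subst sum.atMost_Suc_shift)
      (simp add: homogenize2_def sum_distrib_left mult_ac)
  have "(\<Sum>i\<le>Suc K. coeff Q i * y x ^ i * l x ^ (Suc K - i))
      = (\<Sum>i\<le>K. coeff Q i * y x ^ i * l x ^ (Suc K - i))"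
    using assms by (simp add: coeff_eq_0)
  also have "\<dots> = l x * homogenize2 Q K y l x"
    unfolding homogenize2_def sum_distrib_left
    by (rule sum.cong) (auto simp: Suc_diff_le mult_ac)
  finally have 2: "(\<Sum>i\<le>Suc K. coeff Q i * y x ^ i * l x ^ (Suc K - i)) = l x * homogenize2 Q K y l x" .
  have co: "coeff ([:- a, 1:] * Q) i = coeff (pCons 0 Q) i - a * coeff Q i" for i by simp
  have "homogenize2 ([:- a, 1:] * Q) (Suc K) y l x =
    (\<Sum>i\<le>Suc K. coeff (pCons 0 Q) i * y x ^ i * l x ^ (Suc K - i))
    - a * (\<Sum>i\<le>Suc K. coeff Q i * y x ^ i * l x ^ (Suc K - i))"
    unfolding homogenize2_def co sum_distrib_left sum_subtractf[symmetric]
    by (rule sum.cong) (simp_all add: algebra_simps)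
  also have "\<dots> = ((y - fscale a l) * homogenize2 Q K y l) x"
    unfolding 1 2 by (simp add: fscale_apply algebra_simps)
  finally show "homogenize2 ([:- a, 1:] * Q) (Suc K) y l x = ((y - fscale a l) * homogenize2 Q K y l) x" .
qed

text \<open>Suppose that no graded piece of \<open>I\<close> is full, and let \<open>P\<close> be maximal among the graded ideals
  above \<open>I\<close> with this property. By maximality every form outside \<open>P\<close> generates, together with
  \<open>P\<close>, all forms of high degree. Two consequences follow. First, \<open>P\<close> is prime. Second, for a
  coordinate \<open>l\<close> outside \<open>P\<close>, all forms of degree \<open>D + j\<close> are congruent modulo \<open>P\<close> to \<open>l ^ j\<close> times
  forms of degree \<open>D\<close>, so that the dimension of the quotient in degree \<open>D + j\<close> is bounded
  independently of \<open>j\<close>.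

  Hence for any other coordinate \<open>y\<close> the monomials in \<open>y\<close> and \<open>l\<close> of a high degree are linearly
  dependent modulo \<open>P\<close>. A relation between them is a binary form, which splits into linear
  factors; as \<open>P\<close> is prime, it contains one of these, that is, some \<open>y - a l\<close>. The ratios \<open>a\<close> of all
  coordinates are the coordinates of a point at which all members of \<open>P\<close> vanish. So \<open>I\<close> has a common
  zero. This direct argument replaces Zariski's lemma on finitely generated field extensions.\<close>

theorem projective_nullstellensatz:
  fixes I :: "nat \<Rightarrow> ('k::alg_closed_field ^ 'n \<Rightarrow> 'k) set"
  assumes I: "graded_ideal I" and no_zero: "\<And>x. x \<noteq> 0 \<Longrightarrow> \<exists>d. \<exists>f\<in>I d. f x \<noteq> 0"
  shows "\<exists>D. forms D \<subseteq> I D"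
proof (rule ccontr)
  assume "\<not> ?thesis"
  then obtain P where P: "graded_ideal P" "\<And>d. I d \<subseteq> P d" "\<And>D. \<not> forms D \<subseteq> P D"
    and max: "\<And>J. graded_ideal J \<Longrightarrow> (\<And>d. P d \<subseteq> J d) \<Longrightarrow> (\<And>D. \<not> forms D \<subseteq> J D) \<Longrightarrow> J = P"
    using maximal_graded_ideal[OF I] by metis
  note PD = graded_idealD[OF P(1)]
  have ext: "\<exists>D\<ge>a. \<forall>d\<ge>D. \<forall>g\<in>forms d. \<exists>p\<in>P d. \<exists>h\<in>forms (d - a). g = p + f * h"
    if f: "f \<in> forms a" "f \<notin> P a" for f a
  proof -
    let ?J = "ideal_extend P f a"
    have J: "graded_ideal ?J" by (rule graded_ideal_extend[OF P(1) f(1)])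
    have sub: "P d \<subseteq> ?J d" for d
    proof
      fix p assume "p \<in> P d"
      moreover have "p = p + f * 0" by (simp only: fun_mult_zero add_0_right)
      moreover have "0 \<in> (if a \<le> d then forms (d - a) else {0})" by (simp add: forms_zero)
      ultimately show "p \<in> ?J d" unfolding ideal_extend_def by blast
    qed
    have "f = 0 + f * 1" by (simp only: mult_1_right add_0)
    moreover have "1 \<in> (if a \<le> a then forms (a - a) else {0})" using forms_one by simp
    ultimately have "f \<in> ?J a" unfolding ideal_extend_def using PD(2) by blast
    then have "?J \<noteq> P" using f(2) by metis
    then obtain D where "forms D \<subseteq> ?J D" using max[OF J sub] by blast
    then have full: "forms d \<subseteq> ?J d" if "d \<ge> D" for d using graded_ideal_full_mono[OF J] that by blast
    show ?thesis
    proof (intro exI[of _ "max a D"] conjI allI impI ballI)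
      fix d and g :: "'k ^ 'n \<Rightarrow> 'k" assume d: "max a D \<le> d" and "g \<in> forms d"
      then have "g \<in> ?J d" using full by auto
      then show "\<exists>p\<in>P d. \<exists>h\<in>forms (d - a). g = p + f * h"
        unfolding ideal_extend_def using d by auto
    qed simp
  qed
  have prime: "f \<in> P a \<or> g \<in> P b" if fg: "f \<in> forms a" "g \<in> forms b" "f * g \<in> P (a + b)" for f g a b
  proof (rule ccontr)
    assume "\<not> ?thesis"
    then have nf: "f \<notin> P a" and ng: "g \<notin> P b" by auto
    obtain D where D: "D \<ge> a" "\<And>u. u \<in> forms D \<Longrightarrow> \<exists>p\<in>P D. \<exists>h\<in>forms (D - a). u = p + f * h"
      using ext[OF fg(1) nf] by blast
    obtain E where E: "E \<ge> b" "\<And>u. u \<in> forms E \<Longrightarrow> \<exists>p\<in>P E. \<exists>h\<in>forms (E - b). u = p + g * h"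
      using ext[OF fg(2) ng] by blast
    have "u * v \<in> P (D + E)" if uv: "u \<in> forms D" "v \<in> forms E" for u v
    proof -
      obtain p h where p: "p \<in> P D" "h \<in> forms (D - a)" "u = p + f * h" using D(2)[OF uv(1)] by blast
      obtain q k where q: "q \<in> P E" "k \<in> forms (E - b)" "v = q + g * k" using E(2)[OF uv(2)] by blast
      have "v * p \<in> P (E + D)" using PD(4)[OF uv(2) p(1)] .
      moreover have "(f * h) * q \<in> P ((a + (D - a)) + E)"
        using PD(4)[OF forms_mult[OF fg(1) p(2)] q(1)] .
      moreover have "(h * k) * (f * g) \<in> P (((D - a) + (E - b)) + (a + b))"
        using PD(4)[OF forms_mult[OF p(2) q(2)] fg(3)] .
      moreover have "E + D = D + E" "(a + (D - a)) + E = D + E" "((D - a) + (E - b)) + (a + b) = D + E"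
        using D(1) E(1) by auto
      ultimately have "v * p + ((f * h) * q + (h * k) * (f * g)) \<in> P (D + E)"
        using PD(3) by metis
      moreover have "u * v = v * p + ((f * h) * q + (h * k) * (f * g))"
        by (simp add: p(3) q(3) fun_eq_iff algebra_simps)
      ultimately show ?thesis by (simp only:)
    qed
    then have "{u * v | u v. u \<in> forms D \<and> v \<in> forms E} \<subseteq> P (D + E)" by blast
    then have "fs.span {u * v | u v. u \<in> forms D \<and> v \<in> forms E} \<subseteq> P (D + E)"
      by (rule fs.span_minimal) (rule graded_ideal_subspace[OF P(1)])
    then show False using forms_add_span[of D E] P(3)[of "D + E"] by blast
  qed
  obtain i0 where i0: "(\<lambda>x. x $ i0) \<notin> P 1"
  proof (rule ccontr)
    assume "\<not> thesis"
    then have all: "(\<lambda>x. x $ i) \<in> P 1" for i using that by blast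
    have "(\<lambda>x. x $ i) * g \<in> P 1" if g: "g \<in> forms 0" for i g
      using PD(4)[OF g all[of i]] by (simp only: mult.commute add_0)
    then have "{(\<lambda>x :: 'k ^ 'n. x $ i) * g | i g. g \<in> forms 0} \<subseteq> P 1" by blast
    then have "fs.span {(\<lambda>x :: 'k ^ 'n. x $ i) * g | i g. g \<in> forms 0} \<subseteq> P 1"
      by (rule fs.span_minimal) (rule graded_ideal_subspace[OF P(1)])
    then show False using forms_Suc_span[of 0] P(3)[of 1] by (simp only: One_nat_def) blast
  qed
  define l where "l = (\<lambda>x :: 'k ^ 'n. x $ i0)"
  have l: "l \<in> forms 1" "l \<notin> P 1" using i0 forms_coord unfolding l_def by auto
  have lpow_forms: "l ^ k \<in> forms k" for k using forms_power[OF l(1), of k] by simp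
  have lpow: "l ^ k \<notin> P k" for k
  proof (induction k)
    case 0
    show ?case
    proof
      assume "l ^ 0 \<in> P 0"
      then have 1: "1 \<in> P 0" by (simp only: power_0)
      have "g \<in> P 0" if "g \<in> forms 0" for g
        using PD(4)[OF that 1] by (simp only: mult_1_right add_0)
      then show False using P(3)[of 0] by blast
    qed
  next
    case (Suc k)
    show ?case
    proof
      assume "l ^ Suc k \<in> P (Suc k)"
      then have "l * l ^ k \<in> P (1 + k)" by (simp only: power_Suc plus_1_eq_Suc)
      then show False using prime[OF l(1) lpow_forms] l(2) Suc by blast
    qed
  qed
  obtain D where D: "D \<ge> 1" "\<And>d g. d \<ge> D \<Longrightarrow> g \<in> forms d \<Longrightarrow> \<exists>p\<in>P d. \<exists>h\<in>forms (d - 1). g = p + l * h"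
    using ext[OF l] by blast
  \<comment> \<open>Modulo \<open>P\<close>, degree \<open>D + j\<close> is \<open>l ^ j\<close> times degree \<open>D\<close>.\<close>
  have shift: "\<exists>p\<in>P (D + j). \<exists>u\<in>forms D. g = p + l ^ j * u" if "g \<in> forms (D + j)" for j g
    using that
  proof (induction j arbitrary: g)
    case 0
    have "g = 0 + l ^ 0 * g" by (simp only: power_0 mult_1 add_0)
    then show ?case using 0 PD(2) by (metis add_0_right)
  next
    case (Suc j)
    then obtain p h where p: "p \<in> P (D + Suc j)" "h \<in> forms (D + j)" "g = p + l * h"
      using D(2)[of "D + Suc j" g] by auto
    obtain q u where q: "q \<in> P (D + j)" "u \<in> forms D" "h = q + l ^ j * u" using Suc.IH[OF p(2)] by blast
    have "l * q \<in> P (D + Suc j)" using PD(4)[OF l(1) q(1)] by (simp only: plus_1_eq_Suc add_Suc_right)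
    then have "p + l * q \<in> P (D + Suc j)" using PD(3)[OF p(1)] by blast
    moreover have "g = (p + l * q) + l ^ Suc j * u"
      unfolding p(3) q(3) by (simp only: power_Suc distrib_left mult.assoc add.assoc)
    ultimately show ?case using q(2) by blast
  qed
  have proportional: "\<exists>a. y - fscale a l \<in> P 1" if y: "y \<in> forms 1" for y
  proof -
    have y_pow: "y ^ k \<in> forms k" for k using forms_power[OF y, of k] by simp
    obtain B :: "('k ^ 'n \<Rightarrow> 'k) set" where B: "finite B" "forms D = fs.span B" using forms_finite_dim by blast
    \<comment> \<open>In degree \<open>?K\<close> there are \<open>?h + 1\<close> monomials \<open>y ^ a * l ^ (?K - a)\<close> with \<open>a \<le> ?h\<close>, one more than the dimension
      bound \<open>?h\<close>.\<close>
    let ?h = "card B" and ?K = "D + card B"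
    have "\<exists>p u. p \<in> P ?K \<and> u \<in> forms D \<and> y ^ a * l ^ (?K - a) = p + l ^ ?h * u" if "a \<le> ?h" for a
    proof -
      have "y ^ a * l ^ (?K - a) \<in> forms (a + (?K - a))" by (rule forms_mult[OF y_pow lpow_forms])
      then show ?thesis using shift[of "y ^ a * l ^ (?K - a)" ?h] that by auto
    qed
    then obtain p u where pu: "\<And>a. a \<le> ?h \<Longrightarrow> p a \<in> P ?K"
      "\<And>a. a \<le> ?h \<Longrightarrow> u a \<in> forms D" "\<And>a. a \<le> ?h \<Longrightarrow> y ^ a * l ^ (?K - a) = p a + l ^ ?h * u a" by metis
    obtain c where c: "\<exists>a\<in>{..?h}. c a \<noteq> 0" "\<And>x. (\<Sum>a\<le>?h. c a * u a x) = 0"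
      using linear_relation_if_card_less[of "{..?h}" B u] B pu(2) by auto
    define Q where "Q = (\<Sum>a\<le>?h. monom (c a) a)"
    have coQ: "coeff Q a = (if a \<le> ?h then c a else 0)" for a
      unfolding Q_def by (simp add: coeff_sum coeff_monom)
    have Q0: "Q \<noteq> 0" using c(1) coQ by (metis atMost_iff coeff_0)
    have dQ: "degree Q \<le> ?K" by (rule degree_le) (simp add: coQ)
    have "homogenize2 Q ?K y l = (\<Sum>a\<le>?h. fscale (c a) (p a))"
    proof
      fix x
      have "homogenize2 Q ?K y l x = (\<Sum>a\<le>?h. c a * (y x ^ a * l x ^ (?K - a)))"
        unfolding homogenize2_def coQ
        by (rule sum.mono_neutral_cong_right) auto
      also have "\<dots> = (\<Sum>a\<le>?h. c a * p a x) + l x ^ ?h * (\<Sum>a\<le>?h. c a * u a x)"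
      proof -
        have "y x ^ a * l x ^ (?K - a) = p a x + l x ^ ?h * u a x" if "a \<le> ?h" for a
          using fun_cong[OF pu(3)[OF that], of x] by (simp add: power_fun_apply)
        then show ?thesis by (simp add: sum_distrib_left sum.distrib[symmetric] algebra_simps)
      qed
      finally show "homogenize2 Q ?K y l x = (\<Sum>a\<le>?h. fscale (c a) (p a)) x"
        by (simp add: c(2) sum_fun_apply fscale_apply)
    qed
    moreover have "(\<Sum>a\<le>?h. fscale (c a) (p a)) \<in> P ?K"
      by (rule fs.subspace_sum[OF graded_ideal_subspace[OF P(1)]])
        (use pu(1) graded_ideal_scale[OF P(1)] in auto)
    ultimately have "homogenize2 Q ?K y l \<in> P ?K" by (simp only:)
    moreover have "Q \<noteq> 0 \<Longrightarrow> degree Q \<le> K \<Longrightarrow> homogenize2 Q K y l \<in> P K \<Longrightarrow> \<exists>a. y - fscale a l \<in> P 1"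
      for Q K
    proof (induction K arbitrary: Q)
      case 0
      then have "degree Q = 0" by simp
      then obtain b where b: "Q = [:b:]" by (rule degree_eq_zeroE)
      have "homogenize2 Q 0 y l = fscale b (l ^ 0)" by (simp add: homogenize2_def b fun_eq_iff fscale_apply)
      then have "fscale (1 / b) (fscale b (l ^ 0)) \<in> P 0"
        using 0(3) graded_ideal_scale[OF P(1)] by metis
      moreover have "fscale (1 / b) (fscale b (l ^ 0)) = l ^ 0" using 0(1) b by (simp add: fun_eq_iff fscale_apply)
      ultimately show ?case using lpow[of 0] by (simp only:)
    next
      case (Suc K)
      show ?case
      proof (cases "degree Q = 0")
        case True
        then obtain b where b: "Q = [:b:]" by (rule degree_eq_zeroE)
        have "homogenize2 Q (Suc K) y l = fscale b (l ^ Suc K)"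
        proof
          fix x
          have "homogenize2 Q (Suc K) y l x = (\<Sum>i\<in>{0}. coeff Q i * y x ^ i * l x ^ (Suc K - i))"
            unfolding homogenize2_def
            by (rule sum.mono_neutral_right) (auto simp: b coeff_pCons split: nat.splits)
          then show "homogenize2 Q (Suc K) y l x = fscale b (l ^ Suc K) x"
            by (simp add: b fscale_apply power_fun_apply)
        qed
        then have "fscale (1 / b) (fscale b (l ^ Suc K)) \<in> P (Suc K)"
          using Suc(4) graded_ideal_scale[OF P(1)] by metis
        moreover have "fscale (1 / b) (fscale b (l ^ Suc K)) = l ^ Suc K"
          using Suc(2) b by (simp add: fun_eq_iff fscale_apply)
        ultimately show ?thesis using lpow[of "Suc K"] by (simp only:)
      next
        case False
        then obtain a where "poly Q a = 0" using alg_closed_imp_poly_has_root[of Q] by blast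
        then obtain R where R: "Q = [:- a, 1:] * R" by (metis dvdE poly_eq_0_iff_dvd)
        then have R0: "R \<noteq> 0" using Suc(2) by auto
        have "degree Q = 1 + degree R" unfolding R using R0 by (subst degree_mult_eq) auto
        then have dR: "degree R \<le> K" using Suc(3) by simp
        have hR: "homogenize2 R K y l \<in> forms K"
        proof -
          have "homogenize2 R K y l = (\<Sum>i\<le>K. fscale (coeff R i) (y ^ i * l ^ (K - i)))"
            by (simp add: homogenize2_def fun_eq_iff sum_fun_apply fscale_apply power_fun_apply mult.assoc)
          moreover have "y ^ i * l ^ (K - i) \<in> forms K" if "i \<le> K" for i
            using forms_mult[OF y_pow[of i] lpow_forms[of "K - i"]] that by simp
          then have "(\<Sum>i\<le>K. fscale (coeff R i) (y ^ i * l ^ (K - i))) \<in> forms K"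
            by (intro fs.subspace_sum[OF forms_subspace] forms_scale) simp
          ultimately show ?thesis by (simp only:)
        qed
        have yl: "y - fscale a l \<in> forms 1"
          using fs.subspace_diff[OF forms_subspace y forms_scale[OF l(1)]] .
        have "(y - fscale a l) * homogenize2 R K y l \<in> P (1 + K)"
          using Suc(4) homogenize2_linear_factor[OF dR, of a y l] R by (simp only: plus_1_eq_Suc)
        then show ?thesis using prime[OF yl hR] Suc.IH[OF R0 dR] by blast
      qed
    qed
    ultimately show ?thesis using Q0 dQ by blast
  qed
  have "\<forall>i. \<exists>c. (\<lambda>x. x $ i) - fscale c l \<in> P 1" using proportional[OF forms_coord] ..
  then obtain b where b: "\<forall>i. (\<lambda>x. x $ i) - fscale (b i) l \<in> P 1" by (rule choice[THEN exE])
  define a :: "'k ^ 'n" where "a = (\<chi> i. b i)"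
  have a: "(\<lambda>x. x $ i) - fscale (a $ i) l \<in> P 1" for i using b by (simp add: a_def)
  have ai0: "a $ i0 = 1"
  proof (rule ccontr)
    assume ne: "a $ i0 \<noteq> 1"
    have "fscale (1 / (1 - a $ i0)) ((\<lambda>x. x $ i0) - fscale (a $ i0) l) \<in> P 1"
      using graded_ideal_scale[OF P(1) a] .
    moreover have "fscale (1 / (1 - a $ i0)) ((\<lambda>x. x $ i0) - fscale (a $ i0) l) = l"
    proof
      fix x :: "'k ^ 'n"
      have "x $ i0 - a $ i0 * x $ i0 = (1 - a $ i0) * x $ i0" by (simp add: left_diff_distrib)
      then show "fscale (1 / (1 - a $ i0)) ((\<lambda>x. x $ i0) - fscale (a $ i0) l) x = l x"
        using ne by (simp add: fscale_apply l_def)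
    qed
    ultimately show False using l(2) by (simp only:)
  qed
  have val: "f - fscale (f a) (l ^ d) \<in> P d" if "f \<in> forms d" for f d
    using that
  proof (induction d arbitrary: f)
    case 0
    have "f x = f a" for x
      using form_homogeneous[OF 0, of 0 x] form_homogeneous[OF 0, of 0 a] by simp
    then have "f - fscale (f a) (l ^ 0) = 0" by (simp add: fun_eq_iff fscale_apply)
    then show ?case using PD(2) by (simp only:)
  next
    case (Suc d)
    have "f \<in> fs.span {(\<lambda>x. x $ i) * g | i g. g \<in> forms d}" using Suc.prems forms_Suc_span by blast
    then show ?case
    proof (induction rule: fs.span_induct_alt)
      case base
      have "0 - fscale (0 a) (l ^ Suc d) = 0" by (simp add: fun_eq_iff fscale_apply)
      then show ?case using PD(2) by (simp only:)
    next
      case (step c x y)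
      then obtain i g where x: "x = (\<lambda>x. x $ i) * g" "g \<in> forms d" by blast
      have "g * ((\<lambda>x. x $ i) - fscale (a $ i) l) \<in> P (Suc d)"
        using PD(4)[OF x(2) a[of i]] by (simp only: add.commute[of d] plus_1_eq_Suc)
      moreover have "fscale (a $ i) l * (g - fscale (g a) (l ^ d)) \<in> P (Suc d)"
        using PD(4)[OF forms_scale[OF l(1)] Suc.IH[OF x(2)]] by (simp only: plus_1_eq_Suc)
      ultimately have "fscale c (g * ((\<lambda>x. x $ i) - fscale (a $ i) l)
          + fscale (a $ i) l * (g - fscale (g a) (l ^ d))) + (y - fscale (y a) (l ^ Suc d)) \<in> P (Suc d)"
        using PD(3) graded_ideal_scale[OF P(1)] step(2) by blast
      moreover have "fscale c (g * ((\<lambda>x. x $ i) - fscale (a $ i) l)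
          + fscale (a $ i) l * (g - fscale (g a) (l ^ d))) + (y - fscale (y a) (l ^ Suc d))
          = (fscale c x + y) - fscale ((fscale c x + y) a) (l ^ Suc d)"
        by (simp add: x(1) fun_eq_iff fscale_apply power_fun_apply algebra_simps)
      ultimately show ?case by (simp only:)
    qed
  qed
  have "a \<noteq> 0" using ai0 by auto
  from no_zero[OF this] obtain d f where f: "f \<in> I d" "f a \<noteq> 0"
    by (elim exE bexE) (rule that)
  then have fP: "f \<in> P d" using P(2) by blast
  have "f - fscale (f a) (l ^ d) \<in> P d" using val PD(1)[OF fP] by blast
  then have "fscale (1 / f a) (f + fscale (- 1) (f - fscale (f a) (l ^ d))) \<in> P d"
    by (intro PD(3) fP graded_ideal_scale[OF P(1)])
  moreover have "fscale (1 / f a) (f + fscale (- 1) (f - fscale (f a) (l ^ d))) = l ^ d"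
    using f(2) by (simp add: fun_eq_iff fscale_apply field_simps)
  ultimately show False using lpow by (simp only:)
qed

section \<open>Dimension and Hilbert growth\<close>

lemma functional_linear_form: "functional y \<in> forms 1"
proof -
  have "functional y = (\<Sum>i\<in>UNIV. fscale (y $ i) (\<lambda>x. x $ i))"
    by (simp add: fun_eq_iff functional_def sum_fun_apply fscale_apply)
  also have "\<dots> \<in> forms 1"
    by (intro fs.subspace_sum[OF forms_subspace] forms_scale forms_coord)
  finally show ?thesis .
qed

lemma functional_add_left: "functional (y + z) v = functional y v + functional z v"
  and functional_scale_left: "functional (c *s y) v = c * functional y v"
  and functional_add_right: "functional y (v + w) = functional y v + functional y w"
  and functional_scale_right: "functional y (c *s v) = c * functional y v"
  and functional_commute: "functional y v = functional v y"
  by (simp_all add: functional_def algebra_simps sum.distrib sum_distrib_left)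

lemma linear_form_avoiding_finite_set:
  fixes A :: "('k::alg_closed_field ^ 'n) set"
  assumes "finite A" "0 \<notin> A"
  shows "\<exists>y. \<forall>x\<in>A. functional y x \<noteq> 0"
  using assms
proof (induction A rule: finite_induct)
  case (insert x A)
  then obtain y where y: "\<forall>a\<in>A. functional y a \<noteq> 0" by auto
  obtain i where i: "x $ i \<noteq> 0" using insert(4) by (auto simp: vec_eq_iff)
  define Q where "Q = (\<Prod>a\<in>insert x A. [:functional y a, a $ i:])"
  have "Q \<noteq> 0" unfolding Q_def using insert(1) y i by (auto simp: prod_zero_iff)
  then obtain c where "poly Q c \<noteq> 0" using poly_fun_zero_imp_zero by blast
  then have "\<forall>a\<in>insert x A. functional y a + c * a $ i \<noteq> 0"
    unfolding Q_def using insert(1) by (auto simp: poly_prod prod_zero_iff)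
  moreover have "functional (y + c *s axis i 1) a = functional y a + c * a $ i" for a
    by (simp add: functional_add_left functional_scale_left functional_commute[of "axis i 1"] functional_axis)
  ultimately show ?case by metis
qed simp

lemma irreducible_in_finite_Union:
  assumes "irreducible_in T A" "finite \<Z>" "\<And>Z. Z \<in> \<Z> \<Longrightarrow> closedin T Z" "A \<subseteq> \<Union>\<Z>"
  shows "\<exists>Z\<in>\<Z>. A \<subseteq> Z"
  using assms(2-)
proof (induction \<Z> rule: finite_induct)
  case empty
  then show ?case using assms(1) by (simp add: irreducible_in_def)
next
  case (insert Z \<Z>)
  have "closedin T (\<Union>\<Z>)" using insert by (intro closedin_Union) auto
  moreover have "closedin T Z" using insert by blast
  moreover have "A \<subseteq> Z \<union> \<Union>\<Z>" using insert by simp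
  ultimately have "A \<subseteq> Z \<or> A \<subseteq> \<Union>\<Z>" using assms(1) unfolding irreducible_in_def by blast
  then show ?case using insert by blast
qed

definition irreducible_chain :: "('k::field ^ 'n) set set \<Rightarrow> nat \<Rightarrow> (nat \<Rightarrow> ('k ^ 'n) set set) \<Rightarrow> bool" where
  "irreducible_chain Y m Z \<longleftrightarrow>
     (\<forall>i\<le>m. closedin zariski (Z i) \<and> irreducible_in zariski (Z i) \<and> Z i \<subseteq> Y) \<and> (\<forall>i<m. Z i \<subset> Z (Suc i))"

text \<open>A linear form that vanishes identically on no irreducible component of \<open>Y\<close> cuts out a closed
  subset in which every irreducible chain is shorter, since its last member lies properly inside
  some component. In this form, bounding chains from above, no theorem on the dimension of
  intersections is needed.\<close>

lemma linear_forms_without_common_zero: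
  fixes Y :: "('k::alg_closed_field ^ 'n) set set"
  assumes "closedin zariski Y" "\<And>m Z. irreducible_chain Y m Z \<Longrightarrow> m < r"
  shows "\<exists>l. (\<forall>i<r. l i \<in> forms 1) \<and> (\<forall>x\<in>affine_cone Y. \<exists>i<r. l i x \<noteq> 0)"
  using assms
proof (induction r arbitrary: Y)
  case 0
  obtain \<Z> where Z: "Y = \<Union>\<Z>" "\<forall>Z\<in>\<Z>. closedin zariski Z \<and> irreducible_in zariski Z"
    using finite_irreducible_decomposition[OF 0(1)] by blast
  have "\<Z> = {}"
  proof (rule ccontr)
    assume "\<Z> \<noteq> {}"
    then obtain Z where "Z \<in> \<Z>" by blast
    then have "irreducible_chain Y 0 (\<lambda>_. Z)" unfolding irreducible_chain_def using Z by auto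
    then show False using 0(2) by blast
  qed
  then have "affine_cone Y = {}" using Z(1) by (simp add: affine_cone_def)
  then show ?case by simp
next
  case (Suc r)
  obtain \<Z> where Z: "finite \<Z>" "Y = \<Union>\<Z>" "\<And>Z. Z \<in> \<Z> \<Longrightarrow> closedin zariski Z"
      "\<And>Z. Z \<in> \<Z> \<Longrightarrow> irreducible_in zariski Z"
    using finite_irreducible_decomposition[OF Suc.prems(1)] by blast
  have "\<exists>x. x \<noteq> 0 \<and> line x \<in> Z" if "Z \<in> \<Z>" for Z
  proof -
    have "Z \<noteq> {}" "Z \<subseteq> proj_space UNIV"
      using Z(4)[OF that] by (auto simp: irreducible_in_def topspace_zariski)
    then obtain P where "P \<in> Z" "P \<in> proj_space UNIV" by blast
    then show ?thesis unfolding in_proj_space_UNIV by auto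
  qed
  then obtain pt where pt: "\<And>Z. Z \<in> \<Z> \<Longrightarrow> pt Z \<noteq> 0" "\<And>Z. Z \<in> \<Z> \<Longrightarrow> line (pt Z) \<in> Z" by metis
  have "0 \<notin> pt ` \<Z>" using pt(1) by force
  then obtain y where y: "\<forall>x\<in>pt ` \<Z>. functional y x \<noteq> 0"
    using linear_form_avoiding_finite_set[of "pt ` \<Z>"] Z(1) by blast
  let ?H = "{P \<in> proj_space UNIV. \<forall>x\<in>P. functional y x = 0}"
  have H: "closedin zariski ?H" by (rule closedin_zariski_zeros[OF functional_linear_form])
  have YH: "closedin zariski (Y \<inter> ?H)" using closedin_Int[OF Suc.prems(1) H] .
  have short: "m < r" if ch: "irreducible_chain (Y \<inter> ?H) m C" for m C
  proof -
    have Cm: "irreducible_in zariski (C m)" "C m \<subseteq> Y" "C m \<subseteq> ?H"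
      using ch unfolding irreducible_chain_def by auto
    obtain W where W: "W \<in> \<Z>" "C m \<subseteq> W"
      using irreducible_in_finite_Union[OF Cm(1) Z(1,3)] Cm(2) Z(2) by blast
    have "line (pt W) \<notin> ?H" using y W(1) line_self[of "pt W"] by blast
    then have "C m \<subset> W" using W pt(2)[OF W(1)] Cm(3) by blast
    then have "irreducible_chain Y (Suc m) (C(Suc m := W))"
      unfolding irreducible_chain_def
      using ch Z W(1) unfolding irreducible_chain_def
      by (auto simp: le_Suc_eq less_Suc_eq)
    then show ?thesis using Suc.prems(2) by blast
  qed
  have "\<exists>l. (\<forall>i<r. l i \<in> forms 1) \<and> (\<forall>x\<in>affine_cone (Y \<inter> ?H). \<exists>i<r. l i x \<noteq> 0)"
    by (rule Suc.IH[OF YH]) (rule short)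
  then obtain l
    where l: "\<forall>i<r. l i \<in> forms 1" "\<forall>x\<in>affine_cone (Y \<inter> ?H). \<exists>i<r. l i x \<noteq> 0"
    by (elim exE conjE) (rule that)
  let ?l = "\<lambda>i. case i of 0 \<Rightarrow> functional y | Suc j \<Rightarrow> l j"
  have "\<exists>i<Suc r. ?l i x \<noteq> 0" if x: "x \<in> affine_cone Y" for x
  proof (cases "functional y x = 0")
    case True
    have "functional y (c *s x) = 0" for c using True by (simp add: functional_scale_right)
    then have "\<forall>x'\<in>line x. functional y x' = 0" unfolding line_eq by blast
    then have "x \<in> affine_cone (Y \<inter> ?H)" using x unfolding affine_cone_def in_proj_space_UNIV by blast
    then obtain i where "i < r" "l i x \<noteq> 0" using l(2) by blast
    then show ?thesis by (intro exI[of _ "Suc i"]) simp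
  next
    case False
    then show ?thesis by (intro exI[of _ 0]) simp
  qed
  moreover have "\<forall>i<Suc r. ?l i \<in> forms 1"
    using l(1) functional_linear_form[of y] by (auto split: nat.split)
  ultimately show ?case by blast
qed

lemma chain_length_le_variety_dim:
  assumes "variety_dim X = enat r" "irreducible_chain X m Z"
  shows "m < Suc r"
proof -
  have "enat m \<in> {enat r | r. \<exists>Z. (\<forall>i\<le>r. closedin zariski (Z i) \<and> irreducible_in zariski (Z i) \<and> Z i \<subseteq> X) \<and>
     (\<forall>i<r. Z i \<subset> Z (Suc i))}"
    using assms(2) unfolding irreducible_chain_def by blast
  then have "enat m \<le> variety_dim X" unfolding variety_dim_def by (rule Sup_upper)
  then show ?thesis using assms(1) by simp
qed

text \<open>The Hilbert function of the homogeneous coordinate ring of \<open>X\<close> is bounded by a multiple of the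
  \<open>r\<close>-th power of the degree.\<close>

definition hilbert_growth :: "('k::field ^ 'n) set set \<Rightarrow> nat \<Rightarrow> bool" where
  "hilbert_growth X r \<longleftrightarrow> (\<exists>C. \<forall>d. \<exists>B. finite B \<and> card B \<le> C * (d + 1) ^ r \<and>
     (\<forall>f\<in>forms d. \<exists>h\<in>fs.span B. \<forall>x\<in>affine_cone X. f x = h x))"

lemma finite_bounded_exps: "finite {m :: 'n::finite \<Rightarrow> nat. sum m UNIV \<le> D}"
proof -
  have "m \<in> PiE UNIV (\<lambda>_. {..D})" if "sum m UNIV \<le> D" for m :: "'n \<Rightarrow> nat"
  proof -
    have "m i \<le> D" for i using member_le_sum[of i UNIV m] that by simp
    then show ?thesis by auto
  qed
  then show ?thesis by (intro finite_subset[OF _ finite_PiE[of UNIV "\<lambda>_. {..D}"]]) auto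
qed

text \<open>By the Nullstellensatz, the ideal generated by the linear forms and the ideal of \<open>X\<close> contains all
  forms of some degree \<open>D\<close>. So the coordinate ring is generated by the monomials of degree at most
  \<open>D\<close> as a module over the polynomials in the \<open>r + 1\<close> linear forms, and each of these
  finitely many generators contributes at most \<open>(d + 1) ^ r\<close> monomials in degree \<open>d\<close>.\<close>

lemma hilbert_growth_if_linear_forms:
  fixes X :: "('k::alg_closed_field ^ 'n) set set"
  assumes X: "closedin zariski X" and l: "\<And>i. i < Suc r \<Longrightarrow> l i \<in> forms 1"
    and nz: "\<And>x. x \<in> affine_cone X \<Longrightarrow> \<exists>i<Suc r. l i x \<noteq> 0"
  shows "hilbert_growth X r"
proof -
  let ?H = "\<lambda>d. if d = 0 then {0} else forms (d - 1) :: ('k ^ 'n \<Rightarrow> 'k) set"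
  let ?L = "{..<Suc r}"
  define J where "J = (\<lambda>d. {f \<in> forms d. \<exists>g. (\<forall>j\<in>?L. g j \<in> ?H d) \<and>
    (\<forall>x\<in>affine_cone X. f x = (\<Sum>j\<in>?L. l j x * g j x))})"
  have H_zero: "0 \<in> ?H d" for d by (simp add: forms_zero)
  have H_add: "h + h' \<in> ?H d" if "h \<in> ?H d" "h' \<in> ?H d" for h h' d
    using that by (cases "d = 0") (simp_all only: simp_thms if_True if_False singleton_iff add_0 forms_add)
  have H_mult: "u * h \<in> ?H (e + d)" if u: "u \<in> forms e" and h: "h \<in> ?H d" for u h d e
  proof (cases "d = 0")
    case True
    then have "u * h = 0" using h by (metis fun_mult_zero singletonD)
    then show ?thesis using H_zero by (simp only:)
  next
    case False
    then have "u * h \<in> forms (e + (d - 1))" using h by (intro forms_mult[OF u]) simp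
    then show ?thesis using False by simp
  qed
  have J: "graded_ideal J"
    unfolding graded_ideal_def
  proof (intro conjI allI ballI)
    fix d show "J d \<subseteq> forms d" unfolding J_def by blast
    show "0 \<in> J d" unfolding J_def
      using H_zero forms_zero by (intro CollectI conjI exI[of _ "\<lambda>_. 0"]) auto
  next
    fix d f f' assume "f \<in> J d" "f' \<in> J d"
    then obtain g g' where *: "f \<in> forms d" "\<forall>j\<in>?L. g j \<in> ?H d" "\<forall>x\<in>affine_cone X. f x = (\<Sum>j\<in>?L. l j x * g j x)"
      "f' \<in> forms d" "\<forall>j\<in>?L. g' j \<in> ?H d" "\<forall>x\<in>affine_cone X. f' x = (\<Sum>j\<in>?L. l j x * g' j x)"
      unfolding J_def by blast
    have "\<forall>x\<in>affine_cone X. (f + f') x = (\<Sum>j\<in>?L. l j x * (g j + g' j) x)"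
      using *(3,6) by (simp add: algebra_simps sum.distrib)
    moreover have "\<forall>j\<in>?L. g j + g' j \<in> ?H d" using *(2,5) H_add by blast
    moreover have "f + f' \<in> forms d" using *(1,4) by (rule forms_add)
    ultimately show "f + f' \<in> J d" unfolding J_def by (intro CollectI conjI exI[of _ "\<lambda>j. g j + g' j"])
  next
    fix d e and u f :: "'k ^ 'n \<Rightarrow> 'k" assume u: "u \<in> forms e" and "f \<in> J d"
    then obtain g where *: "f \<in> forms d" "\<forall>j\<in>?L. g j \<in> ?H d" "\<forall>x\<in>affine_cone X. f x = (\<Sum>j\<in>?L. l j x * g j x)"
      unfolding J_def by blast
    have "\<forall>x\<in>affine_cone X. (u * f) x = (\<Sum>j\<in>?L. l j x * (u * g j) x)"
    proof
      fix x assume "x \<in> affine_cone X"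
      then have "(u * f) x = u x * (\<Sum>j\<in>?L. l j x * g j x)" using *(3) by (simp only: times_fun_apply)
      also have "\<dots> = (\<Sum>j\<in>?L. l j x * (u * g j) x)"
        unfolding sum_distrib_left times_fun_apply by (simp only: mult.left_commute)
      finally show "(u * f) x = (\<Sum>j\<in>?L. l j x * (u * g j) x)" .
    qed
    moreover have "\<forall>j\<in>?L. u * g j \<in> ?H (e + d)" using *(2) H_mult[OF u] by blast
    moreover have "u * f \<in> forms (e + d)" using u *(1) by (rule forms_mult)
    ultimately show "u * f \<in> J (e + d)" unfolding J_def by (intro CollectI conjI exI[of _ "\<lambda>j. u * g j"])
  qed
  have "\<exists>d. \<exists>f\<in>J d. f x \<noteq> 0" if x: "x \<noteq> 0" for x
  proof (cases "x \<in> affine_cone X")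
    case True
    then obtain i where i: "i \<in> ?L" "l i x \<noteq> 0" using nz by blast
    let ?g = "\<lambda>j. if j = i then 1 else 0 :: 'k ^ 'n \<Rightarrow> 'k"
    have "l i \<in> J 1" unfolding J_def
    proof (intro CollectI conjI exI[of _ ?g] ballI)
      show "l i \<in> forms 1" using l i(1) by simp
      have H1: "?H 1 = forms 0" by simp
      show "?g j \<in> ?H 1" for j
        unfolding H1 by (cases "j = i") (simp_all only: simp_thms if_True if_False forms_one forms_zero)
      fix x
      have "(\<Sum>j\<in>?L. l j x * ?g j x) = (\<Sum>j\<in>?L. if j = i then l i x else 0)"
        by (rule sum.cong) auto
      then show "l i x = (\<Sum>j\<in>?L. l j x * ?g j x)" using i(1) by simp
    qed
    then show ?thesis using i(2) by blast
  next
    case False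
    then have "line x \<notin> X" using x by (simp add: affine_cone_def)
    from closedin_zariski_separate[OF X x this] obtain d f
      where f: "f \<in> forms d" "f x \<noteq> 0 \<and> (\<forall>y\<in>affine_cone X. f y = 0)" by (elim exE bexE) (rule that)
    have "f \<in> J d" unfolding J_def
      using f H_zero by (intro CollectI conjI exI[of _ "\<lambda>_. 0"]) auto
    then show ?thesis using f(2) by blast
  qed
  then obtain D where D: "forms D \<subseteq> J D" using projective_nullstellensatz[OF J] by blast
  have full: "forms d \<subseteq> J d" if "D \<le> d" for d by (rule graded_ideal_full_mono[OF J D that])
  let ?mu = "\<lambda>m. mono_fn UNIV (\<lambda>i x :: 'k ^ 'n. x $ i) m"
  let ?nu = "\<lambda>n. mono_fn ?L l n"
  define B where "B = (\<lambda>d. {?mu m * ?nu n | m n. sum m UNIV \<le> D \<and> sum m UNIV + sum n ?L = d})"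
  have gen: "\<exists>h\<in>fs.span (B d). \<forall>x\<in>affine_cone X. f x = h x" if "f \<in> forms d" for f d
    using that
  proof (induction d arbitrary: f rule: less_induct)
    case (less d)
    show ?case
    proof (cases "d \<le> D")
      case True
      have "?mu m \<in> B d" if m: "m \<in> deg_exps UNIV d" for m
      proof -
        have "?mu m = ?mu m * ?nu (\<lambda>_. 0)" by (simp only: mono_fn_const mult_1_right)
        moreover have "sum m UNIV \<le> D \<and> sum m UNIV + sum (\<lambda>_. 0) ?L = d"
          using m True by (simp add: deg_exps_def)
        ultimately show ?thesis unfolding B_def by blast
      qed
      then have "?mu ` deg_exps UNIV d \<subseteq> B d" by blast
      then have "f \<in> fs.span (B d)"
        using less.prems fs.span_mono unfolding forms_def mono_span_def by blast
      then show ?thesis by blast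
    next
      case False
      then have "f \<in> J d" using full[of d] less.prems by auto
      then obtain g where g: "\<forall>j\<in>?L. g j \<in> forms (d - 1)" "\<forall>x\<in>affine_cone X. f x = (\<Sum>j\<in>?L. l j x * g j x)"
        unfolding J_def using False by auto
      have "\<forall>j\<in>?L. \<exists>h. h \<in> fs.span (B (d - 1)) \<and> (\<forall>x\<in>affine_cone X. g j x = h x)"
        using less.IH[of "d - 1"] g(1) False by (metis diff_less less_one linorder_not_le nat_less_le zero_le)
      then obtain h where h: "\<And>j. j \<in> ?L \<Longrightarrow> h j \<in> fs.span (B (d - 1))"
        "\<And>j x. j \<in> ?L \<Longrightarrow> x \<in> affine_cone X \<Longrightarrow> g j x = h j x" by metis
      have lB: "l j * b \<in> fs.span (B d)" if j: "j \<in> ?L" and b: "b \<in> B (d - 1)" for j b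
      proof -
        obtain m n where mn: "b = ?mu m * ?nu n" "sum m UNIV \<le> D" "sum m UNIV + sum n ?L = d - 1"
          using b unfolding B_def by blast
        have "l j = ?nu (\<lambda>w. if w = j then 1 else 0)" using mono_fn_var[of ?L j l] j by simp
        then have "l j * b = ?mu m * ?nu (\<lambda>w. (if w = j then 1 else 0) + n w)"
          by (simp only: mn(1) mono_fn_mult[symmetric] mult_ac)
        moreover have "sum (\<lambda>w. (if w = j then 1 else 0) + n w) ?L = 1 + sum n ?L"
          using j by (subst sum.distrib) simp
        then have "sum m UNIV + sum (\<lambda>w. (if w = j then 1 else 0) + n w) ?L = d"
          using mn(3) False by simp
        ultimately have "l j * b \<in> B d" unfolding B_def using mn(2) by blast
        then show ?thesis by (rule fs.span_base)
      qed
      have "l j * h j \<in> fs.span (B d)" if j: "j \<in> ?L" for j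
      proof (rule span_mult)
        show "h j \<in> fs.span (B (d - 1))" using h(1)[OF j] .
        show "l j \<in> fs.span {l j}" by (rule fs.span_base) simp
        fix a b assume "a \<in> {l j}" "b \<in> B (d - 1)"
        then show "a * b \<in> fs.span (B d)" using lB[OF j] by (simp only: singleton_iff)
      qed
      then have "(\<Sum>j\<in>?L. l j * h j) \<in> fs.span (B d)" by (rule fs.span_sum)
      moreover have "\<forall>x\<in>affine_cone X. f x = (\<Sum>j\<in>?L. l j * h j) x"
        using g(2) h(2) by (simp add: sum_fun_apply)
      ultimately show ?thesis by blast
    qed
  qed
  let ?M = "{m :: 'n \<Rightarrow> nat. sum m UNIV \<le> D}"
  have count: "finite (B d) \<and> card (B d) \<le> card ?M * (d + 1) ^ r" for d
  proof -
    let ?S = "\<lambda>m. (\<lambda>q. ?mu m * q) ` (?nu ` deg_exps ?L (d - sum m UNIV))"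
    have sub: "B d \<subseteq> (\<Union>m\<in>?M. ?S m)"
    proof
      fix b assume "b \<in> B d"
      then obtain m n where mn: "b = ?mu m * ?nu n" "sum m UNIV \<le> D" "sum m UNIV + sum n ?L = d"
        unfolding B_def by blast
      then have "n \<in> deg_exps ?L (d - sum m UNIV)" by (auto simp: deg_exps_def)
      then show "b \<in> (\<Union>m\<in>?M. ?S m)" using mn(1,2) by blast
    qed
    have S: "finite (?S m) \<and> card (?S m) \<le> (d + 1) ^ r" for m
    proof -
      have *: "finite (?nu ` deg_exps ?L (d - sum m UNIV))"
        "card (?nu ` deg_exps ?L (d - sum m UNIV)) \<le> (d - sum m UNIV + 1) ^ r"
        using deg_mono_fns_bound[of ?L l "d - sum m UNIV"] by auto
      have "card (?S m) \<le> (d - sum m UNIV + 1) ^ r" using card_image_le[OF *(1)] *(2) le_trans by blast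
      also have "\<dots> \<le> (d + 1) ^ r" by (rule power_mono) auto
      finally show ?thesis using *(1) by blast
    qed
    have fin: "finite (\<Union>m\<in>?M. ?S m)" using S finite_bounded_exps[of D] by blast
    have "card (B d) \<le> card (\<Union>m\<in>?M. ?S m)" by (rule card_mono[OF fin sub])
    also have "\<dots> \<le> (\<Sum>m\<in>?M. card (?S m))" by (rule card_UN_le[OF finite_bounded_exps])
    also have "\<dots> \<le> (\<Sum>m\<in>?M. (d + 1) ^ r)" by (rule sum_mono) (use S in blast)
    finally show ?thesis using fin sub finite_subset by auto
  qed
  show ?thesis
    unfolding hilbert_growth_def
    by (intro exI[of _ "card ?M"] allI) (use gen count in blast)
qed

theorem hilbert_growth_variety_dim:
  fixes X :: "('k::alg_closed_field ^ 'n) set set"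
  assumes "closedin zariski X" "variety_dim X = enat r"
  shows "hilbert_growth X r"
proof -
  have "m < Suc r" if "irreducible_chain X m Z" for m Z
    using chain_length_le_variety_dim[OF assms(2) that] .
  then have "\<exists>l. (\<forall>i<Suc r. l i \<in> forms 1) \<and> (\<forall>x\<in>affine_cone X. \<exists>i<Suc r. l i x \<noteq> 0)"
    by (rule linear_forms_without_common_zero[OF assms(1)])
  then obtain l where l: "\<forall>i<Suc r. l i \<in> forms 1" "\<forall>x\<in>affine_cone X. \<exists>i<Suc r. l i x \<noteq> 0"
    by (elim exE conjE) (rule that)
  show ?thesis
    by (rule hilbert_growth_if_linear_forms[OF assms(1), of r l]) (use l in blast)+
qed

section \<open>Gradients and tangent spaces\<close>

lemma functional_zero_left [simp]: "functional 0 v = 0"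
  by (simp add: functional_def)

lemma functional_inject: "(\<And>v. functional y v = functional z v) \<Longrightarrow> y = z"
  by (metis functional_axis vec_eq_iff)

lemma functional_span_zero:
  assumes "\<And>w. w \<in> S \<Longrightarrow> functional w v = 0" "y \<in> vec.span S"
  shows "functional y v = 0"
  using assms(2)
  by (induction rule: vec.span_induct_alt)
    (simp_all add: functional_add_left functional_scale_left assms(1))

text \<open>A vector outside the span would be detected by a functional that vanishes on \<open>S\<close>.\<close>

lemma double_annihilator:
  fixes S :: "('k::field ^ 'n) set"
  assumes "\<And>v. (\<And>w. w \<in> S \<Longrightarrow> functional w v = 0) \<Longrightarrow> functional y v = 0"
  shows "y \<in> vec.span S"
proof (rule ccontr)
  assume y: "y \<notin> vec.span S"
  obtain B where B: "B \<subseteq> S" "vec.independent B" "S \<subseteq> vec.span B"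
    using vec.maximal_independent_subset by blast
  have yB: "y \<notin> vec.span B" using y vec.span_mono[OF B(1)] by blast
  then have ind: "vec.independent (insert y B)"
    using B(2) by (simp add: vec.independent_insert)
  fix i0 :: 'n
  define \<phi> where "\<phi> = vec.construct (insert y B) (\<lambda>b. if b = y then axis i0 1 else 0 :: 'k ^ 'n)"
  interpret \<phi>: Vector_Spaces.linear "(*s)" "(*s)" \<phi>
    unfolding \<phi>_def by (rule vec.linear_construct[OF ind])
  have \<phi>: "\<phi> b = (if b = y then axis i0 1 else 0)" if "b \<in> insert y B" for b
    unfolding \<phi>_def by (rule vec.construct_basis[OF ind that])
  obtain z where z: "(\<lambda>w. \<phi> w $ i0) = functional z"
    using ex1_functional[of "\<lambda>w. \<phi> w $ i0"] by (auto simp: \<phi>.add \<phi>.scale)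
  have fz: "functional w z = \<phi> w $ i0" for w using fun_cong[OF z, of w] by (simp add: functional_commute)
  have "functional b z = 0" if "b \<in> B" for b
    using that yB vec.span_base[of b B] by (auto simp: fz \<phi>)
  then have "functional w z = 0" if "w \<in> S" for w
    using functional_span_zero[of B z w] B(3) that by blast
  then have "functional y z = 0" using assms by blast
  then show False by (simp add: fz \<phi>)
qed

text \<open>Complete a basis of the span of \<open>S\<close> to a basis of the whole space and use the basis vectors as
  functionals: they are coordinates in which the elements of \<open>T\<close> have zeros at the positions of the
  basis of \<open>S\<close>. Both sets may overlap, so this is not a statement about a direct sum.\<close>

lemma dim_annihilator_le:
  fixes S T :: "('k::field ^ 'n) set"
  assumes "\<And>v w. v \<in> T \<Longrightarrow> w \<in> S \<Longrightarrow> functional w v = 0"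
  shows "vec.dim S + vec.dim T \<le> CARD('n)"
proof -
  obtain B where B: "B \<subseteq> S" "vec.independent B" "S \<subseteq> vec.span B" "card B = vec.dim S"
    using vec.basis_exists by blast
  define E where "E = vec.extend_basis B"
  have E: "B \<subseteq> E" "vec.independent E" "vec.span E = UNIV"
    unfolding E_def using vec.extend_basis_superset[OF B(2)] vec.independent_extend_basis[OF B(2)]
      vec.span_extend_basis[OF B(2)] by auto
  have finE: "finite E" using vec.finiteI_independent[OF E(2)] .
  have cardE: "card E = CARD('n)"
    using vec.dim_eq_card_independent[OF E(2)] vec.dim_span[of E] E(3) vec_dim_card by metis
  obtain e where e: "bij_betw e (UNIV :: 'n set) E"
    using finite_same_card_bij[of "UNIV :: 'n set" E] finE cardE by auto
  define \<psi> where "\<psi> = (\<lambda>v. \<chi> i. functional (e i) v)"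
  have lin: "Vector_Spaces.linear (*s) (*s) \<psi>"
    by unfold_locales (simp_all add: \<psi>_def vec_eq_iff functional_add_right functional_scale_right)
  have "v = w" if "\<psi> v = \<psi> w" for v w
  proof -
    have "functional b (v - w) = 0" if "b \<in> E" for b
    proof -
      obtain i where "b = e i" using e \<open>b \<in> E\<close> unfolding bij_betw_def by blast
      moreover have "functional (e i) v = functional (e i) w"
        using \<open>\<psi> v = \<psi> w\<close> by (simp add: \<psi>_def vec_eq_iff)
      moreover have "functional (e i) v = functional (e i) (v - w) + functional (e i) w"
        by (simp add: functional_add_right[symmetric])
      ultimately show ?thesis by simp
    qed
    then have "functional y (v - w) = 0" for y
      using functional_span_zero[of E "v - w" y] E(3) by blast
    then have "functional (v - w) y = functional 0 y" for y
      by (simp only: functional_commute[of "v - w"] functional_zero_left)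
    then have "v - w = 0" by (rule functional_inject)
    then show ?thesis by simp
  qed
  then have inj: "inj_on \<psi> (vec.span T)" by (auto intro: inj_onI)
  let ?d = "{i. e i \<notin> B}"
  have "\<psi> ` T \<subseteq> {x. \<forall>i. i \<notin> ?d \<longrightarrow> x $ i = 0}"
    using assms B(1) by (auto simp: \<psi>_def)
  then have "vec.dim (\<psi> ` T) \<le> vec.dim {x :: 'k ^ 'n. \<forall>i. i \<notin> ?d \<longrightarrow> x $ i = 0}"
    by (rule vec.dim_subset)
  then have "vec.dim (\<psi> ` T) \<le> card ?d"
    by (simp only: dim_substandard_cart)
  then have dT: "vec.dim T \<le> card ?d"
    using vec.dim_image_eq[OF lin inj] by simp
  have "card (e ` {i. e i \<in> B}) = card B"
  proof (rule arg_cong[of _ _ card], intro set_eqI iffI)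
    fix b assume b: "b \<in> B"
    then obtain i where "b = e i" using e E(1) unfolding bij_betw_def by blast
    then show "b \<in> e ` {i. e i \<in> B}" using b by simp
  qed auto
  moreover have "inj_on e {i. e i \<in> B}" using e unfolding bij_betw_def by (meson inj_on_subset subset_UNIV)
  ultimately have "card {i. e i \<in> B} = card B" by (simp add: card_image)
  moreover have "card (UNIV :: 'n set) = card {i. e i \<in> B} + card ?d"
    by (subst card_Un_disjoint[symmetric]) (auto intro: arg_cong[of _ _ card])
  ultimately show ?thesis using dT B(4) by simp
qed

definition mgrad :: "('n::finite, 'k::field) mpoly \<Rightarrow> 'k ^ 'n \<Rightarrow> 'k ^ 'n" where
  "mgrad p x = (\<chi> i. meval (mpderiv i p) (($) x))"

lemma functional_mgrad: "functional (mgrad p x) v = (\<Sum>i\<in>UNIV. meval (mpderiv i p) (($) x) * v $ i)"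
  by (simp add: functional_def mgrad_def)

lemma meval_mpderiv:
  "meval (mpderiv i p) a = (\<Sum>m\<in>Poly_Mapping.keys p. Poly_Mapping.lookup p m *
     (of_nat (Poly_Mapping.lookup m i) * a i ^ (Poly_Mapping.lookup m i - 1) *
      (\<Prod>j\<in>UNIV - {i}. a j ^ Poly_Mapping.lookup m j)))"
  unfolding mpderiv_def meval_sum meval_single
proof (rule sum.cong[OF refl])
  fix m
  let ?e = "\<lambda>j. Poly_Mapping.lookup (m - Poly_Mapping.single i (1::nat)) j"
  have "(\<Prod>j\<in>UNIV. a j ^ ?e j) = a i ^ ?e i * (\<Prod>j\<in>UNIV - {i}. a j ^ ?e j)"
    by (rule prod.remove) auto
  also have "(\<Prod>j\<in>UNIV - {i}. a j ^ ?e j) = (\<Prod>j\<in>UNIV - {i}. a j ^ Poly_Mapping.lookup m j)"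
    by (rule prod.cong) (auto simp: lookup_minus lookup_single when_def)
  finally show "of_nat (Poly_Mapping.lookup m i) * Poly_Mapping.lookup p m * (\<Prod>j\<in>UNIV. a j ^ ?e j) =
    Poly_Mapping.lookup p m * (of_nat (Poly_Mapping.lookup m i) * a i ^ (Poly_Mapping.lookup m i - 1) *
      (\<Prod>j\<in>UNIV - {i}. a j ^ Poly_Mapping.lookup m j))"
    by (simp add: lookup_minus lookup_single mult_ac)
qed

lemma pderiv_sum: "pderiv (sum f A) = (\<Sum>a\<in>A. pderiv (f a))"
  by (induction A rule: infinite_finite_induct) (simp_all add: pderiv_add)

lemma mgrad_along_line_ex:
  "\<exists>P. (\<forall>c. meval p (($) (x + c *s v)) = poly P c) \<and> functional (mgrad p x) v = poly (pderiv P) 0"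
proof -
  let ?L = "\<lambda>m i. Poly_Mapping.lookup m i"
  define F where "F = (\<lambda>m i. [:x $ i, v $ i:] ^ ?L m i)"
  define P where "P = (\<Sum>m\<in>Poly_Mapping.keys p. smult (Poly_Mapping.lookup p m) (\<Prod>i\<in>UNIV. F m i))"
  have "meval p (($) (x + c *s v)) = poly P c" for c
    by (simp add: meval_def P_def F_def poly_sum poly_prod poly_power)
  moreover have "functional (mgrad p x) v = poly (pderiv P) 0"
  proof -
    have dF: "poly (pderiv (F m i)) 0 = of_nat (?L m i) * x $ i ^ (?L m i - 1) * v $ i" for m i
      by (simp add: F_def pderiv_power poly_power pderiv_pCons)
    have "poly (pderiv P) 0 = (\<Sum>m\<in>Poly_Mapping.keys p. Poly_Mapping.lookup p m *
      (\<Sum>i\<in>UNIV. (\<Prod>j\<in>UNIV - {i}. x $ j ^ ?L m j) * (of_nat (?L m i) * x $ i ^ (?L m i - 1) * v $ i)))"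
      unfolding P_def pderiv_sum pderiv_smult pderiv_prod poly_sum poly_smult poly_mult poly_prod dF
      by (simp add: F_def poly_power)
    also have "\<dots> = (\<Sum>m\<in>Poly_Mapping.keys p. \<Sum>i\<in>UNIV. Poly_Mapping.lookup p m *
      (of_nat (?L m i) * x $ i ^ (?L m i - 1) * (\<Prod>j\<in>UNIV - {i}. x $ j ^ ?L m j)) * v $ i)"
      by (simp add: sum_distrib_left mult_ac)
    also have "\<dots> = (\<Sum>i\<in>UNIV. \<Sum>m\<in>Poly_Mapping.keys p. Poly_Mapping.lookup p m *
      (of_nat (?L m i) * x $ i ^ (?L m i - 1) * (\<Prod>j\<in>UNIV - {i}. x $ j ^ ?L m j)) * v $ i)"
      by (rule sum.swap)
    also have "\<dots> = functional (mgrad p x) v"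
      unfolding functional_mgrad meval_mpderiv by (simp add: sum_distrib_right)
    finally show ?thesis by simp
  qed
  ultimately show ?thesis by blast
qed

text \<open>The gradient is a derivative along lines of the polynomial function. So it depends on the function
  only, and the rules for derivatives of univariate polynomials apply in every characteristic.\<close>

lemma mgrad_along_line:
  fixes x :: "'k::alg_closed_field ^ 'n"
  assumes "\<And>c. meval p (($) (x + c *s v)) = poly P c"
  shows "functional (mgrad p x) v = poly (pderiv P) 0"
proof -
  obtain Q where Q: "\<And>c. meval p (($) (x + c *s v)) = poly Q c" "functional (mgrad p x) v = poly (pderiv Q) 0"
    using mgrad_along_line_ex[of p x v] by blast
  have "P = Q" by (rule poly_fun_eq_imp_eq) (use assms Q(1) in metis)
  then show ?thesis using Q(2) by simp
qed

lemma mgrad_scale: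
  fixes x :: "'k::alg_closed_field ^ 'n"
  assumes p: "homogeneous d p" and c: "c \<noteq> 0"
  shows "mgrad p (c *s x) = (c ^ d / c) *s mgrad p x"
proof (rule functional_inject)
  fix v
  obtain Q where Q: "\<And>t. meval p (($) (x + t *s v)) = poly Q t" "functional (mgrad p x) v = poly (pderiv Q) 0"
    using mgrad_along_line_ex[of p x v] by blast
  have form: "(\<lambda>x. meval p (($) x)) \<in> forms d" using p forms_iff_meval by blast
  define P where "P = smult (c ^ d) (pcompose Q [:0, 1 / c:])"
  have "meval p (($) (c *s x + t *s v)) = poly P t" for t
  proof -
    have "c *s x + t *s v = c *s (x + (t / c) *s v)"
      using c by (simp add: vector_add_ldistrib vector_smult_assoc)
    then have "meval p (($) (c *s x + t *s v)) = c ^ d * meval p (($) (x + (t / c) *s v))"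
      using form_homogeneous[OF form, of c "x + (t / c) *s v"] by (simp only:)
    then show ?thesis by (simp add: P_def Q(1) poly_pcompose)
  qed
  then have "functional (mgrad p (c *s x)) v = poly (pderiv P) 0" by (rule mgrad_along_line)
  also have "\<dots> = c ^ d / c * poly (pderiv Q) 0"
    by (simp add: P_def pderiv_smult pderiv_pcompose poly_pcompose pderiv_pCons)
  finally show "functional (mgrad p (c *s x)) v = functional ((c ^ d / c) *s mgrad p x) v"
    by (simp add: functional_scale_left Q(2))
qed

text \<open>By the product rule; the derivatives of the coefficients are multiplied by values that are zero.\<close>

lemma mgrad_combination:
  fixes x :: "'k::alg_closed_field ^ 'n"
  assumes "finite G" "\<And>y. meval p (($) y) = (\<Sum>q\<in>G. g q y * meval q (($) y))"
    and g: "\<And>q a v. q \<in> G \<Longrightarrow> \<exists>P. \<forall>c. g q (a + c *s v) = poly P c"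
    and zero: "\<And>q. q \<in> G \<Longrightarrow> meval q (($) x) = 0"
  shows "mgrad p x = (\<Sum>q\<in>G. g q x *s mgrad q x)"
proof (rule functional_inject)
  fix v
  have "\<forall>q\<in>G. \<exists>P. \<forall>c. g q (x + c *s v) = poly P c" using g by blast
  then obtain P where P: "\<And>q c. q \<in> G \<Longrightarrow> g q (x + c *s v) = poly (P q) c" by metis
  obtain Q where Q: "\<And>q c. meval q (($) (x + c *s v)) = poly (Q q) c"
    "\<And>q. functional (mgrad q x) v = poly (pderiv (Q q)) 0"
    using mgrad_along_line_ex[of _ x v] by metis
  have "meval p (($) (x + c *s v)) = poly (\<Sum>q\<in>G. P q * Q q) c" for c
    unfolding assms(2) by (simp add: poly_sum P Q(1))
  then have "functional (mgrad p x) v = poly (pderiv (\<Sum>q\<in>G. P q * Q q)) 0"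
    by (rule mgrad_along_line)
  also have "\<dots> = (\<Sum>q\<in>G. poly (P q) 0 * poly (pderiv (Q q)) 0 + poly (Q q) 0 * poly (pderiv (P q)) 0)"
    by (simp add: pderiv_sum pderiv_mult poly_sum)
  also have "\<dots> = (\<Sum>q\<in>G. g q x * functional (mgrad q x) v)"
  proof (rule sum.cong[OF refl])
    fix q assume q: "q \<in> G"
    have "poly (P q) 0 = g q x" using P[OF q, of 0] by simp
    moreover have "poly (Q q) 0 = 0" using Q(1)[of q 0] zero[OF q] by simp
    ultimately show "poly (P q) 0 * poly (pderiv (Q q)) 0 + poly (Q q) 0 * poly (pderiv (P q)) 0
        = g q x * functional (mgrad q x) v" by (simp add: Q(2))
  qed
  also have "\<dots> = functional (\<Sum>q\<in>G. g q x *s mgrad q x) v"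
  proof -
    have "functional (sum h A) v = (\<Sum>a\<in>A. functional (h a) v)"
      for h :: "('n, 'k) mpoly \<Rightarrow> 'k ^ 'n" and A
      by (induction A rule: infinite_finite_induct) (simp_all add: functional_add_left)
    then show ?thesis by (simp only: functional_scale_left)
  qed
  finally show "functional (mgrad p x) v = functional (\<Sum>q\<in>G. g q x *s mgrad q x) v" .
qed

lemma vanishing_forms_zero:
  assumes "p \<in> vanishing_forms X" "x \<in> affine_cone X"
  shows "meval p (($) x) = 0"
  using assms line_self[of x] unfolding vanishing_forms_def affine_cone_def by blast

text \<open>Finitely many generators of the ideal of \<open>X\<close> suffice to describe all tangent spaces of \<open>X\<close>
  simultaneously.\<close>

lemma finite_gradient_generators:
  fixes X :: "('k::alg_closed_field ^ 'n) set set"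
  shows "\<exists>G. finite G \<and> G \<subseteq> vanishing_forms X \<and>
    (\<forall>p\<in>vanishing_forms X. \<forall>x\<in>affine_cone X. mgrad p x \<in> vec.span ((\<lambda>q. mgrad q x) ` G))"
proof -
  obtain A :: "('k ^ 'n \<Rightarrow> 'k) set" where A: "subring_set A" "noetherian_set A" "\<forall>c. (\<lambda>_. c) \<in> A"
    "\<forall>i. (\<lambda>x. x $ i) \<in> A" "\<forall>f\<in>A. \<forall>a v. \<exists>P. \<forall>c. f (a + c *s v) = poly P c"
    using noetherian_polynomial_ring by metis
  let ?ev = "\<lambda>p x. meval p (($) x)"
  let ?F = "?ev ` vanishing_forms X"
  have "?F \<subseteq> A"
  proof
    fix f assume "f \<in> ?F"
    then obtain p d where "f = ?ev p" "homogeneous d p" by (auto simp: vanishing_forms_def)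
    then have "f \<in> forms d" unfolding forms_iff_meval by blast
    moreover have "forms d \<subseteq> A" unfolding forms_def by (rule mono_span_subset_ring) (use A in auto)
    ultimately show "f \<in> A" by blast
  qed
  from noetherian_finite_generation[OF A(1,2) this]
  obtain F where F: "F \<subseteq> ?F" "finite F"
    "\<forall>f\<in>?F. \<exists>g. (\<forall>h\<in>F. g h \<in> A) \<and> f = (\<Sum>h\<in>F. g h * h)"
    by (elim exE conjE) (rule that)
  obtain G where G: "G \<subseteq> vanishing_forms X" "F = ?ev ` G" "inj_on ?ev G"
    using F(1) by (auto simp: subset_image_inj)
  have finG: "finite G" using F(2) G(2,3) by (simp add: finite_image_iff)
  have "mgrad p x \<in> vec.span ((\<lambda>q. mgrad q x) ` G)" if p: "p \<in> vanishing_forms X" and x: "x \<in> affine_cone X" for p x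
  proof -
    obtain g where g: "\<forall>h\<in>F. g h \<in> A" "?ev p = (\<Sum>h\<in>F. g h * h)" using F(3) p by blast
    have "mgrad p x = (\<Sum>q\<in>G. g (?ev q) x *s mgrad q x)"
    proof (rule mgrad_combination[OF finG])
      fix y
      have "(\<Sum>h\<in>F. g h * h) = (\<Sum>q\<in>G. g (?ev q) * ?ev q)"
        unfolding G(2) by (rule sum.reindex_cong[OF G(3) refl refl])
      then have "?ev p y = (\<Sum>q\<in>G. g (?ev q) * ?ev q) y" using fun_cong[OF g(2), of y] by (simp only:)
      then show "?ev p y = (\<Sum>q\<in>G. g (?ev q) y * ?ev q y)" by (simp add: sum_fun_apply)
    next
      fix q and a v :: "'k ^ 'n" assume "q \<in> G"
      then have "g (?ev q) \<in> A" using g(1) G(2) by blast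
      then show "\<exists>P. \<forall>c. g (?ev q) (a + c *s v) = poly P c" using A(5) by blast
    next
      fix q assume "q \<in> G"
      then show "?ev q x = 0" using vanishing_forms_zero G(1) x by blast
    qed
    also have "\<dots> \<in> vec.span ((\<lambda>q. mgrad q x) ` G)"
      by (intro vec.span_sum vec.span_scale vec.span_base) blast
    finally show ?thesis .
  qed
  then show ?thesis using finG G(1) by blast
qed

lemma tangent_cone_generators:
  fixes X :: "('k::alg_closed_field ^ 'n) set set"
  assumes G: "G \<subseteq> vanishing_forms X"
    and gen: "\<forall>p\<in>vanishing_forms X. \<forall>x\<in>affine_cone X. mgrad p x \<in> vec.span ((\<lambda>q. mgrad q x) ` G)"
    and x: "x \<in> affine_cone X"
  shows "tangent_cone X (line x) = {v. \<forall>q\<in>G. functional (mgrad q x) v = 0}"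
proof (intro set_eqI iffI)
  fix v assume "v \<in> tangent_cone X (line x)"
  moreover have "x \<in> line x - {0}" using x line_self[of x] by (simp add: affine_cone_def)
  ultimately show "v \<in> {v. \<forall>q\<in>G. functional (mgrad q x) v = 0}"
    using G unfolding tangent_cone_def functional_mgrad by blast
next
  fix v assume v: "v \<in> {v. \<forall>q\<in>G. functional (mgrad q x) v = 0}"
  have "functional (mgrad p x') v = 0" if p: "p \<in> vanishing_forms X" and x': "x' \<in> line x - {0}" for p x'
  proof -
    obtain c where c: "c \<noteq> 0" "x' = c *s x" using in_line_nonzero[of x' x] x' by blast
    have "line x' = line x" using line_scale[OF c(1), of x] c(2) by simp
    then have "x' \<in> affine_cone X" using x x' by (simp add: affine_cone_def)
    then have sp: "mgrad p x' \<in> vec.span ((\<lambda>q. mgrad q x') ` G)" using gen p by blast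
    have "functional (mgrad q x') v = 0" if q: "q \<in> G" for q
    proof -
      obtain d where d: "homogeneous d q" using G q by (auto simp: vanishing_forms_def)
      then show ?thesis using v q by (simp add: c(2) mgrad_scale[OF d c(1)] functional_scale_left)
    qed
    then show ?thesis using functional_span_zero[OF _ sp] by blast
  qed
  then show "v \<in> tangent_cone X (line x)" unfolding tangent_cone_def functional_mgrad by blast
qed

text \<open>The conormal space at a regular point is the span of the gradients of the equations, by double
  annihilation. Its dimension is at most the codimension \<open>CARD('n) - (r + 1)\<close> of \<open>X\<close>, so a basis of it
  consists of the gradients of at most that many of the equations; a shorter tuple is padded with
  coefficients \<open>0\<close>.\<close>

lemma conormal_vector_combination:
  fixes X :: "('k::alg_closed_field ^ 'n) set set"
  assumes G: "finite G" "G \<subseteq> vanishing_forms X"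
    and gen: "\<forall>p\<in>vanishing_forms X. \<forall>x\<in>affine_cone X. mgrad p x \<in> vec.span ((\<lambda>q. mgrad q x) ` G)"
    and reg: "line x \<in> regular_points X" "x \<noteq> 0" and dim: "variety_dim X = enat r"
    and y: "y \<noteq> 0" "embedded_tangent_space X (line x) \<subseteq> hyperplane y"
  shows "r + 1 < CARD('n)"
    "\<exists>J\<in>{..<CARD('n) - (r + 1)} \<rightarrow>\<^sub>E G. \<exists>t. y = (\<Sum>j<CARD('n) - (r + 1). t j *s mgrad (J j) x)"
proof -
  let ?T = "tangent_cone X (line x)" and ?S = "(\<lambda>q. mgrad q x) ` G" and ?c = "CARD('n) - (r + 1)"
  have x: "x \<in> affine_cone X" using reg by (simp add: regular_points_def affine_cone_def)
  have dT: "vec.dim ?T = r + 1" using reg(1) dim by (simp add: regular_points_def one_enat_def)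
  have T: "?T = {v. \<forall>q\<in>G. functional (mgrad q x) v = 0}"
    by (rule tangent_cone_generators[OF G(2) gen x])
  have yT: "functional y v = 0" if "v \<in> ?T" for v
  proof (cases "v = 0")
    case True
    then show ?thesis by (simp add: functional_def)
  next
    case False
    then have "line v \<in> hyperplane y"
      using y(2) that unfolding embedded_tangent_space_def proj_space_def by blast
    then obtain w where w: "line v = line w" "functional y w = 0" "w \<noteq> 0"
      unfolding hyperplane_def proj_space_def by blast
    obtain c where "v = c *s w" using line_eq_imp_scale[of w v] w(1) False by metis
    then show ?thesis using w(2) by (simp add: functional_scale_right)
  qed
  have ySp: "y \<in> vec.span ?S"
    by (rule double_annihilator) (use yT T in blast)
  have "vec.dim ?S + vec.dim ?T \<le> CARD('n)"
    by (rule dim_annihilator_le) (use T in blast)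
  then have dS: "vec.dim ?S + (r + 1) \<le> CARD('n)" using dT by simp
  obtain B where B: "B \<subseteq> ?S" "vec.independent B" "?S \<subseteq> vec.span B" "card B = vec.dim ?S"
    using vec.basis_exists by blast
  have finB: "finite B" using vec.finiteI_independent[OF B(2)] .
  have "y \<in> vec.span B" using ySp vec.span_mono[OF B(3)] vec.span_span[of B] by blast
  then obtain u where u: "y = (\<Sum>b\<in>B. u b *s b)" unfolding vec.span_finite[OF finB] by blast
  then have B0: "B \<noteq> {}" using y(1) by auto
  then have "card B > 0" using finB by (simp add: card_gt_0_iff)
  then show "r + 1 < CARD('n)" using dS B(4) by simp
  have cB: "card B \<le> ?c" using dS B(4) by simp
  obtain h where h: "bij_betw h {..<card B} B" using ex_bij_betw_nat_finite[OF finB] by (auto simp: atLeast0LessThan)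
  have "\<forall>b\<in>B. \<exists>q\<in>G. b = mgrad q x" using B(1) by blast
  then obtain rep where rep: "\<And>b. b \<in> B \<Longrightarrow> rep b \<in> G" "\<And>b. b \<in> B \<Longrightarrow> b = mgrad (rep b) x" by metis
  obtain b0 where b0: "b0 \<in> B" using B0 by blast
  have hB: "h j \<in> B" if "j < card B" for j using h that unfolding bij_betw_def by blast
  let ?J = "\<lambda>j\<in>{..<?c}. if j < card B then rep (h j) else rep b0"
  let ?t = "\<lambda>j. if j < card B then u (h j) else 0"
  have "?J \<in> {..<?c} \<rightarrow>\<^sub>E G" using rep(1) hB b0 by auto
  moreover have "y = (\<Sum>j<?c. ?t j *s mgrad (?J j) x)"
  proof -
    have "(\<Sum>j<?c. ?t j *s mgrad (?J j) x) = (\<Sum>j<card B. u (h j) *s h j)"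
    proof (rule sum.mono_neutral_cong_right)
      fix j assume "j \<in> {..<card B}"
      then show "?t j *s mgrad (?J j) x = u (h j) *s h j"
        using rep(2)[OF hB, of j] cB by simp
    qed (use cB in auto)
    also have "\<dots> = (\<Sum>b\<in>B. u b *s b)" by (rule sum.reindex_bij_betw[OF h])
    finally show ?thesis using u by simp
  qed
  ultimately show "\<exists>J\<in>{..<?c} \<rightarrow>\<^sub>E G. \<exists>t. y = (\<Sum>j<?c. t j *s mgrad (J j) x)"
    by (intro bexI[of _ ?J] exI[of _ ?t])
qed

section \<open>The Zariski topology of a product\<close>

definition pair_coord :: "'n::finite + 'm::finite \<Rightarrow> ('k ^ 'n) \<times> ('k ^ 'm) \<Rightarrow> 'k" where
  "pair_coord v = (\<lambda>(x, y). case_sum (($) x) (($) y) v)"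

definition biforms :: "nat \<Rightarrow> nat \<Rightarrow> (('k::field ^ 'n) \<times> ('k ^ 'm) \<Rightarrow> 'k) set" where
  "biforms d e = mono_span UNIV pair_coord (bideg_exps UNIV UNIV d e)"

lemma biforms_iff_meval:
  "f \<in> biforms d e \<longleftrightarrow>
    (\<exists>p. bihomogeneous d e p \<and> f = (\<lambda>(x, y). meval p (case_sum (($) x) (($) y))))"
proof -
  have "(\<lambda>q. meval p (\<lambda>i. pair_coord i q)) = (\<lambda>(x, y). meval p (case_sum (($) x) (($) y)))"
    for p :: "('b + 'c, 'a) mpoly"
    by (auto simp: fun_eq_iff pair_coord_def)
  then show ?thesis
    unfolding biforms_def mono_span_iff_meval bihomogeneous_def bideg_exps_def by simp
qed

lemma mono_fn_pair_coord:
  "mono_fn UNIV pair_coord m (x, y) = (\<Prod>i\<in>UNIV. x $ i ^ m (Inl i)) * (\<Prod>j\<in>UNIV. y $ j ^ m (Inr j))"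
  unfolding mono_fn_def UNIV_Plus_UNIV[symmetric]
  by (subst prod.Plus) (simp_all add: pair_coord_def)

lemma mono_fn_pair_scale:
  "mono_fn UNIV pair_coord m (a *s x, b *s y) =
     a ^ (\<Sum>i\<in>UNIV. m (Inl i)) * b ^ (\<Sum>j\<in>UNIV. m (Inr j)) * mono_fn UNIV pair_coord m (x, y)"
  by (simp add: mono_fn_pair_coord power_mult_distrib prod.distrib power_sum mult_ac)

lemma biform_homogeneous:
  assumes "f \<in> biforms d e"
  shows "f (a *s x, b *s y) = a ^ d * b ^ e * f (x, y)"
  using assms unfolding biforms_def mono_span_def
proof (induction rule: fs.span_induct_alt)
  case (step c g h)
  then obtain m where m: "g = mono_fn UNIV pair_coord m" "(\<Sum>i\<in>UNIV. m (Inl i)) = d" "(\<Sum>j\<in>UNIV. m (Inr j)) = e"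
    by (auto simp: bideg_exps_def)
  have "g (a *s x, b *s y) = a ^ d * b ^ e * g (x, y)"
    unfolding m(1) mono_fn_pair_scale m(2,3) ..
  then show ?case using step by (simp add: fscale_apply algebra_simps)
qed simp

lemma openin_bizariski_biform:
  assumes "f \<in> biforms d e"
  shows "openin bizariski {(P, H). P \<in> proj_space UNIV \<and> H \<in> proj_space UNIV \<and>
    (\<exists>x\<in>P. \<exists>y\<in>H. f (x, y) \<noteq> 0)}"
proof -
  obtain p where p: "bihomogeneous d e p" "f = (\<lambda>(x, y). meval p (case_sum (($) x) (($) y)))"
    using assms unfolding biforms_iff_meval by blast
  show ?thesis
    unfolding bizariski_def openin_topology_generated_by_iff
    by (rule generate_topology_on.Basis) (use p in auto)
qed

lemma topspace_bizariski: "topspace bizariski \<subseteq> proj_space UNIV \<times> proj_space UNIV"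
  unfolding bizariski_def topology_generated_by_topspace by blast

abbreviation lines :: "('k::field ^ 'n) \<times> ('k ^ 'm) \<Rightarrow> ('k ^ 'n) set \<times> ('k ^ 'm) set" where
  "lines \<equiv> \<lambda>(x, y). (line x, line y)"

text \<open>The nonvanishing set of a bihomogeneous polynomial is open.\<close>

lemma biform_vanishes_on_closure:
  assumes f: "f \<in> biforms d e" and N: "\<And>x y. (x, y) \<in> N \<Longrightarrow> f (x, y) = 0"
    and cl: "(line x, line y) \<in> bizariski closure_of (lines ` N)"
  shows "f (x, y) = 0"
proof (rule ccontr)
  assume ne: "f (x, y) \<noteq> 0"
  let ?U = "{(P, H). P \<in> proj_space UNIV \<and> H \<in> proj_space UNIV \<and> (\<exists>x\<in>P. \<exists>y\<in>H. f (x, y) \<noteq> 0)}"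
  have "(line x, line y) \<in> topspace bizariski" using cl by (simp add: in_closure_of)
  then have "line x \<in> proj_space UNIV" "line y \<in> proj_space UNIV"
    using topspace_bizariski by blast+
  moreover have "\<exists>x'\<in>line x. \<exists>y'\<in>line y. f (x', y') \<noteq> 0"
    using ne line_self[of x] line_self[of y] by (intro bexI)
  ultimately have U: "(line x, line y) \<in> ?U" by simp
  have "\<exists>z. z \<in> lines ` N \<and> z \<in> ?U"
    using cl U openin_bizariski_biform[OF f] unfolding in_closure_of by (elim conjE allE[of _ ?U]) simp
  then obtain z where "z \<in> lines ` N" "z \<in> ?U" by (elim exE conjE) (rule that)
  then obtain x' y' x'' y'' where *: "(x', y') \<in> N" "x'' \<in> line x'" "y'' \<in> line y'" "f (x'', y'') \<noteq> 0"
    by auto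
  obtain a b where "x'' = a *s x'" "y'' = b *s y'" using *(2,3) unfolding line_eq by blast
  then show False using *(4) N[OF *(1)] biform_homogeneous[OF f, of a x' b y'] by simp
qed

text \<open>A polynomial in \<open>(x, y)\<close> that vanishes on the chart \<open>x $ i0 = 1\<close> of a set stable under scaling in
  \<open>y\<close> has homogeneous components in \<open>y\<close> that vanish there as well. Homogenized in \<open>x\<close> with the help of
  \<open>x $ i0\<close>, with one factor to spare, they vanish on the whole set, also where \<open>x $ i0 = 0\<close>, and then
  on its closure.\<close>

lemma polynomial_vanishes_on_closure:
  fixes N :: "(('k::alg_closed_field ^ 'n) \<times> ('k ^ 'm)) set"
    and x :: "'k ^ 'n" and y :: "'k ^ 'm"
  assumes scale: "\<And>x y a b. (x, y) \<in> N \<Longrightarrow> a \<noteq> 0 \<Longrightarrow> b \<noteq> 0 \<Longrightarrow> (a *s x, b *s y) \<in> N"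
    and g: "g \<in> mono_span UNIV pair_coord UNIV"
    and van: "\<And>x y. (x, y) \<in> N \<Longrightarrow> x $ i0 = 1 \<Longrightarrow> g (x, y) = 0"
    and cl: "(line x, line y) \<in> bizariski closure_of (lines ` N)" and x: "x $ i0 = 1"
  shows "g (x, y) = 0"
proof -
  obtain S c where S: "finite S" "\<And>p. g p = (\<Sum>m\<in>S. c m * mono_fn UNIV pair_coord m p)"
    using mono_span_explicit[OF g] by metis
  let ?dx = "\<lambda>m :: 'n + 'm \<Rightarrow> nat. \<Sum>i\<in>UNIV. m (Inl i)" and ?dy = "\<lambda>m :: 'n + 'm \<Rightarrow> nat. \<Sum>j\<in>UNIV. m (Inr j)"
  \<comment> \<open>Any common bound on the degrees in \<open>x\<close> would do.\<close>
  define E where "E = (\<Sum>m\<in>S. ?dx m)"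
  have E: "?dx m \<le> E" if "m \<in> S" for m unfolding E_def by (rule member_le_sum) (use S(1) that in auto)
  define G where "G = (\<lambda>\<beta> (p :: ('k ^ 'n) \<times> ('k ^ 'm)). \<Sum>m\<in>{m \<in> S. ?dy m = \<beta>}.
    c m * (fst p $ i0 ^ (E + 1 - ?dx m) * mono_fn UNIV pair_coord m p))"
  have G: "G \<beta> \<in> biforms (E + 1) \<beta>" for \<beta>
    unfolding G_def biforms_def mono_span_def
  proof (rule span_sum_scale)
    show "finite {m \<in> S. ?dy m = \<beta>}" using S(1) by simp
    fix m assume m: "m \<in> {m \<in> S. ?dy m = \<beta>}"
    let ?m = "\<lambda>v. m v + (if v = Inl i0 then E + 1 - ?dx m else 0)"
    have "(\<lambda>p :: ('k ^ 'n) \<times> ('k ^ 'm). fst p $ i0 ^ (E + 1 - ?dx m) * mono_fn UNIV pair_coord m p) = mono_fn UNIV pair_coord ?m"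
    proof
      fix p :: "('k ^ 'n) \<times> ('k ^ 'm)"
      obtain x y where p: "p = (x, y)" by (cases p)
      have "(\<Prod>i\<in>UNIV. x $ i ^ ?m (Inl i)) =
          (\<Prod>i\<in>UNIV. x $ i ^ m (Inl i)) * (\<Prod>i\<in>UNIV. if i = i0 then x $ i ^ (E + 1 - ?dx m) else 1)"
        unfolding prod.distrib[symmetric] by (rule prod.cong) (auto simp: power_add)
      then show "fst p $ i0 ^ (E + 1 - ?dx m) * mono_fn UNIV pair_coord m p = mono_fn UNIV pair_coord ?m p"
        unfolding p mono_fn_pair_coord by simp
    qed
    moreover have "?m \<in> bideg_exps UNIV UNIV (E + 1) \<beta>"
    proof -
      have "(\<Sum>i\<in>UNIV. ?m (Inl i)) = ?dx m + (\<Sum>i\<in>UNIV. if i = i0 then E + 1 - ?dx m else 0)"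
        unfolding sum.distrib[symmetric] by (rule sum.cong) auto
      also have "\<dots> = E + 1" using E[of m] m by simp
      finally show ?thesis using m by (simp add: bideg_exps_def)
    qed
    ultimately show "(\<lambda>p :: ('k ^ 'n) \<times> ('k ^ 'm). fst p $ i0 ^ (E + 1 - ?dx m) * mono_fn UNIV pair_coord m p)
        \<in> fs.span (mono_fn UNIV pair_coord ` bideg_exps UNIV UNIV (E + 1) \<beta>)"
      by (simp only: fs.span_base imageI)
  qed
  have G0: "G \<beta> (x, y) = 0" if N: "(x, y) \<in> N" for x y \<beta>
  proof (cases "x $ i0 = 0")
    case True
    show ?thesis unfolding G_def
    proof (rule sum.neutral, rule ballI)
      fix m assume "m \<in> {m \<in> S. ?dy m = \<beta>}"
      then have "E + 1 - ?dx m > 0" using E[of m] by auto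
      then show "c m * (fst (x, y) $ i0 ^ (E + 1 - ?dx m) * mono_fn UNIV pair_coord m (x, y)) = 0"
        using True by simp
    qed
  next
    case False
    let ?x = "(1 / x $ i0) *s x"
    have x1: "?x $ i0 = 1" using False by simp
    define P where "P = (\<Sum>m\<in>S. monom (c m * mono_fn UNIV pair_coord m (?x, y)) (?dy m))"
    have "poly P b = 0" if b: "b \<noteq> 0" for b
    proof -
      have "(?x, b *s y) \<in> N" using scale[OF N, of "1 / x $ i0" b] b False by simp
      then have "g (?x, b *s y) = 0" using van x1 by blast
      moreover have "mono_fn UNIV pair_coord m (?x, b *s y) = b ^ ?dy m * mono_fn UNIV pair_coord m (?x, y)" for m
        using mono_fn_pair_scale[of m 1 ?x b y] by simp
      ultimately show ?thesis
        unfolding P_def S(2) by (simp add: poly_sum poly_monom mult_ac)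
    qed
    then have "P = 0" by (rule poly_fun_zero_imp_zero)
    then have "coeff P \<beta> = 0" by simp
    then have "(\<Sum>m\<in>{m \<in> S. ?dy m = \<beta>}. c m * mono_fn UNIV pair_coord m (?x, y)) = 0"
      unfolding P_def coeff_sum coeff_monom by (simp add: sum.inter_filter[OF S(1)])
    then have "G \<beta> (?x, y) = 0" unfolding G_def using x1 by simp
    moreover have "G \<beta> (x, y) = x $ i0 ^ (E + 1) * G \<beta> (?x, y)"
      using biform_homogeneous[OF G, of \<beta> "x $ i0" ?x 1 y] False by (simp add: vector_smult_assoc)
    ultimately show ?thesis by simp
  qed
  have "g (x, y) = (\<Sum>\<beta>\<in>?dy ` S. \<Sum>m\<in>{m \<in> S. ?dy m = \<beta>}. c m * mono_fn UNIV pair_coord m (x, y))"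
    unfolding S(2) by (rule sum.image_gen[OF S(1)])
  also have "\<dots> = (\<Sum>\<beta>\<in>?dy ` S. G \<beta> (x, y))"
    unfolding G_def using x by simp
  also have "\<dots> = 0"
    by (rule sum.neutral, rule ballI, rule biform_vanishes_on_closure[OF G G0 cl])
  finally show ?thesis .
qed

section \<open>Symmetric forms\<close>

lemma bilin_axis: "bilin q (axis i 1) (axis j 1) = q $ (i, j)"
proof -
  have "bilin q (axis i 1) (axis j 1) = (\<Sum>a\<in>UNIV. \<Sum>b\<in>UNIV. if a = i then (if b = j then q $ (a, b) else 0) else 0)"
    unfolding bilin_def by (intro sum.cong refl) (auto simp: axis_def)
  also have "\<dots> = (\<Sum>a\<in>UNIV. if a = i then q $ (a, j) else 0)"
    by (rule sum.cong) (auto simp: sum.delta)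
  finally show ?thesis by simp
qed

lemma sym_forms_iff: "q \<in> sym_forms \<longleftrightarrow> (\<forall>i j. q $ (i, j) = q $ (j, i))"
proof
  assume "q \<in> sym_forms"
  then have "bilin q (axis i 1) (axis j 1) = bilin q (axis j 1) (axis i 1)" for i j
    unfolding sym_forms_def by blast
  then show "\<forall>i j. q $ (i, j) = q $ (j, i)" by (simp only: bilin_axis simp_thms)
next
  assume s: "\<forall>i j. q $ (i, j) = q $ (j, i)"
  have "bilin q x y = bilin q y x" for x y
  proof -
    have "bilin q x y = (\<Sum>j\<in>UNIV. \<Sum>i\<in>UNIV. q $ (i, j) * x $ i * y $ j)"
      unfolding bilin_def by (rule sum.swap)
    also have "\<dots> = bilin q y x"
      unfolding bilin_def by (intro sum.cong refl) (use s in \<open>auto simp: mult_ac\<close>)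
    finally show ?thesis .
  qed
  then show "q \<in> sym_forms" by (simp add: sym_forms_def)
qed

lemma form_along_line:
  assumes "f \<in> forms d"
  shows "\<exists>P. \<forall>c. f (x + c *s v) = poly P c"
  using assms unfolding forms_def
proof (rule mono_span_along_curve)
  fix i show "\<exists>P. \<forall>c. (x + c *s v) $ i = poly P c"
    by (rule exI[of _ "[:x $ i, v $ i:]"]) simp
qed

text \<open>The space of symmetric forms is irreducible: on the line joining two symmetric forms, two polynomial
  functions that do not vanish identically have a common nonzero.\<close>

lemma common_nonvanishing_form:
  fixes \<F> :: "('k::alg_closed_field ^ ('n::finite \<times> 'n) \<Rightarrow> 'k) set"
  assumes "finite \<F>" "\<And>F. F \<in> \<F> \<Longrightarrow> (\<exists>d. F \<in> forms d) \<and> (\<exists>q\<in>sym_forms. F q \<noteq> 0)"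
  shows "\<exists>d \<Phi>. \<Phi> \<in> forms d \<and> (\<exists>q\<in>sym_forms. \<Phi> q \<noteq> 0) \<and> (\<forall>q. \<Phi> q \<noteq> 0 \<longrightarrow> (\<forall>F\<in>\<F>. F q \<noteq> 0))"
  using assms
proof (induction \<F> rule: finite_induct)
  case empty
  have "0 \<in> sym_forms" by (simp add: sym_forms_iff)
  then have "\<exists>q\<in>sym_forms. (1 :: 'k ^ ('n \<times> 'n) \<Rightarrow> 'k) q \<noteq> 0" by (intro bexI[of _ 0]) simp_all
  then show ?case using forms_one by (intro exI[of _ 0] exI[of _ 1]) blast
next
  case (insert F \<F>)
  then obtain d \<Phi> where \<Phi>: "\<Phi> \<in> forms d" "\<exists>q\<in>sym_forms. \<Phi> q \<noteq> 0" "\<forall>q. \<Phi> q \<noteq> 0 \<longrightarrow> (\<forall>F\<in>\<F>. F q \<noteq> 0)"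
    by auto
  obtain e where F: "F \<in> forms e" "\<exists>q\<in>sym_forms. F q \<noteq> 0" using insert.prems by blast
  obtain q1 q2 where q: "q1 \<in> sym_forms" "\<Phi> q1 \<noteq> 0" "q2 \<in> sym_forms" "F q2 \<noteq> 0" using \<Phi>(2) F(2) by blast
  obtain P1 where P1: "\<And>c. \<Phi> (q1 + c *s (q2 - q1)) = poly P1 c" using form_along_line[OF \<Phi>(1)] by metis
  obtain P2 where P2: "\<And>c. F (q1 + c *s (q2 - q1)) = poly P2 c" using form_along_line[OF F(1)] by metis
  have "poly P1 0 \<noteq> 0" using P1[of 0] q(2) by simp
  moreover have "poly P2 1 \<noteq> 0" using P2[of 1] q(4) by simp
  ultimately have "P1 * P2 \<noteq> 0" by auto
  then obtain c where c: "poly (P1 * P2) c \<noteq> 0" using poly_fun_zero_imp_zero by blast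
  let ?q = "q1 + c *s (q2 - q1)"
  have "?q \<in> sym_forms" using q(1,3) by (simp add: sym_forms_iff)
  moreover have "(\<Phi> * F) ?q \<noteq> 0" using c P1[of c] P2[of c] by (simp only: times_fun_apply poly_mult not_False_eq_True)
  moreover have "\<forall>F'\<in>insert F \<F>. F' q \<noteq> 0" if "(\<Phi> * F) q \<noteq> 0" for q
    using that \<Phi>(3) by auto
  ultimately show ?case using forms_mult[OF \<Phi>(1) F(1)] by (intro exI[of _ "d + e"] exI[of _ "\<Phi> * F"] conjI) blast+
qed

definition form_det :: "'k::field ^ ('n::finite \<times> 'n) \<Rightarrow> 'k" where
  "form_det q = det (\<chi> i j. q $ (i, j))"

lemma form_det_form: "(form_det :: 'k::field ^ ('n::finite \<times> 'n) \<Rightarrow> 'k) \<in> forms CARD('n)"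
proof -
  have "(form_det :: 'k ^ ('n::finite \<times> 'n) \<Rightarrow> 'k) = (\<lambda>q. \<Sum>\<pi> | \<pi> permutes (UNIV :: 'n set). of_int (sign \<pi>) * (\<lambda>q. \<Prod>i\<in>UNIV. q $ (i, \<pi> i)) q)"
    by (simp add: form_det_def det_def fun_eq_iff)
  also have "\<dots> \<in> forms CARD('n)"
    unfolding forms_def mono_span_def
  proof (rule span_sum_scale)
    show "finite {\<pi>. \<pi> permutes (UNIV :: 'n set)}" by (simp add: finite_permutations)
    fix \<pi> :: "'n \<Rightarrow> 'n"
    have "(\<lambda>q :: 'k ^ ('n::finite \<times> 'n). \<Prod>i\<in>UNIV. q $ (i, \<pi> i)) \<in>
        mono_span UNIV (\<lambda>i x. x $ i) (deg_exps UNIV (\<Sum>i\<in>(UNIV :: 'n set). 1))"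
      by (rule deg_span_prod, simp, rule deg_span_var) simp_all
    then show "(\<lambda>q :: 'k ^ ('n::finite \<times> 'n). \<Prod>i\<in>UNIV. q $ (i, \<pi> i)) \<in>
        fs.span (mono_fn UNIV (\<lambda>i x. x $ i) ` deg_exps UNIV CARD('n))"
      by (simp add: mono_span_def)
  qed
  finally show ?thesis .
qed

lemma flat_zero_imp_zero:
  assumes "form_det q \<noteq> 0" "flat q x = 0"
  shows "x = 0"
proof -
  let ?A = "(\<chi> i j. q $ (i, j))"
  obtain B where B: "?A ** B = mat 1"
    using assms(1) unfolding form_det_def invertible_det_nz[symmetric] invertible_def by blast
  have "x v* ?A = 0"
    using assms(2) by (simp add: flat_def vector_matrix_mult_def vec_eq_iff mult.commute)
  then have "x v* (?A ** B) = 0 v* B" by (simp add: vector_matrix_mul_assoc[symmetric])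
  then show ?thesis using B by simp
qed

lemma nondegenerate_if_form_det:
  assumes "form_det q \<noteq> 0"
  shows "nondegenerate q"
  unfolding nondegenerate_def
proof (intro allI impI)
  fix x assume "\<forall>y. bilin q x y = 0"
  then have "functional (flat q x) = functional 0" by (simp add: functional_flat fun_eq_iff)
  then have "flat q x = 0" using functional_inject by metis
  then show "x = 0" using flat_zero_imp_zero assms by blast
qed

lemma form_det_nonzero_somewhere: "\<exists>q\<in>sym_forms. form_det (q :: 'k::field ^ ('n::finite \<times> 'n)) \<noteq> 0"
proof -
  let ?q = "(\<chi> ij. if fst ij = snd ij then 1 else 0) :: 'k ^ ('n::finite \<times> 'n)"
  have "(\<chi> i j. ?q $ (i, j)) = (mat 1 :: 'k ^ 'n ^ 'n)" by (simp add: mat_def vec_eq_iff)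
  then have "form_det ?q = 1" by (simp add: form_det_def)
  moreover have "?q \<in> sym_forms" by (simp add: sym_forms_iff)
  ultimately show ?thesis by (metis zero_neq_one)
qed

text \<open>For nondegenerate \<open>q\<close>, the points \<open>([x], [qx])\<close> already form a closed set, cut out by the
  \<open>2 \<times> 2\<close> minors of \<open>y\<close> and \<open>qx\<close>.\<close>

lemma form_diagonal_points:
  fixes q :: "'k::field ^ ('n::finite \<times> 'n)"
  assumes q: "form_det q \<noteq> 0" and PH: "(P, H) \<in> form_diagonal q"
  shows "\<exists>x. x \<noteq> 0 \<and> P = line x \<and> H = line (flat q x)"
proof -
  let ?N = "{(x, flat q x) | x. x \<noteq> 0}"
  have "lines ` ?N = {(line x, line (flat q x)) | x. x \<noteq> 0}" by auto
  then have cl: "(P, H) \<in> bizariski closure_of (lines ` ?N)" using PH unfolding form_diagonal_def by simp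
  then have "(P, H) \<in> topspace bizariski" by (simp add: in_closure_of)
  then have "P \<in> proj_space UNIV" "H \<in> proj_space UNIV" using topspace_bizariski by blast+
  then obtain x y where xy: "x \<noteq> 0" "P = line x" "y \<noteq> 0" "H = line y"
    unfolding in_proj_space_UNIV by (elim exE conjE) (rule that)
  have flat_bi: "(\<lambda>(x, y). flat q x $ j * y $ i) \<in> biforms 1 1" for i j :: 'n
  proof -
    have "pair_coord (Inr i) \<in> mono_span (UNIV <+> UNIV) pair_coord (bideg_exps (UNIV :: 'n set) UNIV 0 1)"
      by (rule bideg_span_Inr) simp_all
    then have 1: "(pair_coord (Inr i) :: ('k ^ 'n) \<times> ('k ^ 'n) \<Rightarrow> 'k) \<in> biforms 0 1"
      unfolding biforms_def UNIV_Plus_UNIV .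
    have "pair_coord (Inl a) \<in> mono_span (UNIV <+> UNIV) pair_coord (bideg_exps UNIV (UNIV :: 'n set) 1 0)" for a :: 'n
      by (rule bideg_span_Inl) simp_all
    then have 2: "(pair_coord (Inl a) :: ('k ^ 'n) \<times> ('k ^ 'n) \<Rightarrow> 'k) \<in> biforms 1 0" for a
      unfolding biforms_def UNIV_Plus_UNIV .
    have "pair_coord (Inl a) * pair_coord (Inr i) \<in> (biforms (1 + 0) (0 + 1) :: (('k ^ 'n) \<times> ('k ^ 'n) \<Rightarrow> 'k) set)" for a
      using 1 2[of a] unfolding biforms_def by (intro bideg_span_mult)
    then have 3: "pair_coord (Inl a) * pair_coord (Inr i) \<in> (biforms 1 1 :: (('k ^ 'n) \<times> ('k ^ 'n) \<Rightarrow> 'k) set)" for a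
      by (simp only: add_0 add_0_right)
    have "(\<lambda>p. \<Sum>a\<in>UNIV. q $ (a, j) * (pair_coord (Inl a) * pair_coord (Inr i)) p) \<in> (biforms 1 1 :: (('k ^ 'n) \<times> ('k ^ 'n) \<Rightarrow> 'k) set)"
      unfolding biforms_def mono_span_def
      by (rule span_sum_scale, simp, rule 3[unfolded biforms_def mono_span_def])
    moreover have "(\<lambda>p. \<Sum>a\<in>UNIV. q $ (a, j) * (pair_coord (Inl a) * pair_coord (Inr i)) p) = (\<lambda>(x, y). flat q x $ j * y $ i)"
      by (auto simp: fun_eq_iff pair_coord_def flat_def sum_distrib_right sum_distrib_left mult_ac)
    ultimately show ?thesis by simp
  qed
  have minors: "flat q x $ j * y $ i = flat q x $ i * y $ j" for i j
  proof -
    let ?f = "\<lambda>i j. \<lambda>(x :: 'k ^ 'n, y :: 'k ^ 'n). flat q x $ j * y $ i"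
    have "?f i j - ?f j i \<in> biforms 1 1"
      using flat_bi[of j i] flat_bi[of i j] unfolding biforms_def mono_span_def by (rule fs.span_diff)
    then have "(?f i j - ?f j i) (x, y) = 0"
      by (rule biform_vanishes_on_closure[of _ 1 1 ?N]) (use cl xy in \<open>auto simp: mult.commute\<close>)
    then show ?thesis by simp
  qed
  have "flat q x \<noteq> 0" using flat_zero_imp_zero[OF q] xy(1) by blast
  then obtain j where j: "flat q x $ j \<noteq> 0" by (auto simp: vec_eq_iff)
  let ?c = "y $ j / flat q x $ j"
  have y: "y = ?c *s flat q x"
    using minors[of j] j by (simp add: vec_eq_iff field_simps)
  then have "?c \<noteq> 0" using xy(3) by auto
  then have "line y = line (flat q x)" using line_scale y by metis
  then show ?thesis using xy by blast
qed

section \<open>Forms with a prescribed value at a vector\<close>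

text \<open>A choice of one of the indices \<open>(i, j)\<close> and \<open>(j, i)\<close>: the entries at these positions are
  coordinates on the space of symmetric matrices.\<close>

definition triangle :: "('n \<times> 'n) set \<Rightarrow> bool" where
  "triangle T \<longleftrightarrow> (\<forall>i j. ((i, j) \<in> T \<or> (j, i) \<in> T) \<and> ((i, j) \<in> T \<and> (j, i) \<in> T \<longrightarrow> i = j))"

definition minor_indices :: "'n \<Rightarrow> ('n \<times> 'n) set \<Rightarrow> ('n \<times> 'n) set" where
  "minor_indices i0 T = {\<tau> \<in> T. fst \<tau> \<noteq> i0 \<and> snd \<tau> \<noteq> i0}"

lemma triangle_exists: "\<exists>T :: ('n::finite \<times> 'n) set. triangle T"
proof -
  obtain f :: "'n \<Rightarrow> nat" where "inj f" using finite_imp_inj_to_nat_seg[of "UNIV :: 'n set"] by auto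
  then have "triangle {(i, j). f i \<le> f j}"
    unfolding triangle_def by (auto dest: injD)
  then show ?thesis by blast
qed

lemma card_triangle:
  fixes T :: "('n::finite \<times> 'n) set"
  assumes T: "triangle T"
  shows "card T = card (minor_indices i0 T) + CARD('n)"
proof -
  let ?h = "\<lambda>i. if (i, i0) \<in> T then (i, i0) else (i0, i)"
  have "T - minor_indices i0 T = range ?h"
  proof (intro set_eqI iffI)
    fix \<tau> assume \<tau>: "\<tau> \<in> T - minor_indices i0 T"
    obtain i j where ij: "\<tau> = (i, j)" by (cases \<tau>)
    have "i = i0 \<or> j = i0" using \<tau> ij by (auto simp: minor_indices_def)
    then show "\<tau> \<in> range ?h"
    proof
      assume "j = i0"
      then show ?thesis using \<tau> ij by (intro range_eqI[of _ _ i]) simp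
    next
      assume i: "i = i0"
      have "(j, i0) \<in> T \<Longrightarrow> j = i0" using T \<tau> ij i unfolding triangle_def by blast
      then show ?thesis using \<tau> ij i by (intro range_eqI[of _ _ j]) auto
    qed
  next
    fix \<tau> assume "\<tau> \<in> range ?h"
    then show "\<tau> \<in> T - minor_indices i0 T"
      using T unfolding triangle_def by (auto simp: minor_indices_def)
  qed
  moreover have "inj ?h" by (rule injI) (auto split: if_splits)
  ultimately have "card (T - minor_indices i0 T) = CARD('n)" by (simp only: card_image)
  moreover have "minor_indices i0 T \<subseteq> T" by (auto simp: minor_indices_def)
  ultimately show ?thesis
    by (metis add.commute card_Diff_subset card_mono finite le_add_diff_inverse)
qed

definition entry :: "('n \<times> 'n) set \<Rightarrow> ('n \<times> 'n \<Rightarrow> 'k) \<Rightarrow> 'n \<Rightarrow> 'n \<Rightarrow> 'k" where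
  "entry T p i j = p (if (i, j) \<in> T then (i, j) else (j, i))"

text \<open>A symmetric matrix \<open>q\<close> with \<open>qx = y\<close> is determined by its minor without row and column \<open>i0\<close> if
  \<open>x $ i0 = 1\<close>: solving \<open>qx = y\<close> yields the entries at \<open>(i0, j)\<close>, \<open>j \<noteq> i0\<close>, and then the corner. The
  solution is polynomial in \<open>x\<close>, \<open>y\<close> and the minor, and it is homogeneous of degree 1 in \<open>y\<close> and the
  minor together.\<close>

definition completion_row ::
    "'n \<Rightarrow> ('n \<times> 'n) set \<Rightarrow> 'k::field ^ 'n::finite \<Rightarrow> 'k ^ 'n \<Rightarrow> ('n \<times> 'n \<Rightarrow> 'k) \<Rightarrow> 'n \<Rightarrow> 'k" where
  "completion_row i0 T x y p j = y $ j - (\<Sum>i\<in>UNIV - {i0}. entry T p i j * x $ i)"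

definition completion ::
    "'n \<Rightarrow> ('n \<times> 'n) set \<Rightarrow> 'k::field ^ 'n::finite \<Rightarrow> 'k ^ 'n \<Rightarrow> ('n \<times> 'n \<Rightarrow> 'k) \<Rightarrow> 'n \<times> 'n \<Rightarrow> 'k" where
  "completion i0 T x y p = (\<lambda>(i, j).
     if i \<noteq> i0 \<and> j \<noteq> i0 then entry T p i j
     else if i \<noteq> i0 then completion_row i0 T x y p i
     else if j \<noteq> i0 then completion_row i0 T x y p j
     else y $ i0 - (\<Sum>j\<in>UNIV - {i0}. x $ j * completion_row i0 T x y p j))"

lemma completion_flat:
  fixes q :: "'k::field ^ ('n::finite \<times> 'n)" and x :: "'k ^ 'n"
  assumes "q \<in> sym_forms" and x: "x $ i0 = 1"
  shows "completion i0 T x (flat q x) (($) q) \<tau> = q $ \<tau>"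
proof -
  have s: "q $ (i, j) = q $ (j, i)" for i j using assms(1) by (simp add: sym_forms_iff)
  have e: "entry T (($) q) i j = q $ (i, j)" for i j unfolding entry_def using s[of i j] by simp
  have split: "flat q x $ j = q $ (i0, j) + (\<Sum>i\<in>UNIV - {i0}. q $ (i, j) * x $ i)" for j
  proof -
    have "flat q x $ j = (\<Sum>i\<in>UNIV. q $ (i, j) * x $ i)" by (simp add: flat_def)
    also have "\<dots> = q $ (i0, j) * x $ i0 + (\<Sum>i\<in>UNIV - {i0}. q $ (i, j) * x $ i)"
      by (rule sum.remove) simp_all
    finally show ?thesis using x by simp
  qed
  have row: "completion_row i0 T x (flat q x) (($) q) j = q $ (i0, j)" for j
    unfolding completion_row_def e split by simp
  have corner: "flat q x $ i0 - (\<Sum>j\<in>UNIV - {i0}. x $ j * q $ (i0, j)) = q $ (i0, i0)"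
  proof -
    have "(\<Sum>j\<in>UNIV - {i0}. x $ j * q $ (i0, j)) = (\<Sum>j\<in>UNIV - {i0}. q $ (j, i0) * x $ j)"
      by (rule sum.cong[OF refl]) (subst s, rule mult.commute)
    then show ?thesis unfolding split by simp
  qed
  obtain i j where "\<tau> = (i, j)" by (cases \<tau>)
  then show ?thesis
    unfolding completion_def by (simp add: e row corner s[of i i0])
qed

section \<open>The dimension count\<close>

text \<open>The points \<open>(x, s)\<close> parametrize bad symmetric forms; \<open>s\<close> comprises the coefficients of \<open>y\<close> and the
  entries of the minor. The coordinate \<open>x $ i0\<close> is replaced by 1, so that multiplication by it raises
  the degree in \<open>x\<close> of a function without changing it.\<close>

definition param_coord :: "'n \<Rightarrow> 'n + 'w \<Rightarrow> ('k::field ^ 'n::finite) \<times> ('w \<Rightarrow> 'k) \<Rightarrow> 'k" where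
  "param_coord i0 v = (\<lambda>(x, s). case v of Inl i \<Rightarrow> if i = i0 then 1 else x $ i | Inr w \<Rightarrow> s w)"

definition param_span ::
    "'n \<Rightarrow> 'w set \<Rightarrow> nat \<Rightarrow> nat \<Rightarrow> (('k::field ^ 'n::finite) \<times> ('w \<Rightarrow> 'k) \<Rightarrow> 'k) set" where
  "param_span i0 W d b = mono_span (UNIV <+> W) (param_coord i0) (bideg_exps UNIV W d b)"

lemma param_span_mult:
  assumes "f \<in> param_span i0 W d b" "g \<in> param_span i0 W d' b'"
  shows "(\<lambda>p. f p * g p) \<in> param_span i0 W (d + d') (b + b')"
proof -
  have "(\<lambda>p. f p * g p) = f * g" by (simp add: fun_eq_iff)
  then show ?thesis using bideg_span_mult assms unfolding param_span_def by (simp only:)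
qed

lemma param_span_diff:
  assumes "f \<in> param_span i0 W d b" "g \<in> param_span i0 W d b"
  shows "(\<lambda>p. f p - g p) \<in> param_span i0 W d b"
proof -
  have "(\<lambda>p. f p - g p) = f - g" by (simp add: fun_eq_iff)
  then show ?thesis using fs.span_diff assms unfolding param_span_def mono_span_def by (simp only:)
qed

lemma param_span_sum:
  assumes "finite I" "\<And>i. i \<in> I \<Longrightarrow> f i \<in> param_span i0 W d b"
  shows "(\<lambda>p. \<Sum>i\<in>I. u i * f i p) \<in> param_span i0 W d b"
  using assms unfolding param_span_def mono_span_def by (rule span_sum_scale)

lemma param_span_sum1:
  assumes "finite I" "\<And>i. i \<in> I \<Longrightarrow> f i \<in> param_span i0 W d b"
  shows "(\<lambda>p. \<Sum>i\<in>I. f i p) \<in> param_span i0 W d b"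
  using param_span_sum[of I f i0 W d b "\<lambda>_. 1"] assms by simp

lemma param_span_Inl:
  assumes "finite W"
  shows "param_coord i0 (Inl i) \<in> param_span i0 W 1 0"
  unfolding param_span_def by (rule bideg_span_Inl) (use assms in simp_all)

lemma param_span_Inr:
  assumes "finite W" "w \<in> W"
  shows "param_coord i0 (Inr w) \<in> param_span i0 W 0 1"
  unfolding param_span_def by (rule bideg_span_Inr) (use assms in simp_all)

lemma param_span_raise:
  assumes W: "finite W" and f: "f \<in> param_span i0 W d b" and "d \<le> d'"
  shows "f \<in> param_span i0 W d' b"
  using assms(3)
proof (induction d' rule: dec_induct)
  case (step d')
  have "(\<lambda>p. param_coord i0 (Inl i0) p * f p) \<in> param_span i0 W (1 + d') (0 + b)"
    by (rule param_span_mult[OF param_span_Inl[OF W] step(3)])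
  then show ?case by (simp add: param_coord_def case_prod_beta)
qed (rule f)

definition chart_point :: "'n \<Rightarrow> 'k::field ^ 'n::finite \<Rightarrow> 'k ^ 'n" where
  "chart_point i0 x = (\<chi> i. if i = i0 then 1 else x $ i)"

lemma chart_point_fixed:
  fixes x :: "'k::field ^ 'n"
  shows "x $ i0 = 1 \<Longrightarrow> chart_point i0 x = x"
  by (auto simp: chart_point_def vec_eq_iff)

lemma chart_point_coord: "chart_point i0 (fst p) $ i = param_coord i0 (Inl i) p"
  by (simp add: chart_point_def param_coord_def case_prod_beta)

lemma param_span_meval:
  fixes p :: "('n::finite, 'k::field) mpoly"
  assumes W: "finite W"
  shows "\<exists>d. \<forall>d'\<ge>d. (\<lambda>z. meval p (($) (chart_point i0 (fst z)))) \<in> param_span i0 W d' 0"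
proof -
  let ?s = "\<lambda>m. \<Sum>i\<in>UNIV. Poly_Mapping.lookup m i :: nat"
  let ?d = "\<Sum>m\<in>Poly_Mapping.keys p. ?s m"
  have "(\<lambda>z. meval p (($) (chart_point i0 (fst z)))) \<in> param_span i0 W d' 0" if d': "d' \<ge> ?d" for d'
    unfolding meval_def
  proof (rule param_span_sum)
    fix m assume m: "m \<in> Poly_Mapping.keys p"
    have pw: "(\<lambda>z. param_coord i0 (Inl i) z ^ Poly_Mapping.lookup m i)
        \<in> param_span i0 W (Poly_Mapping.lookup m i) 0" for i
      using bideg_span_power[OF param_span_Inl[OF W, of i0 i, unfolded param_span_def], of "Poly_Mapping.lookup m i"]
      unfolding param_span_def by simp
    have "(\<lambda>z. \<Prod>i\<in>UNIV. param_coord i0 (Inl i) z ^ Poly_Mapping.lookup m i)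
        \<in> param_span i0 W (?s m) (\<Sum>i\<in>(UNIV :: 'n set). 0)"
      unfolding param_span_def by (rule bideg_span_prod) (use pw in \<open>simp_all add: param_span_def\<close>)
    then have 1: "(\<lambda>z. \<Prod>i\<in>UNIV. param_coord i0 (Inl i) z ^ Poly_Mapping.lookup m i)
        \<in> param_span i0 W (?s m) 0" by simp
    have "?s m \<le> ?d" by (rule member_le_sum) (use m in auto)
    then have "?s m \<le> d'" using d' by simp
    then show "(\<lambda>z. \<Prod>i\<in>UNIV. chart_point i0 (fst z) $ i ^ Poly_Mapping.lookup m i) \<in> param_span i0 W d' 0"
      unfolding chart_point_coord by (rule param_span_raise[OF W 1])
  qed simp
  then show ?thesis by blast
qed

text \<open>On the part of the chart that belongs to \<open>X\<close>, the factor depending on \<open>x\<close> only matters through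
  the homogeneous coordinate ring of \<open>X\<close>; this is where its growth enters.\<close>

lemma param_span_restrict:
  fixes X :: "('k::field ^ 'n::finite) set set"
  assumes W: "finite W" and B: "\<forall>f\<in>forms d. \<exists>h\<in>fs.span B. \<forall>x\<in>affine_cone X. f x = h x"
    and f: "f \<in> param_span i0 W d b"
  shows "\<exists>h\<in>fs.span ((\<lambda>(\<beta>, \<mu>) (x, s). \<beta> x * \<mu> s) ` (B \<times> mono_fn W (\<lambda>w s. s w) ` deg_exps W b)).
    \<forall>x s. x \<in> affine_cone X \<and> x $ i0 = 1 \<longrightarrow> f (x, s) = h (x, s)"
  using f unfolding param_span_def mono_span_def
proof (induction rule: fs.span_induct_alt)
  case base
  then show ?case using fs.span_zero by (intro bexI[of _ 0]) simp_all
next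
  case (step a g k)
  let ?C = "(\<lambda>(\<beta>, \<mu>) (x, s). \<beta> x * \<mu> s) ` (B \<times> mono_fn W (\<lambda>w s. s w) ` deg_exps W b)"
  obtain m where m: "g = mono_fn (UNIV <+> W) (param_coord i0) m" "(\<Sum>i\<in>UNIV. m (Inl i)) = d" "(\<Sum>w\<in>W. m (Inr w)) = b"
    using step(1) by (auto simp: bideg_exps_def)
  let ?f = "mono_fn UNIV (\<lambda>i x. x $ i) (\<lambda>i. m (Inl i)) :: 'k ^ 'n \<Rightarrow> 'k"
  let ?\<mu> = "mono_fn W (\<lambda>w s. s w) (\<lambda>w. m (Inr w)) :: (_ \<Rightarrow> 'k) \<Rightarrow> 'k"
  have "?f \<in> forms d" unfolding forms_def by (rule mono_span_base) (simp add: deg_exps_def m(2))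
  then obtain \<beta> where \<beta>: "\<beta> \<in> fs.span B" "\<forall>x\<in>affine_cone X. ?f x = \<beta> x" using B by blast
  have \<mu>: "?\<mu> \<in> mono_fn W (\<lambda>w s. s w) ` deg_exps W b" by (rule imageI) (simp add: deg_exps_def m(3))
  have prod: "(\<lambda>(x, s). \<beta> x * ?\<mu> s) \<in> fs.span ?C"
    using \<beta>(1)
  proof (induction rule: fs.span_induct_alt)
    case base
    have "(\<lambda>(x, s). (0 :: 'k ^ 'n \<Rightarrow> 'k) x * ?\<mu> s) = 0" by (simp add: fun_eq_iff)
    then show ?case using fs.span_zero by (simp only:)
  next
    case (step c \<beta>1 \<beta>2)
    have eq: "(\<lambda>(x, s). (fscale c \<beta>1 + \<beta>2) x * ?\<mu> s)
      = fscale c (\<lambda>(x, s). \<beta>1 x * ?\<mu> s) + (\<lambda>(x, s). \<beta>2 x * ?\<mu> s)"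
      by (simp add: fun_eq_iff fscale_apply algebra_simps)
    have "(\<lambda>(x, s). \<beta>1 x * ?\<mu> s) \<in> ?C" using step(1) \<mu> by (intro image_eqI[of _ _ "(\<beta>1, ?\<mu>)"]) auto
    then show ?case unfolding eq by (intro fs.span_add fs.span_scale step(2) fs.span_base)
  qed
  have g: "g (x, s) = \<beta> x * ?\<mu> s" if "x \<in> affine_cone X" "x $ i0 = 1" for x s
  proof -
    have "g (x, s) = (\<Prod>i\<in>UNIV. param_coord i0 (Inl i) (x, s) ^ m (Inl i)) *
        (\<Prod>w\<in>W. param_coord i0 (Inr w) (x, s) ^ m (Inr w))"
      unfolding m(1) mono_fn_def
      using prod.Plus[OF finite[of UNIV] W, of "\<lambda>v. param_coord i0 v (x, s) ^ m v"] by (simp add: comp_def)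
    also have "(\<Prod>i\<in>UNIV. param_coord i0 (Inl i) (x, s) ^ m (Inl i)) = ?f x"
      unfolding mono_fn_def by (rule prod.cong) (use that(2) in \<open>auto simp: param_coord_def\<close>)
    also have "(\<Prod>w\<in>W. param_coord i0 (Inr w) (x, s) ^ m (Inr w)) = ?\<mu> s"
      by (simp add: mono_fn_def param_coord_def)
    finally show ?thesis using \<beta>(2) that(1) by simp
  qed
  obtain h where h: "h \<in> fs.span ?C" "\<forall>x s. x \<in> affine_cone X \<and> x $ i0 = 1 \<longrightarrow> k (x, s) = h (x, s)"
    using step(2) by blast
  show ?case
  proof (intro bexI allI impI)
    show "fscale a (\<lambda>(x, s). \<beta> x * ?\<mu> s) + h \<in> fs.span ?C"
      by (intro fs.span_add fs.span_scale prod h(1))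
    fix x s assume "x \<in> affine_cone X \<and> x $ i0 = 1"
    then show "(fscale a g + k) (x, s) = (fscale a (\<lambda>(x, s). \<beta> x * ?\<mu> s) + h) (x, s)"
      using g h(2) by (simp add: fscale_apply)
  qed
qed

text \<open>All exponents but one are chosen freely below \<open>a\<close>, and the last one adjusts the degree.\<close>

lemma many_exponents:
  fixes T :: "'v set"
  assumes "finite T" "\<tau>0 \<in> T"
  shows "\<exists>E. finite E \<and> card E = a ^ (card T - 1) \<and>
    (\<forall>e\<in>E. sum e T = (card T - 1) * a \<and> (\<forall>\<tau>. \<tau> \<notin> T \<longrightarrow> e \<tau> = 0))"
proof -
  let ?R = "T - {\<tau>0}" and ?b = "(card T - 1) * a"
  let ?G = "\<lambda>g \<tau>. if \<tau> \<in> ?R then g \<tau> else if \<tau> = \<tau>0 then ?b - sum g ?R else (0::nat)"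
  let ?P = "PiE ?R (\<lambda>_. {..<a})"
  have cR: "card ?R = card T - 1" using assms by simp
  have inj: "inj_on ?G ?P"
  proof (rule inj_onI, rule ext)
    fix g h \<tau> assume gh: "g \<in> ?P" "h \<in> ?P" "?G g = ?G h"
    show "g \<tau> = h \<tau>"
    proof (cases "\<tau> \<in> ?R")
      case True
      then show ?thesis using fun_cong[OF gh(3), of \<tau>] by simp
    next
      case False
      then show ?thesis using gh(1,2) by (metis PiE_arb)
    qed
  qed
  have "card (?G ` ?P) = a ^ (card T - 1)"
    using card_image[OF inj] assms cR by (simp add: card_PiE)
  moreover have "finite (?G ` ?P)" using assms by (intro finite_imageI finite_PiE) auto
  moreover have "\<forall>e\<in>?G ` ?P. sum e T = ?b \<and> (\<forall>\<tau>. \<tau> \<notin> T \<longrightarrow> e \<tau> = 0)"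
  proof
    fix e assume "e \<in> ?G ` ?P"
    then obtain g where g: "g \<in> ?P" "e = ?G g" by blast
    have "sum g ?R \<le> (\<Sum>\<tau>\<in>?R. a)" by (rule sum_mono) (use g(1) in \<open>auto simp: PiE_iff less_imp_le\<close>)
    then have "sum g ?R \<le> ?b" using cR by simp
    moreover have "sum e T = e \<tau>0 + sum e ?R" using assms by (simp add: sum.remove)
    moreover have "sum e ?R = sum g ?R" unfolding g(2) by (rule sum.cong) auto
    ultimately show "sum e T = ?b \<and> (\<forall>\<tau>. \<tau> \<notin> T \<longrightarrow> e \<tau> = 0)"
      using assms(2) by (auto simp: g(2))
  qed
  ultimately show ?thesis by (intro exI[of _ "?G ` ?P"] conjI)
qed

text \<open>Only the values on \<open>S\<close> matter, which allows to replace each \<open>H e\<close> by a representative in the span.\<close>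

lemma linear_relation_on_subset:
  assumes "finite E" "finite B" "card B < card E"
    and "\<And>e. e \<in> E \<Longrightarrow> \<exists>h\<in>fs.span B. \<forall>p\<in>S. H e p = h p"
  shows "\<exists>u. (\<exists>e\<in>E. u e \<noteq> 0) \<and> (\<forall>p\<in>S. (\<Sum>e\<in>E. u e * H e p) = 0)"
proof -
  have "\<forall>e\<in>E. \<exists>h. h \<in> fs.span B \<and> (\<forall>p\<in>S. H e p = h p)" using assms(4) by blast
  then obtain h where h: "\<forall>e\<in>E. h e \<in> fs.span B \<and> (\<forall>p\<in>S. H e p = h e p)" by (rule bchoice[THEN exE])
  then have hB: "\<And>e. e \<in> E \<Longrightarrow> h e \<in> fs.span B" by blast
  have "\<exists>u. (\<exists>e\<in>E. u e \<noteq> 0) \<and> (\<forall>p. (\<Sum>e\<in>E. u e * h e p) = 0)"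
    by (rule linear_relation_if_card_less[OF assms(1-3)]) (rule hB)
  then obtain u where u: "\<exists>e\<in>E. u e \<noteq> 0" "\<forall>p. (\<Sum>e\<in>E. u e * h e p) = 0"
    by (elim exE conjE) (rule that)
  have "(\<Sum>e\<in>E. u e * H e p) = 0" if "p \<in> S" for p
  proof -
    have "(\<Sum>e\<in>E. u e * H e p) = (\<Sum>e\<in>E. u e * h e p)" by (rule sum.cong) (use h that in auto)
    then show ?thesis using u(2) by simp
  qed
  then have "\<forall>p\<in>S. (\<Sum>e\<in>E. u e * H e p) = 0" by blast
  with u(1) show ?thesis by (intro exI[of _ u] conjI)
qed

text \<open>The dimension count. With \<open>N = card T\<close> the number of coordinates on symmetric matrices, there are
  at least \<open>a ^ (N - 1)\<close> monomials of degree \<open>b = (N - 1) * a\<close> in these coordinates. Pulled back to the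
  parameters \<open>(x, s)\<close>, they are homogeneous of degree \<open>b\<close> in the parameters \<open>s\<close>, whose number
  is \<open>card W = c + N - CARD('n)\<close>, and of degree \<open>O(b)\<close> in \<open>x\<close>. On \<open>X\<close> such functions are spanned by
  \<open>O(b ^ r * b ^ (card W - 1))\<close> of them, and \<open>r + card W - 1 = N - 2\<close>. So for large \<open>a\<close> there are more monomials
  than dimensions.\<close>

lemma relation_among_completions:
  fixes X :: "('k::field ^ 'n::finite) set set" and v :: "nat \<Rightarrow> 'n \<Rightarrow> ('n, 'k) mpoly"
  assumes X: "hilbert_growth X r" and T: "triangle T" and c: "c \<ge> 1" "c + r + 1 = CARD('n)"
  shows "\<exists>b E u. finite E \<and> (\<forall>e\<in>E. sum e T = b \<and> (\<forall>\<tau>. \<tau> \<notin> T \<longrightarrow> e \<tau> = 0)) \<and> (\<exists>e\<in>E. u e \<noteq> 0) \<and>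
    (\<forall>x t p. x \<in> affine_cone X \<and> x $ i0 = 1 \<longrightarrow>
      (\<Sum>e\<in>E. u e * (\<Prod>\<tau>\<in>T. completion i0 T x (\<chi> k. \<Sum>j<c. t j * meval (v j k) (($) x)) p \<tau> ^ e \<tau>)) = 0)"
proof -
  let ?T' = "minor_indices i0 T"
  define W where "W = {..<c} <+> ?T'"
  have finW: "finite W" unfolding W_def by simp
  have cW: "card W = c + card ?T'" unfolding W_def by (subst card_Plus) simp_all
  have finT: "finite T" by simp
  have T0: "(i0, i0) \<in> T" using T unfolding triangle_def by blast
  let ?S = "param_span i0 W :: nat \<Rightarrow> nat \<Rightarrow> (('k ^ 'n) \<times> (nat + 'n \<times> 'n \<Rightarrow> 'k) \<Rightarrow> 'k) set"
  let ?x = "\<lambda>z :: ('k ^ 'n) \<times> (nat + 'n \<times> 'n \<Rightarrow> 'k). chart_point i0 (fst z)"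
  let ?y = "\<lambda>z. \<chi> k. \<Sum>j<c. snd z (Inl j) * meval (v j k) (($) (?x z))"
  let ?p = "\<lambda>z :: ('k ^ 'n) \<times> (nat + 'n \<times> 'n \<Rightarrow> 'k). \<lambda>\<tau>. snd z (Inr \<tau>)"
  let ?Q = "\<lambda>\<tau> z. completion i0 T (?x z) (?y z) (?p z) \<tau>"
  note raise = param_span_raise[OF finW]
  have "\<forall>j k. \<exists>d. \<forall>d'\<ge>d. (\<lambda>z. meval (v j k) (($) (?x z))) \<in> ?S d' 0"
    using param_span_meval[OF finW] by blast
  then obtain dv where dv: "\<And>j k d'. d' \<ge> dv j k \<Longrightarrow> (\<lambda>z. meval (v j k) (($) (?x z))) \<in> ?S d' 0"
    by metis
  define D1 where "D1 = (\<Sum>j<c. \<Sum>k\<in>UNIV. dv j k)"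
  have D1: "dv j k \<le> D1" if "j < c" for j k
  proof -
    have "dv j k \<le> (\<Sum>k\<in>UNIV. dv j k)" by (rule member_le_sum) auto
    also have "\<dots> \<le> D1" unfolding D1_def by (rule member_le_sum) (use that in auto)
    finally show ?thesis .
  qed
  have y: "(\<lambda>z. ?y z $ k) \<in> ?S D1 1" for k
  proof -
    have "(\<lambda>z. param_coord i0 (Inr (Inl j)) z * meval (v j k) (($) (?x z))) \<in> ?S (0 + D1) (1 + 0)"
      if "j \<in> {..<c}" for j
    proof (rule param_span_mult)
      show "param_coord i0 (Inr (Inl j)) \<in> ?S 0 1"
        by (rule param_span_Inr[OF finW]) (use that in \<open>simp add: W_def InlI\<close>)
      show "(\<lambda>z. meval (v j k) (($) (?x z))) \<in> ?S D1 0" by (rule dv) (use D1 that in simp)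
    qed
    then have "(\<lambda>z. \<Sum>j<c. param_coord i0 (Inr (Inl j)) z * meval (v j k) (($) (?x z))) \<in> ?S D1 1"
      by (intro param_span_sum1) simp_all
    then show ?thesis by (simp add: param_coord_def case_prod_beta)
  qed
  have entry: "(\<lambda>z. entry T (?p z) i j) \<in> ?S 0 1" if ij: "i \<noteq> i0" "j \<noteq> i0" for i j
  proof -
    let ?\<tau> = "if (i, j) \<in> T then (i, j) else (j, i)"
    have "?\<tau> \<in> ?T'" using T ij unfolding triangle_def minor_indices_def by auto
    then have "param_coord i0 (Inr (Inr ?\<tau>)) \<in> ?S 0 1"
      by (intro param_span_Inr[OF finW]) (simp only: W_def InrI)
    moreover have "(\<lambda>z. entry T (?p z) i j) = param_coord i0 (Inr (Inr ?\<tau>))"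
      by (simp add: fun_eq_iff param_coord_def entry_def)
    ultimately show ?thesis by (simp only:)
  qed
  have row: "(\<lambda>z. completion_row i0 T (?x z) (?y z) (?p z) j) \<in> ?S (D1 + 1) 1" if j: "j \<noteq> i0" for j
  proof -
    have "(\<lambda>z. entry T (?p z) i j * ?x z $ i) \<in> ?S (0 + 1) (1 + 0)" if "i \<in> UNIV - {i0}" for i
      unfolding chart_point_coord
      by (rule param_span_mult[OF entry param_span_Inl[OF finW]]) (use that j in auto)
    then have "(\<lambda>z. \<Sum>i\<in>UNIV - {i0}. entry T (?p z) i j * ?x z $ i) \<in> ?S 1 1"
      by (intro param_span_sum1) simp_all
    then have "(\<lambda>z. \<Sum>i\<in>UNIV - {i0}. entry T (?p z) i j * ?x z $ i) \<in> ?S (D1 + 1) 1"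
      by (rule raise) simp
    moreover have "(\<lambda>z. ?y z $ j) \<in> ?S (D1 + 1) 1" by (rule raise[OF y]) simp
    ultimately show ?thesis unfolding completion_row_def by (intro param_span_diff)
  qed
  let ?D = "D1 + 2"
  have Q: "?Q \<tau> \<in> ?S ?D 1" for \<tau>
  proof -
    obtain i j where ij: "\<tau> = (i, j)" by (cases \<tau>)
    consider "i \<noteq> i0" "j \<noteq> i0" | "i \<noteq> i0" "j = i0" | "i = i0" "j \<noteq> i0" | "i = i0" "j = i0" by blast
    then show ?thesis
    proof cases
      case 1
      have "(\<lambda>z. entry T (?p z) i j) \<in> ?S ?D 1" by (rule raise[OF entry]) (use 1 in auto)
      then show ?thesis using 1 by (simp add: ij completion_def)
    next
      case 2
      have "(\<lambda>z. completion_row i0 T (?x z) (?y z) (?p z) i) \<in> ?S ?D 1" by (rule raise[OF row]) (use 2 in auto)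
      then show ?thesis using 2 by (simp add: ij completion_def)
    next
      case 3
      have "(\<lambda>z. completion_row i0 T (?x z) (?y z) (?p z) j) \<in> ?S ?D 1" by (rule raise[OF row]) (use 3 in auto)
      then show ?thesis using 3 by (simp add: ij completion_def)
    next
      case 4
      have "(\<lambda>z. ?x z $ k * completion_row i0 T (?x z) (?y z) (?p z) k) \<in> ?S (1 + (D1 + 1)) (0 + 1)"
        if "k \<in> UNIV - {i0}" for k
        using param_span_mult[OF param_span_Inl[OF finW, of i0 k] row[of k]] that
        by (simp only: chart_point_coord Diff_iff singleton_iff simp_thms)
      then have "(\<lambda>z. \<Sum>k\<in>UNIV - {i0}. ?x z $ k * completion_row i0 T (?x z) (?y z) (?p z) k) \<in> ?S ?D 1"
        by (intro param_span_sum1) simp_all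
      moreover have "(\<lambda>z. ?y z $ i0) \<in> ?S ?D 1" by (rule raise[OF y]) simp
      ultimately have "(\<lambda>z. ?y z $ i0 - (\<Sum>k\<in>UNIV - {i0}. ?x z $ k * completion_row i0 T (?x z) (?y z) (?p z) k)) \<in> ?S ?D 1"
        by (rule param_span_diff[rotated])
      then show ?thesis using 4 by (simp add: ij completion_def)
    qed
  qed
  obtain C where C: "\<And>d. \<exists>B. finite B \<and> card B \<le> C * (d + 1) ^ r \<and>
     (\<forall>f\<in>forms d. \<exists>h\<in>fs.span B. \<forall>x\<in>affine_cone X. f x = h x)"
    using X unfolding hilbert_growth_def by blast
  define R where "R = card T - 1"
  define w where "w = card W - 1"
  have w: "card W = w + 1" unfolding w_def using cW c(1) by simp
  have R: "R = r + w + 1"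
    unfolding R_def using card_triangle[OF T, of i0] c cW w by simp
  \<comment> \<open>\<open>R\<close> is \<open>N - 1\<close>. For \<open>a \<ge> 1\<close> one has \<open>b + 1 \<le> M * a\<close>, so the dimension is at most \<open>K * a ^ (R - 1)\<close>, and
    \<open>a = K + 1\<close> makes the number \<open>a ^ R\<close> of monomials larger.\<close>
  define M where "M = R + 1"
  define K where "K = C * ((?D + 1) * M) ^ r * M ^ w"
  define a where "a = K + 1"
  define b where "b = R * a"
  obtain E where E: "finite E" "card E = a ^ R" "\<forall>e\<in>E. sum e T = b \<and> (\<forall>\<tau>. \<tau> \<notin> T \<longrightarrow> e \<tau> = 0)"
    using many_exponents[OF finT T0, of a] unfolding R_def b_def by blast
  obtain B where B: "finite B" "card B \<le> C * (?D * b + 1) ^ r"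
    "\<forall>f\<in>forms (?D * b). \<exists>h\<in>fs.span B. \<forall>x\<in>affine_cone X. f x = h x" using C by blast
  let ?mW = "mono_fn W (\<lambda>w (s :: nat + 'n \<times> 'n \<Rightarrow> 'k). s w) ` deg_exps W b"
  let ?B = "(\<lambda>(\<beta>, \<mu>) (x, s). \<beta> x * \<mu> s) ` (B \<times> ?mW)"
  have W0: "W \<noteq> {}" using w by auto
  have mW: "finite ?mW" "card ?mW \<le> (b + 1) ^ w"
    using deg_mono_fns_bound[OF finW W0, of "\<lambda>w (s :: nat + 'n \<times> 'n \<Rightarrow> 'k). s w" b] unfolding w_def by auto
  have finB: "finite ?B" using B(1) mW(1) by blast
  have "card ?B \<le> card (B \<times> ?mW)" by (rule card_image_le) (use B(1) mW(1) in blast)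
  also have "\<dots> = card B * card ?mW" by (rule card_cartesian_product)
  also have "\<dots> \<le> (C * (?D * b + 1) ^ r) * (b + 1) ^ w" by (rule mult_le_mono[OF B(2) mW(2)])
  also have "\<dots> \<le> (C * ((?D + 1) * M * a) ^ r) * (M * a) ^ w"
  proof -
    have b1: "b + 1 \<le> M * a" unfolding b_def M_def a_def by simp
    have "?D * b + 1 \<le> ?D * (b + 1) + (b + 1)" by simp
    also have "\<dots> = (?D + 1) * (b + 1)" by simp
    also have "\<dots> \<le> (?D + 1) * (M * a)" by (rule mult_le_mono2[OF b1])
    finally have b2: "?D * b + 1 \<le> (?D + 1) * M * a" by (simp only: mult.assoc)
    show ?thesis by (intro mult_le_mono power_mono b1 b2 order_refl) simp_all
  qed
  also have "\<dots> = K * a ^ (r + w)"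
    unfolding K_def by (simp only: power_mult_distrib power_add mult_ac)
  also have "\<dots> < a * a ^ (r + w)" unfolding a_def by simp
  also have "\<dots> = card E" unfolding E(2) R by simp
  finally have less: "card ?B < card E" .
  let ?H = "\<lambda>e z. \<Prod>\<tau>\<in>T. ?Q \<tau> z ^ e \<tau>"
  let ?dom = "{(x, s). x \<in> affine_cone X \<and> x $ i0 = 1}"
  have rel: "\<exists>h\<in>fs.span ?B. \<forall>z\<in>?dom. ?H e z = h z" if e: "e \<in> E" for e
  proof -
    have pw: "(\<lambda>z. ?Q \<tau> z ^ e \<tau>) \<in> ?S (e \<tau> * ?D) (e \<tau>)" for \<tau>
      using bideg_span_power[OF Q[of \<tau>, unfolded param_span_def], of "e \<tau>"] unfolding param_span_def by simp
    have "?H e \<in> ?S (\<Sum>\<tau>\<in>T. e \<tau> * ?D) (\<Sum>\<tau>\<in>T. e \<tau>)"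
      unfolding param_span_def by (rule bideg_span_prod[OF finT pw[unfolded param_span_def]])
    moreover have sb: "(\<Sum>\<tau>\<in>T. e \<tau>) = b" using E(3) e by blast
    moreover have "(\<Sum>\<tau>\<in>T. e \<tau> * ?D) = ?D * b"
      unfolding sum_distrib_right[symmetric] sb by (rule mult.commute)
    ultimately have "?H e \<in> ?S (?D * b) b" by (simp only:)
    from param_span_restrict[OF finW B(3) this] obtain h
      where "h \<in> fs.span ?B" "\<forall>x s. x \<in> affine_cone X \<and> x $ i0 = 1 \<longrightarrow> ?H e (x, s) = h (x, s)"
      by (elim bexE) (rule that)
    then show ?thesis by (intro bexI[of _ h]) auto
  qed
  have "\<exists>u. (\<exists>e\<in>E. u e \<noteq> 0) \<and> (\<forall>z\<in>?dom. (\<Sum>e\<in>E. u e * ?H e z) = 0)"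
    by (rule linear_relation_on_subset[OF E(1) finB less]) (rule rel)
  then obtain u
    where u: "\<exists>e\<in>E. u e \<noteq> 0" "\<forall>z\<in>?dom. (\<Sum>e\<in>E. u e * ?H e z) = 0" by (elim exE conjE) (rule that)
  have "(\<Sum>e\<in>E. u e * (\<Prod>\<tau>\<in>T. completion i0 T x (\<chi> k. \<Sum>j<c. t j * meval (v j k) (($) x)) p \<tau> ^ e \<tau>)) = 0"
    if x: "x \<in> affine_cone X" "x $ i0 = 1" for x t p
  proof -
    have "(x, case_sum t p) \<in> ?dom" using x by simp
    from bspec[OF u(2) this] show ?thesis by (simp add: chart_point_fixed[OF x(2)])
  qed
  then show ?thesis using E(1,3) u(1) by (intro exI[of _ b] exI[of _ E] exI[of _ u]) blast
qed

lemma mgrad_vector: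
  "(\<chi> k. \<Sum>j<c. t j * meval (mpderiv k (J j)) (($) x)) = (\<Sum>j<c. t j *s mgrad (J j) x)"
  by (simp add: vec_eq_iff mgrad_def sum_component)

lemma pol_const:
  fixes a :: "'k::field"
  shows "(\<lambda>_ :: ('k ^ 'n) \<times> ('k ^ 'm). a) \<in> mono_span UNIV pair_coord UNIV"
proof -
  let ?one = "mono_fn UNIV pair_coord (\<lambda>_. 0) :: ('k ^ 'n) \<times> ('k ^ 'm) \<Rightarrow> 'k"
  have "fscale a ?one \<in> mono_span UNIV pair_coord UNIV"
    by (intro mono_span_scale mono_span_base) simp
  moreover have "fscale a ?one = (\<lambda>_. a)"
    by (simp add: fun_eq_iff fscale_apply mono_fn_const)
  ultimately show ?thesis by (simp only:)
qed

lemma pol_var: "pair_coord v \<in> mono_span UNIV pair_coord UNIV"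
proof -
  have "mono_fn UNIV pair_coord (\<lambda>w. if w = v then 1 else 0) \<in> mono_span UNIV pair_coord UNIV"
    by (rule mono_span_base) simp
  then show ?thesis by (simp only: mono_fn_var[OF finite UNIV_I])
qed

lemma pol_mult:
  assumes "f \<in> mono_span UNIV pair_coord UNIV" "g \<in> mono_span UNIV pair_coord UNIV"
  shows "(\<lambda>z. f z * g z) \<in> mono_span UNIV pair_coord UNIV"
proof -
  have "(\<lambda>z. f z * g z) = f * g" by (simp add: fun_eq_iff)
  moreover have "f * g \<in> mono_span UNIV pair_coord UNIV" by (rule mono_span_mult[OF UNIV_I assms])
  ultimately show ?thesis by (simp only:)
qed

lemma pol_diff:
  assumes "f \<in> mono_span UNIV pair_coord UNIV" "g \<in> mono_span UNIV pair_coord UNIV"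
  shows "(\<lambda>z. f z - g z) \<in> mono_span UNIV pair_coord UNIV"
proof -
  have "(\<lambda>z. f z - g z) = f - g" by (simp add: fun_eq_iff)
  then show ?thesis using fs.span_diff assms unfolding mono_span_def by (simp only:)
qed

lemma pol_sum:
  assumes "finite I" "\<And>i. i \<in> I \<Longrightarrow> f i \<in> mono_span UNIV pair_coord UNIV"
  shows "(\<lambda>z. \<Sum>i\<in>I. u i * f i z) \<in> mono_span UNIV pair_coord UNIV"
  using assms unfolding mono_span_def by (rule span_sum_scale)

lemma pol_power:
  assumes "f \<in> mono_span UNIV pair_coord UNIV"
  shows "(\<lambda>z. f z ^ k) \<in> mono_span UNIV pair_coord UNIV"
proof (induction k)
  case 0
  show ?case using pol_const[of 1] by (simp only: power_0)
next
  case (Suc k)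
  show ?case using pol_mult[OF assms Suc] by (simp only: power_Suc)
qed

lemma pol_prod:
  assumes "finite I" "\<And>i. i \<in> I \<Longrightarrow> f i \<in> mono_span UNIV pair_coord UNIV"
  shows "(\<lambda>z. \<Prod>i\<in>I. f i z) \<in> mono_span UNIV pair_coord UNIV"
  using assms
proof (induction I rule: finite_induct)
  case empty
  show ?case using pol_const[of 1] by (simp only: prod.empty)
next
  case (insert i I)
  have "(\<lambda>z. f i z * (\<Prod>i\<in>I. f i z)) \<in> mono_span UNIV pair_coord UNIV"
    by (rule pol_mult) (use insert in auto)
  then show ?case by (simp only: prod.insert[OF insert(1,2)])
qed

lemma completion_polynomial:
  fixes p :: "'n::finite \<times> 'n \<Rightarrow> 'k::field"
  shows "(\<lambda>(x, y). completion i0 T x y p \<tau>) \<in> mono_span UNIV pair_coord UNIV"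
proof -
  let ?P = "mono_span UNIV pair_coord UNIV :: (('k ^ 'n) \<times> ('k ^ 'n) \<Rightarrow> 'k) set"
  have x: "(\<lambda>z. fst z $ i) \<in> ?P" for i :: 'n
  proof -
    have "(\<lambda>z :: ('k ^ 'n) \<times> ('k ^ 'n). fst z $ i) = pair_coord (Inl i)" by (simp add: fun_eq_iff pair_coord_def)
    then show ?thesis using pol_var by (simp only:)
  qed
  have y: "(\<lambda>z. snd z $ i) \<in> ?P" for i :: 'n
  proof -
    have "(\<lambda>z :: ('k ^ 'n) \<times> ('k ^ 'n). snd z $ i) = pair_coord (Inr i)" by (simp add: fun_eq_iff pair_coord_def)
    then show ?thesis using pol_var by (simp only:)
  qed
  have row: "(\<lambda>z. completion_row i0 T (fst z) (snd z) p j) \<in> ?P" for j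
    unfolding completion_row_def by (intro pol_diff pol_sum x y) simp
  have corner: "(\<lambda>z. snd z $ i0 - (\<Sum>j\<in>UNIV - {i0}. 1 * (fst z $ j * completion_row i0 T (fst z) (snd z) p j))) \<in> ?P"
    by (intro pol_diff pol_sum pol_mult x y row) simp
  obtain i j where ij: "\<tau> = (i, j)" by (cases \<tau>)
  have "(\<lambda>z. completion i0 T (fst z) (snd z) p (i, j)) \<in> ?P"
    using pol_const[of "entry T p i j"] row[of i] row[of j] corner
    by (cases "i = i0"; cases "j = i0") (simp_all add: completion_def)
  moreover have "(\<lambda>(x, y). completion i0 T x y p \<tau>) = (\<lambda>z. completion i0 T (fst z) (snd z) p (i, j))"
    by (simp add: fun_eq_iff ij)
  ultimately show ?thesis by (simp only:)
qed

lemma symmetric_with_triangle: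
  fixes z :: "'n::finite \<times> 'n \<Rightarrow> 'k::field"
  assumes T: "triangle T"
  shows "\<exists>q\<in>sym_forms. \<forall>\<tau>\<in>T. q $ \<tau> = z \<tau>"
proof -
  let ?q = "(\<chi> \<tau>. if \<tau> \<in> T then z \<tau> else z (snd \<tau>, fst \<tau>)) :: 'k ^ ('n \<times> 'n)"
  have "?q $ (i, j) = ?q $ (j, i)" for i j
    using T unfolding triangle_def by (cases "i = j") auto
  then have "?q \<in> sym_forms" by (simp add: sym_forms_iff)
  moreover have "\<forall>\<tau>\<in>T. ?q $ \<tau> = z \<tau>" by simp
  ultimately show ?thesis by blast
qed

lemma form_det_zero: "form_det (0 :: 'k::field ^ ('n::finite \<times> 'n)) = 0"
proof (rule ccontr)
  assume "form_det (0 :: 'k ^ ('n \<times> 'n)) \<noteq> 0"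
  moreover have "flat (0 :: 'k ^ ('n \<times> 'n)) (axis undefined 1) = 0" by (simp add: flat_def vec_eq_iff)
  ultimately have "axis (undefined :: 'n) (1 :: 'k) = 0" by (rule flat_zero_imp_zero)
  then show False by simp
qed

text \<open>The set \<open>N\<close> is swept out by \<open>c\<close> vector fields over the cone of \<open>X\<close>, so that it has dimension at
  most \<open>r + c\<close> up to scaling of \<open>x\<close>. A relation between the pulled back monomials is a form
  \<open>F\<close> that vanishes at all completions, for points of \<open>N\<close> in the chart; for a fixed minor this is a
  polynomial identity in \<open>(x, y)\<close>, which passes to the closure of \<open>N\<close>. A form \<open>q\<close> is the completion of
  its own minor at \<open>(x, qx)\<close>, so \<open>F q = 0\<close>. The coordinate \<open>i0\<close> has to be fixed, because the completion
  divides by it.\<close>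

lemma bad_forms_in_hypersurface:
  fixes X :: "('k::alg_closed_field ^ 'n) set set" and N :: "(('k ^ 'n) \<times> ('k ^ 'n)) set"
  assumes X: "hilbert_growth X r" and c: "c \<ge> 1" "c + r + 1 = CARD('n)"
    and scale: "\<And>x y a b. (x, y) \<in> N \<Longrightarrow> a \<noteq> 0 \<Longrightarrow> b \<noteq> 0 \<Longrightarrow> (a *s x, b *s y) \<in> N"
    and N: "\<And>x y. (x, y) \<in> N \<Longrightarrow> x \<in> affine_cone X \<and> (\<exists>t. y = (\<Sum>j<c. t j *s mgrad (J j) x))"
  shows "\<exists>d F. F \<in> forms d \<and> (\<exists>q\<in>sym_forms. F q \<noteq> 0) \<and>
    (\<forall>q\<in>sym_forms. \<forall>x. x $ i0 = 1 \<and> (line x, line (flat q x)) \<in> bizariski closure_of (lines ` N) \<longrightarrow> F q = 0)"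
proof -
  obtain T :: "('n \<times> 'n) set" where T: "triangle T" using triangle_exists by blast
  obtain b E u where E: "finite E" "\<forall>e\<in>E. sum e T = b \<and> (\<forall>\<tau>. \<tau> \<notin> T \<longrightarrow> e \<tau> = 0)" "\<exists>e\<in>E. u e \<noteq> 0"
    and rel: "\<forall>x t p. x \<in> affine_cone X \<and> x $ i0 = 1 \<longrightarrow>
      (\<Sum>e\<in>E. u e * (\<Prod>\<tau>\<in>T. completion i0 T x (\<chi> k. \<Sum>j<c. t j * meval (mpderiv k (J j)) (($) x)) p \<tau> ^ e \<tau>)) = 0"
    using relation_among_completions[OF X T c, of i0 "\<lambda>j k. mpderiv k (J j)"] by (elim exE conjE) (rule that)
  define F where "F = (\<lambda>q :: 'k ^ ('n \<times> 'n). \<Sum>e\<in>E. u e * (\<Prod>\<tau>\<in>T. q $ \<tau> ^ e \<tau>))"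
  have "(\<lambda>q :: 'k ^ ('n \<times> 'n). \<Sum>e\<in>E. u e * mono_fn UNIV (\<lambda>\<tau> q. q $ \<tau>) e q) \<in> forms b"
    unfolding forms_def mono_span_def
  proof (rule span_sum_scale[OF E(1)])
    fix e assume e: "e \<in> E"
    have "sum e UNIV = sum e T" by (rule sum.mono_neutral_right) (use E(2) e in auto)
    then have "e \<in> deg_exps UNIV b" using E(2) e by (simp add: deg_exps_def)
    then show "mono_fn UNIV (\<lambda>\<tau> q :: 'k ^ ('n \<times> 'n). q $ \<tau>) e
        \<in> fs.span (mono_fn UNIV (\<lambda>\<tau> q. q $ \<tau>) ` deg_exps UNIV b)"
      by (intro fs.span_base imageI)
  qed
  moreover have "(\<lambda>q :: 'k ^ ('n \<times> 'n). \<Sum>e\<in>E. u e * mono_fn UNIV (\<lambda>\<tau> q. q $ \<tau>) e q) = F"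
    unfolding F_def mono_fn_def
  proof (rule ext, rule sum.cong[OF refl], rule arg_cong2[of _ _ _ _ "(*)", OF refl])
    fix q :: "'k ^ ('n \<times> 'n)" and e assume e: "e \<in> E"
    show "(\<Prod>\<tau>\<in>UNIV. q $ \<tau> ^ e \<tau>) = (\<Prod>\<tau>\<in>T. q $ \<tau> ^ e \<tau>)"
      by (rule prod.mono_neutral_right) (use E(2) e in auto)
  qed
  ultimately have F: "F \<in> forms b" by (simp only:)
  have "\<exists>q\<in>sym_forms. F q \<noteq> 0"
  proof (rule ccontr)
    assume "\<not> ?thesis"
    then have zero: "F q = 0" if "q \<in> sym_forms" for q using that by blast
    have "(\<Sum>e\<in>E. u e * (\<Prod>\<tau>\<in>T. z \<tau> ^ e \<tau>)) = 0" for z :: "'n \<times> 'n \<Rightarrow> 'k"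
    proof -
      obtain q where q: "q \<in> sym_forms" "\<forall>\<tau>\<in>T. q $ \<tau> = z \<tau>" using symmetric_with_triangle[OF T] by blast
      have "(\<Sum>e\<in>E. u e * (\<Prod>\<tau>\<in>T. z \<tau> ^ e \<tau>)) = F q"
        unfolding F_def using q(2) by (simp cong: prod.cong)
      then show ?thesis using zero[OF q(1)] by simp
    qed
    then have "u e = 0" if "e \<in> E" for e
      by (rule mono_fns_independent[of T E, rotated 3]) (use E(1,2) that in auto)
    then show False using E(3) by blast
  qed
  moreover have "F q = 0" if q: "q \<in> sym_forms" and x: "x $ i0 = 1"
      and cl: "(line x, line (flat q x)) \<in> bizariski closure_of (lines ` N)" for q x
  proof -
    let ?g = "\<lambda>(x, y). \<Sum>e\<in>E. u e * (\<Prod>\<tau>\<in>T. completion i0 T x y (($) q) \<tau> ^ e \<tau>)"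
    have "(\<lambda>z. \<Sum>e\<in>E. u e * (\<Prod>\<tau>\<in>T. (\<lambda>(x, y). completion i0 T x y (($) q) \<tau>) z ^ e \<tau>)) \<in> mono_span UNIV pair_coord UNIV"
      by (intro pol_sum[OF E(1)] pol_prod pol_power completion_polynomial) simp
    moreover have "(\<lambda>z. \<Sum>e\<in>E. u e * (\<Prod>\<tau>\<in>T. (\<lambda>(x, y). completion i0 T x y (($) q) \<tau>) z ^ e \<tau>)) = ?g"
      by (simp add: fun_eq_iff)
    ultimately have g: "?g \<in> mono_span UNIV pair_coord UNIV" by (simp only:)
    have van: "?g (x, y) = 0" if xy: "(x, y) \<in> N" "x $ i0 = 1" for x y
    proof -
      obtain t where t: "x \<in> affine_cone X" "y = (\<Sum>j<c. t j *s mgrad (J j) x)" using N[OF xy(1)] by blast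
      then show ?thesis using rel xy(2) by (simp add: mgrad_vector)
    qed
    have "?g (x, flat q x) = 0"
      by (rule polynomial_vanishes_on_closure[OF scale g van cl x])
    then show ?thesis by (simp add: completion_flat[OF q x] F_def)
  qed
  ultimately show ?thesis using F by (intro exI[of _ b] exI[of _ F]) blast
qed

section \<open>Generic forms avoid the conormal variety\<close>

text \<open>A choice \<open>J\<close> of \<open>c\<close> equations yields the set of all combinations of their gradients over the cone
  of \<open>X\<close>. Finitely many such sets cover the conormal vectors at regular points, and closure commutes with
  finite unions. The sets may be larger than the conormal variety over the singular points, which does
  not affect the count of dimensions. If there are no conormal vectors, for instance if the dimension of \<open>X\<close> is infinite or
  full, then there is nothing to cover.\<close>

lemma conormal_pieces:
  fixes X :: "('k::alg_closed_field ^ 'n) set set"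
  assumes X: "closedin zariski X"
  shows "\<exists>\<J> c. finite \<J> \<and> (\<forall>J\<in>\<J>. \<forall>j<c. \<exists>d. homogeneous d (J j)) \<and>
    (\<J> \<noteq> {} \<longrightarrow> c \<ge> 1 \<and> (\<exists>r. variety_dim X = enat r \<and> c + r + 1 = CARD('n))) \<and>
    conormal_variety X \<subseteq> (\<Union>J\<in>\<J>. bizariski closure_of (lines `
      {(x, y). x \<in> affine_cone X \<and> (\<exists>t. y = (\<Sum>j<c. t j *s mgrad (J j) x))}))"
proof (cases "{(P, line y) | P y. P \<in> regular_points X \<and> y \<noteq> 0 \<and> embedded_tangent_space X P \<subseteq> hyperplane y} = {}")
  case True
  then have "conormal_variety X = {}" by (simp only: conormal_variety_def closure_of_empty)
  then show ?thesis by (intro exI[of _ "{}"] exI[of _ 0]) simp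
next
  case False
  let ?C = "{(P, line y) | P y. P \<in> regular_points X \<and> y \<noteq> 0 \<and> embedded_tangent_space X P \<subseteq> hyperplane y}"
  obtain G where G: "finite G" "G \<subseteq> vanishing_forms X"
    "\<forall>p\<in>vanishing_forms X. \<forall>x\<in>affine_cone X. mgrad p x \<in> vec.span ((\<lambda>q. mgrad q x) ` G)"
    using finite_gradient_generators[of X] by (elim exE conjE) (rule that)
  have rep: "\<exists>x. x \<noteq> 0 \<and> P = line x" if "P \<in> regular_points X" for P
    using that closedin_subset[OF X] unfolding regular_points_def topspace_zariski
    by (auto simp: in_proj_space_UNIV)
  obtain P0 y0 where P0: "P0 \<in> regular_points X" "y0 \<noteq> 0" "embedded_tangent_space X P0 \<subseteq> hyperplane y0"
    using False by blast
  have "enat (vec.dim (tangent_cone X P0)) = variety_dim X + 1" using P0(1) by (simp add: regular_points_def)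
  then obtain r where r: "variety_dim X = enat r" by (cases "variety_dim X") auto
  let ?c = "CARD('n) - (r + 1)"
  obtain x0 where x0: "x0 \<noteq> 0" "P0 = line x0" using rep[OF P0(1)] by blast
  have rn: "r + 1 < CARD('n)"
    by (rule conormal_vector_combination(1)[OF G _ x0(1) r P0(2)]) (use P0 x0 in auto)
  let ?\<J> = "{..<?c} \<rightarrow>\<^sub>E G"
  let ?N = "\<lambda>J. {(x, y). x \<in> affine_cone X \<and> (\<exists>t. y = (\<Sum>j<?c. t j *s mgrad (J j) x))}"
  have fin: "finite ?\<J>" using G(1) by (intro finite_PiE) auto
  have hom: "\<forall>J\<in>?\<J>. \<forall>j<?c. \<exists>d. homogeneous d (J j)"
    using G(2) unfolding vanishing_forms_def by (auto simp: PiE_iff)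
  have "?C \<subseteq> \<Union>((\<lambda>J. lines ` ?N J) ` ?\<J>)"
  proof
    fix z assume "z \<in> ?C"
    then obtain P y where Py: "z = (P, line y)" "P \<in> regular_points X" "y \<noteq> 0"
      "embedded_tangent_space X P \<subseteq> hyperplane y" by blast
    obtain x where x: "x \<noteq> 0" "P = line x" using rep[OF Py(2)] by blast
    have "\<exists>J\<in>?\<J>. \<exists>t. y = (\<Sum>j<?c. t j *s mgrad (J j) x)"
      by (rule conormal_vector_combination(2)[OF G _ x(1) r Py(3)]) (use Py x in auto)
    then obtain J t where J: "J \<in> ?\<J>" "y = (\<Sum>j<?c. t j *s mgrad (J j) x)" by blast
    have "x \<in> affine_cone X" using Py(2) x by (simp add: regular_points_def affine_cone_def)
    then have "(x, y) \<in> ?N J" using J(2) by blast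
    then have "z \<in> lines ` ?N J" unfolding Py(1) x(2) by (intro image_eqI[of _ _ "(x, y)"]) auto
    then show "z \<in> \<Union>((\<lambda>J. lines ` ?N J) ` ?\<J>)" using J(1) by blast
  qed
  then have "conormal_variety X \<subseteq> bizariski closure_of \<Union>((\<lambda>J. lines ` ?N J) ` ?\<J>)"
    unfolding conormal_variety_def by (rule closure_of_mono)
  also have "\<dots> = (\<Union>J\<in>?\<J>. bizariski closure_of (lines ` ?N J))"
    using fin by (subst closure_of_Union) auto
  finally have sub: "conormal_variety X \<subseteq> (\<Union>J\<in>?\<J>. bizariski closure_of (lines ` ?N J))" .
  have dims: "?\<J> \<noteq> {} \<longrightarrow> ?c \<ge> 1 \<and> (\<exists>r. variety_dim X = enat r \<and> ?c + r + 1 = CARD('n))"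
    by (intro impI conjI exI[of _ r]) (use rn r in simp_all)
  show ?thesis
    by (rule exI[of _ ?\<J>], rule exI[of _ ?c], intro conjI, rule fin, rule hom, rule dims, rule sub)
qed

theorem propositionA1:
  fixes X :: "('k::alg_closed_field ^ 'n) set set"
  assumes "CHAR('k) \<noteq> 2"
    and "projective_variety X"
    and "X \<subset> proj_space UNIV"
  shows "\<exists>U :: ('k ^ ('n \<times> 'n)) set set.
    openin sym_zariski U \<and> U \<noteq> {} \<and>
    (\<forall>q. q \<noteq> 0 \<and> line q \<in> U \<longrightarrow>
       nondegenerate q \<and> conormal_variety X \<inter> form_diagonal q = {})"
proof -
  have X: "closedin zariski X" using assms(2) by (simp add: projective_variety_def)
  obtain \<J> c where J: "finite \<J>" "\<forall>J\<in>\<J>. \<forall>j<c. \<exists>d. homogeneous d (J j)"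
    "\<J> \<noteq> {} \<longrightarrow> c \<ge> 1 \<and> (\<exists>r. variety_dim X = enat r \<and> c + r + 1 = CARD('n))"
    "conormal_variety X \<subseteq> (\<Union>J\<in>\<J>. bizariski closure_of (lines `
      {(x, y). x \<in> affine_cone X \<and> (\<exists>t. y = (\<Sum>j<c. t j *s mgrad (J j) x))}))"
    using conormal_pieces[OF X] by (elim exE conjE) (rule that)
  define N where "N = (\<lambda>J. {(x, y). x \<in> affine_cone X \<and> (\<exists>t. y = (\<Sum>j<c. t j *s mgrad (J j) x))})"
  define separates where "separates = (\<lambda>J i0 F. (\<exists>d. F \<in> forms d) \<and> (\<exists>q\<in>sym_forms. F q \<noteq> 0) \<and>
      (\<forall>q\<in>sym_forms. \<forall>x. x $ i0 = 1 \<and> (line x, line (flat q x)) \<in> bizariski closure_of (lines ` N J) \<longrightarrow> F q = 0))"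
  have "\<exists>F. separates J i0 F" if JJ: "J \<in> \<J>" for J i0
  proof -
    obtain r where r: "c \<ge> 1" "variety_dim X = enat r" "c + r + 1 = CARD('n)" using J(3) JJ by blast
    have scale: "(a *s x, b *s y) \<in> N J" if xy: "(x, y) \<in> N J" and ab: "a \<noteq> 0" "b \<noteq> 0" for x y a b
    proof -
      obtain t where t: "x \<in> affine_cone X" "y = (\<Sum>j<c. t j *s mgrad (J j) x)" using xy unfolding N_def by blast
      have "\<forall>j. \<exists>d. j < c \<longrightarrow> homogeneous d (J j)" using J(2) JJ by blast
      then obtain d where d: "\<And>j. j < c \<Longrightarrow> homogeneous (d j) (J j)" by metis
      have "a *s x \<in> affine_cone X" using t(1) ab(1) line_scale[OF ab(1), of x] by (simp add: affine_cone_def)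
      moreover have "b *s y = (\<Sum>j<c. (b * t j * (a / a ^ d j)) *s mgrad (J j) (a *s x))"
      proof -
        have "(b * t j * (a / a ^ d j)) *s mgrad (J j) (a *s x) = b *s (t j *s mgrad (J j) x)" if "j < c" for j
          using mgrad_scale[OF d[OF that] ab(1), of x] ab(1) by (simp add: vector_smult_assoc)
        then show ?thesis unfolding t(2) by (simp add: vec.scale_sum_right)
      qed
      then have "\<exists>t. b *s y = (\<Sum>j<c. t j *s mgrad (J j) (a *s x))"
        by (rule exI[of _ "\<lambda>j. b * t j * (a / a ^ d j)"])
      ultimately show ?thesis by (simp only: N_def mem_Collect_eq prod.case simp_thms)
    qed
    have "\<exists>d F. F \<in> forms d \<and> (\<exists>q\<in>sym_forms. F q \<noteq> 0) \<and>
      (\<forall>q\<in>sym_forms. \<forall>x. x $ i0 = 1 \<and> (line x, line (flat q x)) \<in> bizariski closure_of (lines ` N J) \<longrightarrow> F q = 0)"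
      by (rule bad_forms_in_hypersurface[OF hilbert_growth_variety_dim[OF X r(2)] r(1,3) scale, where J = J])
        (auto simp: N_def)
    then obtain d F where "F \<in> forms d \<and> (\<exists>q\<in>sym_forms. F q \<noteq> 0) \<and>
      (\<forall>q\<in>sym_forms. \<forall>x. x $ i0 = 1 \<and> (line x, line (flat q x)) \<in> bizariski closure_of (lines ` N J) \<longrightarrow> F q = 0)"
      by (elim exE) (rule that)
    then have "separates J i0 F" unfolding separates_def by (intro conjI exI[of _ d]) simp_all
    then show ?thesis by (rule exI[of _ F])
  qed
  then obtain F where sep: "\<And>J i0. J \<in> \<J> \<Longrightarrow> separates J i0 (F J i0)" by metis
  have F: "\<And>J i0. J \<in> \<J> \<Longrightarrow> \<exists>d. F J i0 \<in> forms d"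
    "\<And>J i0. J \<in> \<J> \<Longrightarrow> \<exists>q\<in>sym_forms. F J i0 q \<noteq> 0"
    "\<And>J i0 q x. J \<in> \<J> \<Longrightarrow> q \<in> sym_forms \<Longrightarrow> x $ i0 = 1 \<Longrightarrow>
      (line x, line (flat q x)) \<in> bizariski closure_of (lines ` N J) \<Longrightarrow> F J i0 q = 0"
    using sep unfolding separates_def by blast+
  let ?\<F> = "insert form_det ((\<lambda>(J, i0). F J i0) ` (\<J> \<times> UNIV))"
  have finF: "finite ?\<F>" using J(1) by simp
  have goodF: "(\<exists>d. f \<in> forms d) \<and> (\<exists>q\<in>sym_forms. f q \<noteq> 0)" if f: "f \<in> ?\<F>" for f
  proof (cases "f = form_det")
    case True
    then show ?thesis using form_det_form form_det_nonzero_somewhere by blast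
  next
    case False
    then obtain J i0 where "J \<in> \<J>" "f = F J i0" using f by auto
    then show ?thesis using F(1,2) by simp
  qed
  have "\<exists>d \<Phi>. \<Phi> \<in> forms d \<and> (\<exists>q\<in>sym_forms. \<Phi> q \<noteq> 0) \<and> (\<forall>q. \<Phi> q \<noteq> 0 \<longrightarrow> (\<forall>f\<in>?\<F>. f q \<noteq> 0))"
    by (rule common_nonvanishing_form[OF finF]) (rule goodF)
  then obtain d \<Phi> where \<Phi>: "\<Phi> \<in> forms d" "\<exists>q\<in>sym_forms. \<Phi> q \<noteq> 0" "\<forall>q. \<Phi> q \<noteq> 0 \<longrightarrow> (\<forall>f\<in>?\<F>. f q \<noteq> 0)"
    by (elim exE conjE) (rule that)
  define V where "V = {P \<in> proj_space UNIV. \<exists>q\<in>P. \<Phi> q \<noteq> 0}"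
  let ?U = "V \<inter> proj_space sym_forms"
  have "openin sym_zariski ?U"
    unfolding sym_zariski_def using openin_zariski_form[OF \<Phi>(1)] V_def by (metis openin_subtopology_Int)
  moreover have "?U \<noteq> {}"
  proof -
    obtain q where q: "q \<in> sym_forms" "\<Phi> q \<noteq> 0" using \<Phi>(2) by blast
    then have "form_det q \<noteq> 0" using \<Phi>(3) by blast
    then have "q \<noteq> 0" using form_det_zero by blast
    then have "line q \<in> ?U"
      using q line_self[of q] unfolding V_def proj_space_def by blast
    then show ?thesis by blast
  qed
  moreover have "nondegenerate q \<and> conormal_variety X \<inter> form_diagonal q = {}" if q: "q \<noteq> 0" "line q \<in> ?U" for q
  proof -
    obtain q' where q': "q' \<in> sym_forms" "line q' = line q" using q(2) unfolding proj_space_def by auto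
    obtain a where "q = a *s q'" using line_eq_imp_scale[OF q'(2) q(1)] by blast
    then have sym: "q \<in> sym_forms" using q'(1) by (simp add: sym_forms_iff)
    have "\<Phi> q \<noteq> 0" using q(2) line_nonvanishing_iff[OF \<Phi>(1), of q] unfolding V_def by blast
    then have ne: "\<forall>f\<in>?\<F>. f q \<noteq> 0" using \<Phi>(3) by blast
    then have det: "form_det q \<noteq> 0" by blast
    have "z \<notin> form_diagonal q" if z: "z \<in> conormal_variety X" for z
    proof
      assume "z \<in> form_diagonal q"
      then obtain x where x: "x \<noteq> 0" "z = (line x, line (flat q x))"
        using form_diagonal_points[OF det, of "fst z" "snd z"] by (metis prod.collapse)
      obtain J where J': "J \<in> \<J>" "z \<in> bizariski closure_of (lines ` N J)" using J(4) z unfolding N_def by blast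
      obtain i0 where i0: "x $ i0 \<noteq> 0" using x(1) by (auto simp: vec_eq_iff)
      \<comment> \<open>Rescaled, \<open>x\<close> lies in the chart to which the form \<open>F J i0\<close> belongs.\<close>
      let ?x = "(1 / x $ i0) *s x"
      have "line ?x = line x" by (rule line_scale) (use i0 in simp)
      moreover have "flat q ?x = (1 / x $ i0) *s flat q x"
        by (simp add: flat_def vec_eq_iff sum_divide_distrib)
      then have "line (flat q ?x) = line (flat q x)" using line_scale[of "1 / x $ i0" "flat q x"] i0 by simp
      ultimately have "F J i0 q = 0"
        using F(3)[OF J'(1) sym, of ?x i0] J'(2) x(2) i0 by simp
      then show False using ne J'(1) by blast
    qed
    then show ?thesis using nondegenerate_if_form_det[OF det] by blast
  qed
  ultimately show ?thesis by (intro exI[of _ ?U] conjI allI impI) blast+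
qed

end
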